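(* Let $d\ge1$ be an integer and $T>0$. Let $p,q$ be positive real numbers with $\frac1p+\frac1q\le\frac12$, let $b\in L^2([0,T];L^p(\mathbb{T}^d))$ be a divergence-free vector field and let $w\in L^\infty([0,T];L^q(\mathbb{T}^d))$. Let $(\rho^\delta)_{\delta>0}$ be a family of smooth convolution kernels on $\mathbb{T}^d$ and define the commutator $$r^\delta:=b\cdot\nabla(w*\rho^\delta)-(b\cdot\nabla w)*\rho^\delta,$$ where, since $b$ is divergence-free, $b\cdot\nabla w$ is understood as the distribution $\operatorname{div}(bw)$ (and likewise $b\cdot\nabla(w*\rho^\delta)=\operatorname{div}(b\,(w*\rho^\delta))$). Then $r^\delta\to0$ in $L^2([0,T];H^{-1}(\mathbb{T}^d))$ as $\delta\to0$.
   Context: $\mathbb{T}^d=\mathbb{R}^d/\mathbb{Z}^d$ is the flat torus. A vector field $b:[0,T]\times\mathbb{T}^d\to\mathbb{R}^d$ is divergence-free if $\operatorname{div}_x b=0$ in the sense of distributions. Convolutions are in the space variable only. Smooth convolution kernels: $\rho^\delta(y)=\delta^{-d}\rho(y/\delta)$ (regarded as a function on the torus for small $\delta$), where $\rho\in C_c^\infty(\mathbb{R}^d)$, $\rho\ge0$, $\int\rho=1$. $H^{-1}(\mathbb{T}^d)$ is the dual of $H^1(\mathbb{T}^d)=W^{1,2}(\mathbb{T}^d)$. *)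

theory Defs
  imports "HOL-Analysis.Analysis"
begin

text \<open>
  Functions on the torus \<open>\<real>\<^sup>d / \<int>\<^sup>d\<close>, \<open>d = CARD('n)\<close>, are
  \<open>\<int>\<^sup>d\<close>-periodic functions on \<open>real ^ 'n\<close>, integrated over the unit cube. Elements of
  function spaces are represented by functions; a.e.-equal functions are not identified.
\<close>

definition torus_periodic :: "(real ^ 'n \<Rightarrow> 'b) \<Rightarrow> bool" where
  "torus_periodic f \<longleftrightarrow> (\<forall>k. (\<forall>i. k $ i \<in> \<int>) \<longrightarrow> (\<forall>x. f (x + k) = f x))"

abbreviation torus_measure :: "(real ^ 'n) measure" where
  "torus_measure \<equiv> lebesgue_on (cbox 0 1)"


subsection \<open>Smooth functions\<close>

primrec Ck_function :: "nat \<Rightarrow> ('a::real_normed_vector \<Rightarrow> 'b::real_normed_vector) \<Rightarrow> bool" where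
  "Ck_function 0 f \<longleftrightarrow> continuous_on UNIV f"
| "Ck_function (Suc k) f \<longleftrightarrow> (\<forall>x. f differentiable at x) \<and>
     (\<forall>v. Ck_function k (\<lambda>x. frechet_derivative f (at x) v))"

definition smooth_function :: "('a::real_normed_vector \<Rightarrow> 'b::real_normed_vector) \<Rightarrow> bool" where
  "smooth_function f \<longleftrightarrow> (\<forall>k. Ck_function k f)"

definition grad :: "(real ^ 'n \<Rightarrow> real) \<Rightarrow> real ^ 'n \<Rightarrow> real ^ 'n" where
  "grad f x = (\<chi> i. frechet_derivative f (at x) (axis i 1))"

definition torus_smooth :: "(real ^ 'n \<Rightarrow> real) set" where
  "torus_smooth = {\<phi>. smooth_function \<phi> \<and> torus_periodic \<phi>}"

text \<open>Test functions on \<open>(0,T) \<times> torus\<close>, extended by zero to all times.\<close>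

definition spacetime_test :: "real \<Rightarrow> (real \<times> (real ^ 'n) \<Rightarrow> real) set" where
  "spacetime_test T = {\<phi>. smooth_function \<phi> \<and> (\<forall>t. torus_periodic (\<lambda>x. \<phi> (t, x))) \<and>
     (\<exists>a c. 0 < a \<and> c < T \<and> (\<forall>t x. t \<notin> {a..c} \<longrightarrow> \<phi> (t, x) = 0))}"


subsection \<open>Lebesgue and Sobolev spaces on the torus\<close>

definition torus_Lp :: "real \<Rightarrow> (real ^ 'n \<Rightarrow> 'b::euclidean_space) set" where
  "torus_Lp p = {f. torus_periodic f \<and> f \<in> borel_measurable lebesgue \<and>
     integrable torus_measure (\<lambda>x. norm (f x) powr p)}"

definition torus_Lp_norm :: "real \<Rightarrow> (real ^ 'n \<Rightarrow> 'b::euclidean_space) \<Rightarrow> real" where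
  "torus_Lp_norm p f = (\<integral>x. norm (f x) powr p \<partial>torus_measure) powr (1 / p)"

definition has_weak_grad :: "(real ^ 'n \<Rightarrow> real) \<Rightarrow> (real ^ 'n \<Rightarrow> real ^ 'n) \<Rightarrow> bool" where
  "has_weak_grad f g \<longleftrightarrow> (\<forall>\<phi>\<in>torus_smooth. \<forall>i.
     (\<integral>x. f x * grad \<phi> x $ i \<partial>torus_measure) = - (\<integral>x. g x $ i * \<phi> x \<partial>torus_measure))"

definition torus_H1 :: "(real ^ 'n \<Rightarrow> real) set" where
  "torus_H1 = {f \<in> torus_Lp 2. \<exists>g\<in>torus_Lp 2. has_weak_grad f g}"

text \<open>The choice below is immaterial: weak gradients are unique up to null sets.\<close>

definition weak_grad :: "(real ^ 'n \<Rightarrow> real) \<Rightarrow> real ^ 'n \<Rightarrow> real ^ 'n" where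
  "weak_grad f = (SOME g. g \<in> torus_Lp 2 \<and> has_weak_grad f g)"

definition torus_H1_norm :: "(real ^ 'n \<Rightarrow> real) \<Rightarrow> real" where
  "torus_H1_norm f = sqrt ((torus_Lp_norm 2 f)\<^sup>2 + (torus_Lp_norm 2 (weak_grad f))\<^sup>2)"

text \<open>
  Only the values of a functional on \<open>torus_H1\<close> are constrained. Boundedness makes it respect
  a.e. equality.
\<close>

definition torus_Hm1 :: "((real ^ 'n \<Rightarrow> real) \<Rightarrow> real) set" where
  "torus_Hm1 = {\<Lambda>.
     (\<forall>f\<in>torus_H1. \<forall>g\<in>torus_H1. \<Lambda> (\<lambda>x. f x + g x) = \<Lambda> f + \<Lambda> g) \<and>
     (\<forall>f\<in>torus_H1. \<forall>c. \<Lambda> (\<lambda>x. c * f x) = c * \<Lambda> f) \<and>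
     (\<exists>C. \<forall>f\<in>torus_H1. \<bar>\<Lambda> f\<bar> \<le> C * torus_H1_norm f)}"

definition torus_Hm1_norm :: "((real ^ 'n \<Rightarrow> real) \<Rightarrow> real) \<Rightarrow> real" where
  "torus_Hm1_norm \<Lambda> = (SUP f\<in>{f \<in> torus_H1. torus_H1_norm f \<le> 1}. \<bar>\<Lambda> f\<bar>)"


subsection \<open>Bochner spaces on a time interval\<close>

text \<open>
  The target space is given by a carrier \<open>X\<close> and a (semi)norm \<open>nrm\<close>; strong measurability means
  being an a.e. limit of simple functions.
\<close>

definition strongly_measurable ::
    "real \<Rightarrow> 'c::minus set \<Rightarrow> ('c \<Rightarrow> real) \<Rightarrow> (real \<Rightarrow> 'c) \<Rightarrow> bool" where
  "strongly_measurable T X nrm f \<longleftrightarrow> (\<exists>s.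
     (\<forall>n::nat. simple_function (lebesgue_on {0..T}) (s n) \<and> s n ` {0..T} \<subseteq> X) \<and>
     (AE t in lebesgue_on {0..T}. f t \<in> X \<and> (\<lambda>n. nrm (f t - s n t)) \<longlonglongrightarrow> 0))"

definition bochner_L2 :: "real \<Rightarrow> 'c::minus set \<Rightarrow> ('c \<Rightarrow> real) \<Rightarrow> (real \<Rightarrow> 'c) set" where
  "bochner_L2 T X nrm = {f. strongly_measurable T X nrm f \<and>
     integrable (lebesgue_on {0..T}) (\<lambda>t. (nrm (f t))\<^sup>2)}"

definition bochner_L2_norm :: "real \<Rightarrow> ('c \<Rightarrow> real) \<Rightarrow> (real \<Rightarrow> 'c) \<Rightarrow> real" where
  "bochner_L2_norm T nrm f = sqrt (\<integral>t. (nrm (f t))\<^sup>2 \<partial>lebesgue_on {0..T})"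

definition bochner_Linf :: "real \<Rightarrow> 'c::minus set \<Rightarrow> ('c \<Rightarrow> real) \<Rightarrow> (real \<Rightarrow> 'c) set" where
  "bochner_Linf T X nrm = {f. strongly_measurable T X nrm f \<and>
     (\<exists>C. AE t in lebesgue_on {0..T}. nrm (f t) \<le> C)}"


subsection \<open>Divergence, mollification and the commutator\<close>

definition divergence_free :: "real \<Rightarrow> (real \<Rightarrow> real ^ 'n \<Rightarrow> real ^ 'n) \<Rightarrow> bool" where
  "divergence_free T b \<longleftrightarrow> (\<forall>\<phi>\<in>spacetime_test T.
     (\<integral>t. (\<integral>x. b t x \<bullet> grad (\<lambda>y. \<phi> (t, y)) x \<partial>torus_measure) \<partial>lebesgue_on {0..T}) = 0)"

definition convolution_kernel :: "(real ^ 'n \<Rightarrow> real) \<Rightarrow> bool" where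
  "convolution_kernel \<rho> \<longleftrightarrow> smooth_function \<rho> \<and> compact (closure {y. \<rho> y \<noteq> 0}) \<and>
     (\<forall>y. \<rho> y \<ge> 0) \<and> (\<integral>y. \<rho> y \<partial>lebesgue) = 1"

definition rescaled :: "(real ^ 'n \<Rightarrow> real) \<Rightarrow> real \<Rightarrow> real ^ 'n \<Rightarrow> real" where
  "rescaled \<rho> \<delta> y = \<rho> (y /\<^sub>R \<delta>) / \<delta> ^ CARD('n)"

text \<open>
  For periodic \<open>f\<close>, integrating against a kernel \<open>k\<close> on the whole space is the same as
  convolving on the torus with the periodization of \<open>k\<close>.
\<close>

definition torus_conv :: "(real ^ 'n \<Rightarrow> real) \<Rightarrow> (real ^ 'n \<Rightarrow> real) \<Rightarrow> real ^ 'n \<Rightarrow> real" where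
  "torus_conv f k x = (\<integral>y. f (x - y) * k y \<partial>lebesgue)"

text \<open>Distributions on the torus are functionals evaluated on \<open>torus_smooth\<close>.\<close>

definition distr_div :: "(real ^ 'n \<Rightarrow> real ^ 'n) \<Rightarrow> (real ^ 'n \<Rightarrow> real) \<Rightarrow> real" where
  "distr_div F \<phi> = - (\<integral>x. F x \<bullet> grad \<phi> x \<partial>torus_measure)"

definition distr_conv ::
    "((real ^ 'n \<Rightarrow> real) \<Rightarrow> real) \<Rightarrow> (real ^ 'n \<Rightarrow> real) \<Rightarrow> (real ^ 'n \<Rightarrow> real) \<Rightarrow> real" where
  "distr_conv u k \<phi> = u (torus_conv \<phi> (\<lambda>y. k (- y)))"

text \<open>\<open>b \<cdot> \<nabla> w\<close> for a divergence-free \<open>b\<close>, in conservative form.\<close>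

definition transport ::
    "(real ^ 'n \<Rightarrow> real ^ 'n) \<Rightarrow> (real ^ 'n \<Rightarrow> real) \<Rightarrow> (real ^ 'n \<Rightarrow> real) \<Rightarrow> real" where
  "transport b w = distr_div (\<lambda>x. w x *\<^sub>R b x)"

definition commutator ::
    "(real ^ 'n \<Rightarrow> real) \<Rightarrow> (real ^ 'n \<Rightarrow> real ^ 'n) \<Rightarrow> (real ^ 'n \<Rightarrow> real)
      \<Rightarrow> (real ^ 'n \<Rightarrow> real) \<Rightarrow> real" where
  "commutator k b w \<phi> = transport b (torus_conv w k) \<phi> - distr_conv (transport b w) k \<phi>"

text \<open>
  A time-dependent distribution \<open>u\<close> is identified with the \<open>H\<^sup>1\<close>-functional-valued function
  \<open>R\<close> extending it from smooth functions at almost every time; as smooth functions are dense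
  in \<open>H\<^sup>1\<close>, \<open>R\<close> is determined on \<open>H\<^sup>1\<close> for almost every time.
\<close>

definition represents_L2_Hm1 ::
    "real \<Rightarrow> (real \<Rightarrow> (real ^ 'n \<Rightarrow> real) \<Rightarrow> real) \<Rightarrow> (real \<Rightarrow> (real ^ 'n \<Rightarrow> real) \<Rightarrow> real) \<Rightarrow> bool" where
  "represents_L2_Hm1 T R u \<longleftrightarrow> R \<in> bochner_L2 T torus_Hm1 torus_Hm1_norm \<and>
     (AE t in lebesgue_on {0..T}. \<forall>\<phi>\<in>torus_smooth. R t \<phi> = u t \<phi>)"

end

theory Submission
  imports Defs
begin

text \<open>
  The commutator is, up to sign, the divergence of a single vector field. Moving the mollifier onto the test
  function and translating the torus gives, for smooth \<open>\<phi>\<close> and at almost every time,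
  \<open>commutator k b w \<phi> = (\<integral>x. G x \<bullet> grad \<phi> x)\<close> with
  \<open>G x = (\<integral>y. k y *\<^sub>R (w (x - y) *\<^sub>R (b (x - y) - b x)))\<close>
  (\<open>commutator_eq_integral_field\<close>). Its norm in \<open>H\<^sup>-\<^sup>1\<close> is therefore at most the norm of \<open>G\<close> in
  \<open>L\<^sup>2\<close>, and everything is an estimate of \<open>G\<close>, called \<open>commutator_field\<close> below.

  Jensen's inequality for the probability density \<open>k\<close> and Hoelder's inequality bound the norm of \<open>G\<close>
  by the norm of \<open>w\<close> in \<open>L\<^sup>q\<close> times the largest norm in \<open>L\<^sup>p\<close> of an increment \<open>b (x - y) - b x\<close> with \<open>y\<close>
  in the support of \<open>k\<close>. Since \<open>p\<close> is finite and exceeds two, translations are continuous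
  in \<open>L\<^sup>p\<close> (\<open>translation_continuous_Lp\<close>), and \<open>G\<close> tends to zero as the kernels concentrate, at almost
  every time (\<open>commutator_field_small\<close>). Bounding the increment by twice the norm of \<open>b\<close> instead
  gives a bound uniform in the kernel (\<open>commutator_field_L2\<close>), whose square is integrable in time by
  the hypotheses on \<open>b\<close> and \<open>w\<close>. Dominated convergence in time concludes.

  Two points remain. The functional \<open>\<phi> \<mapsto> (\<integral>x. G x \<bullet> grad \<phi> x)\<close> extends to the whole Sobolev space by
  weak gradients; it is linear there because weak gradients are unique up to null sets. This
  uniqueness is obtained from the same estimate with \<open>w = 1\<close>, for which \<open>G\<close> is the mollification
  error of \<open>b\<close> (\<open>torus_fundamental_lemma\<close>). Strong measurability in time holds because \<open>G\<close> is bilinear in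
  \<open>(b, w)\<close> and bounded, so that simple functions approximating \<open>b\<close> and \<open>w\<close> yield simple functions
  approximating the commutator (\<open>flux_commutator_field_diff\<close>).

  Functions on the torus are only Lebesgue measurable, whereas Tonelli's theorem for the maps
  \<open>(x, y) \<mapsto> w (x - y)\<close> needs Borel functions. Each function is therefore replaced by a periodic Borel
  representative, which changes no integral.
\<close>

section \<open>The unit cube as a measure space\<close>

text \<open>
  Normalised Lebesgue measure of the cube, spread over the whole space as a density. Its
  measurable sets are exactly the Borel sets, so that Tonelli's theorem applies to jointly Borel
  functions on its product with \<open>lborel\<close>. For a merely Lebesgue measurable \<open>w\<close> the map
  \<open>(x, y) \<mapsto> w (x - y)\<close> need not be measurable on a product of completed measures.
\<close>

definition unit_cube :: "(real ^ 'n) measure" where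
  "unit_cube = density lborel (indicator (cbox 0 1))"

lemma sets_unit_cube [simp, measurable_cong]: "sets unit_cube = sets borel"
  by (simp add: unit_cube_def)

lemma space_unit_cube [simp]: "space unit_cube = UNIV"
  by (simp add: unit_cube_def)

lemma nn_integral_unit_cube:
  assumes [measurable]: "f \<in> borel_measurable borel"
  shows "(\<integral>\<^sup>+x. f x \<partial>unit_cube) = (\<integral>\<^sup>+x. f x * indicator (cbox 0 1) x \<partial>lborel)"
  unfolding unit_cube_def by (subst nn_integral_density) (auto simp: mult.commute)

lemma emeasure_unit_cube: "emeasure (unit_cube :: (real ^ 'n) measure) UNIV = 1"
proof -
  have "emeasure lborel (cbox 0 1 :: (real ^ 'n) set) = ennreal (measure lborel (cbox 0 1 :: (real ^ 'n) set))"
    by (rule emeasure_eq_ennreal_measure) (simp add: emeasure_lborel_cbox_eq)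
  also have "measure lborel (cbox 0 1 :: (real ^ 'n) set) = 1"
    using content_cbox_cart[of "0 :: real ^ 'n" 1]
    by (simp add: interval_ne_empty_cart)
  finally show ?thesis
    unfolding unit_cube_def by (simp add: emeasure_density nn_integral_indicator)
qed

interpretation unit_cube: finite_measure "unit_cube :: (real ^ 'n) measure"
  by standard (simp add: emeasure_unit_cube)

interpretation cube_space: pair_sigma_finite "unit_cube :: (real ^ 'n) measure" "lborel :: (real ^ 'n) measure" ..

lemma AE_lborel_imp_unit_cube:
  assumes "AE x in lborel. P x" shows "AE x in unit_cube. P x"
  unfolding unit_cube_def using assms by (subst AE_density) auto

lemma AE_unit_cube_imp_torus:
  assumes "AE x in unit_cube. P x" shows "AE x in torus_measure. P x"
proof -
  have "AE x in lborel. x \<in> cbox 0 1 \<longrightarrow> P x"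
    using assms unfolding unit_cube_def
    by (subst (asm) AE_density) (auto simp: indicator_def)
  then show ?thesis
    by (subst AE_restrict_space_iff) (auto simp: AE_completion)
qed

lemma AE_lborel_imp_torus:
  "AE x in lborel. P x \<Longrightarrow> AE x in torus_measure. P x"
  by (intro AE_unit_cube_imp_torus AE_lborel_imp_unit_cube)

lemma nn_integral_torus_measure:
  assumes "f \<in> borel_measurable borel"
  shows "(\<integral>\<^sup>+x. f x \<partial>torus_measure) = (\<integral>\<^sup>+x. f x \<partial>unit_cube)"
  by (subst nn_integral_restrict_space)
    (auto simp: nn_integral_completion nn_integral_unit_cube[OF assms])

lemma borel_measurable_torus_measure:
  "f \<in> borel_measurable lebesgue \<Longrightarrow> f \<in> borel_measurable torus_measure"
  by (rule measurable_restrict_space1)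

lemma borel_imp_lebesgue: "f \<in> borel_measurable borel \<Longrightarrow> f \<in> borel_measurable lebesgue"
  by (rule measurable_completion) simp

lemma integral_torus_measure:
  fixes f :: "real ^ 'n \<Rightarrow> 'b::euclidean_space"
  assumes [measurable]: "f \<in> borel_measurable borel"
  shows "(\<integral>x. f x \<partial>torus_measure) = (\<integral>x. f x \<partial>unit_cube)"
proof -
  have "(\<integral>x. f x \<partial>torus_measure) = (\<integral>x. indicator (cbox 0 1) x *\<^sub>R f x \<partial>lebesgue)"
    by (subst integral_restrict_space) auto
  also have "\<dots> = (\<integral>x. indicator (cbox 0 1) x *\<^sub>R f x \<partial>lborel)"
    by (rule integral_completion) measurable
  also have "\<dots> = (\<integral>x. f x \<partial>density lborel (\<lambda>x. ennreal (indicator (cbox 0 1) x)))"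
    by (subst integral_density) auto
  finally show ?thesis by (simp add: unit_cube_def ennreal_indicator)
qed

section \<open>Translation invariance on the torus\<close>

lemma lattice_countable: "countable {k :: real ^ 'n. \<forall>i. k $ i \<in> \<int>}"
  using countable_vector[of "\<lambda>_. \<int>"] by (simp add: countable_int)

text \<open>
  The half-open cube meets every orbit of the lattice in exactly one point. It replaces the closed
  cube, from which it differs by a null set, in every counting argument.
\<close>

definition fundamental_cell :: "(real ^ 'n) set" where
  "fundamental_cell = {x. \<forall>i. 0 \<le> x $ i \<and> x $ i < 1}"

lemma fundamental_cell_borel [measurable]: "fundamental_cell \<in> sets borel"
  unfolding fundamental_cell_def by measurable

definition cell_part :: "real ^ 'n \<Rightarrow> real ^ 'n" where
  "cell_part x = (\<chi> i. frac (x $ i))"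

lemma cell_part_eq: "cell_part x = x + (\<chi> i. - of_int \<lfloor>x $ i\<rfloor>)"
  by (simp add: cell_part_def vec_eq_iff frac_def)

lemma torus_periodic_cell_part: "torus_periodic f \<Longrightarrow> f (cell_part x) = f x"
  unfolding torus_periodic_def cell_part_eq by auto

lemma cell_part_measurable [measurable]: "cell_part \<in> borel_measurable borel"
proof -
  have "(\<lambda>x :: real ^ 'n. cell_part x $ i) \<in> borel_measurable borel" for i
    unfolding cell_part_def frac_def by simp
  then have "(\<lambda>x :: real ^ 'n. cell_part x \<bullet> j) \<in> borel_measurable borel" if "j \<in> Basis" for j
    using that by (auto simp: Basis_vec_def inner_axis)
  then show ?thesis by (subst borel_measurable_euclidean_space) auto
qed

lemma cell_part_periodic:
  fixes g :: "real ^ 'n \<Rightarrow> 'b"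
  shows "torus_periodic (\<lambda>x. g (cell_part x))"
  unfolding torus_periodic_def
proof (intro allI impI)
  fix k x :: "real ^ 'n" assume "\<forall>i. k $ i \<in> \<int>"
  then have "frac (x $ i + k $ i) = frac (x $ i)" for i
    by (auto simp: frac_def elim!: Ints_cases dest!: spec[of _ i])
  then show "g (cell_part (x + k)) = g (cell_part x)"
    by (simp add: cell_part_def)
qed

lemma count_lattice_cell:
  fixes x :: "real ^ 'n"
  shows "(\<integral>\<^sup>+k. indicator fundamental_cell (x + k) \<partial>count_space {k. \<forall>i. k $ i \<in> \<int>}) = 1"
proof -
  define Z :: "(real ^ 'n) set" where "Z = {k. \<forall>i. k $ i \<in> \<int>}"
  define k0 :: "real ^ 'n" where "k0 = (\<chi> i. - of_int \<lfloor>x $ i\<rfloor>)"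
  have k0: "k0 \<in> Z" by (simp add: k0_def Z_def)
  have "x + k \<in> fundamental_cell \<longleftrightarrow> k = k0" if "k \<in> Z" for k
  proof
    assume "k = k0" then show "x + k \<in> fundamental_cell"
      by (simp add: k0_def fundamental_cell_def) linarith
  next
    assume a: "x + k \<in> fundamental_cell"
    show "k = k0" unfolding vec_eq_iff
    proof
      fix i
      from that obtain m where m: "k $ i = of_int m" by (auto simp: Z_def elim: Ints_cases)
      have "0 \<le> x $ i + of_int m" "x $ i + of_int m < 1"
        using a m by (auto simp: fundamental_cell_def dest: spec[of _ i])
      then have "\<lfloor>x $ i\<rfloor> = - m" by linarith
      then show "k $ i = k0 $ i" by (simp add: k0_def m)
    qed
  qed
  then have "(\<integral>\<^sup>+k. indicator fundamental_cell (x + k) \<partial>count_space Z) =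
      (\<integral>\<^sup>+k. indicator {k0} k \<partial>count_space Z)"
    by (intro nn_integral_cong) (auto simp: indicator_def)
  also have "\<dots> = 1" using k0 by simp
  finally show ?thesis by (simp add: Z_def)
qed

lemma nn_integral_lborel_shift:
  fixes f :: "'a::euclidean_space \<Rightarrow> ennreal"
  assumes [measurable]: "f \<in> borel_measurable borel"
  shows "(\<integral>\<^sup>+x. f (x + a) \<partial>lborel) = (\<integral>\<^sup>+x. f x \<partial>lborel)"
proof -
  have "(\<integral>\<^sup>+x. f x \<partial>lborel) = (\<integral>\<^sup>+x. f x \<partial>distr lborel borel (\<lambda>x. x + a))"
    using lborel_distr_plus[of a] by (simp add: add.commute[of _ a])
  also have "\<dots> = (\<integral>\<^sup>+x. f (x + a) \<partial>lborel)"
    by (subst nn_integral_distr) auto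
  finally show ?thesis by simp
qed

lemma AE_indicator_cell: "AE x :: real ^ 'n in lborel. (indicator (cbox 0 1) x :: ennreal) = indicator fundamental_cell x"
proof -
  have "negligible (cbox 0 1 - box 0 1 :: (real ^ 'n) set)"
    by (rule negligible_frontier_interval)
  then have "AE x :: real ^ 'n in lebesgue. x \<notin> cbox 0 1 - box 0 1"
    by (intro AE_not_in) (simp add: negligible_iff_null_sets)
  then have "AE x :: real ^ 'n in lborel. x \<notin> cbox 0 1 - box 0 1"
    by (simp add: AE_completion_iff)
  then show ?thesis
    by eventually_elim (auto simp: indicator_def fundamental_cell_def mem_box_cart less_imp_le)
qed

lemma nn_integral_unit_cube_cell:
  assumes [measurable]: "f \<in> borel_measurable borel"
  shows "(\<integral>\<^sup>+x. f x \<partial>unit_cube) = (\<integral>\<^sup>+x. f x * indicator fundamental_cell x \<partial>lborel)"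
  unfolding nn_integral_unit_cube[OF assms]
  by (rule nn_integral_cong_AE) (use AE_indicator_cell in eventually_elim, simp)

text \<open>
  The integer translates of a cell tile space, and so do those of the translated cell. Inserting the
  partition of unity \<open>1 = (\<Sum>k. indicator cell (x + k))\<close>, moving each summand back by its lattice
  vector, which does not change the periodic \<open>f\<close>, and summing the other way exchanges the two cells.
\<close>

lemma nn_integral_torus_shift:
  fixes f :: "real ^ 'n \<Rightarrow> ennreal"
  assumes f [measurable]: "f \<in> borel_measurable borel" and per: "torus_periodic f"
  shows "(\<integral>\<^sup>+x. f (x + a) \<partial>unit_cube) = (\<integral>\<^sup>+x. f x \<partial>unit_cube)"
proof -
  define Z :: "(real ^ 'n) set" where "Z = {k. \<forall>i. k $ i \<in> \<int>}"
  have Z: "countable Z" unfolding Z_def by (rule lattice_countable)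
  let ?C = "indicator fundamental_cell :: real ^ 'n \<Rightarrow> ennreal"
  have one: "(\<integral>\<^sup>+k. ?C (x + k) \<partial>count_space Z) = 1" for x
    unfolding Z_def by (rule count_lattice_cell)
  have one': "(\<integral>\<^sup>+k. ?C (x - k) \<partial>count_space Z) = 1" for x
  proof -
    have bij: "bij_betw uminus Z Z"
      by (rule bij_betw_byWitness[where f' = uminus]) (auto simp: Z_def)
    show ?thesis
      using nn_integral_bij_count_space[OF bij, of "\<lambda>k. ?C (x + k)"] one[of x] by simp
  qed
  have "(\<integral>\<^sup>+x. f (x + a) \<partial>unit_cube) = (\<integral>\<^sup>+x. f (x + a) * ?C (x + a - a) \<partial>lborel)"
    by (subst nn_integral_unit_cube_cell) auto
  also have "\<dots> = (\<integral>\<^sup>+x. f x * ?C (x - a) \<partial>lborel)"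
    by (rule nn_integral_lborel_shift) measurable
  also have "\<dots> = (\<integral>\<^sup>+x. (\<integral>\<^sup>+k. f x * ?C (x - a) * ?C (x + k) \<partial>count_space Z) \<partial>lborel)"
    by (simp add: nn_integral_cmult one)
  also have "\<dots> = (\<integral>\<^sup>+k. (\<integral>\<^sup>+x. f x * ?C (x - a) * ?C (x + k) \<partial>lborel) \<partial>count_space Z)"
    by (subst nn_integral_count_space_nn_integral[OF Z]) auto
  also have "\<dots> = (\<integral>\<^sup>+k. (\<integral>\<^sup>+x. f x * ?C (x - a - k) * ?C x \<partial>lborel) \<partial>count_space Z)"
  proof (rule nn_integral_cong)
    fix k :: "real ^ 'n" assume "k \<in> space (count_space Z)"
    then have k: "\<forall>i. k $ i \<in> \<int>" by (simp add: Z_def)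
    have fk: "f (x + k) = f x" for x using per k by (auto simp: torus_periodic_def)
    have "(\<integral>\<^sup>+x. f x * ?C (x - a) * ?C (x + k) \<partial>lborel) =
        (\<integral>\<^sup>+x. f (x + k) * ?C ((x + k) - a - k) * ?C (x + k) \<partial>lborel)"
      by (simp add: fk algebra_simps)
    also have "\<dots> = (\<integral>\<^sup>+x. f x * ?C (x - a - k) * ?C x \<partial>lborel)"
      by (rule nn_integral_lborel_shift) measurable
    finally show "(\<integral>\<^sup>+x. f x * ?C (x - a) * ?C (x + k) \<partial>lborel) =
        (\<integral>\<^sup>+x. f x * ?C (x - a - k) * ?C x \<partial>lborel)" .
  qed
  also have "\<dots> = (\<integral>\<^sup>+x. (\<integral>\<^sup>+k. f x * ?C (x - a - k) * ?C x \<partial>count_space Z) \<partial>lborel)"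
    by (subst nn_integral_count_space_nn_integral[OF Z]) auto
  also have "\<dots> = (\<integral>\<^sup>+x. (f x * ?C x) * (\<integral>\<^sup>+k. ?C (x - a - k) \<partial>count_space Z) \<partial>lborel)"
    by (subst nn_integral_cmult[symmetric]) (auto simp: mult_ac)
  also have "\<dots> = (\<integral>\<^sup>+x. f x * ?C x \<partial>lborel)"
    by (simp add: one')
  also have "\<dots> = (\<integral>\<^sup>+x. f x \<partial>unit_cube)"
    by (subst nn_integral_unit_cube_cell) auto
  finally show ?thesis .
qed

lemma torus_periodic_shift: "torus_periodic f \<Longrightarrow> torus_periodic (\<lambda>x. f (x + a))"
  unfolding torus_periodic_def by (simp add: add.commute[of _ a] add.assoc[symmetric])

lemma torus_periodic_comp: "torus_periodic f \<Longrightarrow> torus_periodic (\<lambda>x. g (f x))"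
  by (simp add: torus_periodic_def)

lemma torus_periodic_comp2: "torus_periodic f \<Longrightarrow> torus_periodic g \<Longrightarrow> torus_periodic (\<lambda>x. h (f x) (g x))"
  by (simp add: torus_periodic_def)

lemma integrable_torus_shift:
  fixes f :: "real ^ 'n \<Rightarrow> 'b::euclidean_space"
  assumes f [measurable]: "f \<in> borel_measurable borel" and per: "torus_periodic f"
  shows "integrable unit_cube (\<lambda>x. f (x + a)) \<longleftrightarrow> integrable unit_cube f"
  using nn_integral_torus_shift[of "\<lambda>x. ennreal (norm (f x))" a]
    torus_periodic_comp[OF per, of "\<lambda>z. ennreal (norm z)"]
  unfolding integrable_iff_bounded by simp

lemma integral_torus_shift:
  fixes f :: "real ^ 'n \<Rightarrow> real"
  assumes f [measurable]: "f \<in> borel_measurable borel" and per: "torus_periodic f"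
  shows "(\<integral>x. f (x + a) \<partial>unit_cube) = (\<integral>x. f x \<partial>unit_cube)"
proof (cases "integrable unit_cube f")
  case True
  then have "integrable unit_cube (\<lambda>x. f (x + a))"
    by (simp add: integrable_torus_shift[OF f per])
  then show ?thesis
    using True nn_integral_torus_shift[of "\<lambda>x. ennreal (f x)" a] torus_periodic_comp[OF per, of ennreal]
      nn_integral_torus_shift[of "\<lambda>x. ennreal (- f x)" a] torus_periodic_comp[OF per, of "\<lambda>x. ennreal (- x)"]
    by (simp add: real_lebesgue_integral_def)
next
  case False
  then have "\<not> integrable unit_cube (\<lambda>x. f (x + a))"
    by (simp add: integrable_torus_shift[OF f per])
  with False show ?thesis by (simp add: not_integrable_integral_eq)
qed

section \<open>Borel representatives\<close>

lemma lborel_distr_reflect: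
  "distr lborel borel (\<lambda>x :: 'a::euclidean_space. a - x) = lborel"
  using lborel_affine[of "-1" a] by (simp add: density_1)

lemma AE_lborel_shift:
  fixes a :: "'a::euclidean_space"
  assumes "AE x in lborel. P x"
  shows "AE x in lborel. P (x + a)"
proof (rule AE_distrD[of "\<lambda>x. x + a" lborel borel])
  have "(\<lambda>x. x + a) = (+) a" by (rule ext) (rule add.commute)
  then show "AE x in distr lborel borel (\<lambda>x. x + a). P x"
    using assms lborel_distr_plus[of a] by metis
qed simp

lemma AE_lborel_reflect:
  fixes a :: "'a::euclidean_space"
  assumes "AE x in lborel. P x"
  shows "AE x in lborel. P (a - x)"
proof (rule AE_distrD[of "\<lambda>x. a - x" lborel borel])
  show "AE x in distr lborel borel (\<lambda>x. a - x). P x"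
    unfolding lborel_distr_reflect by (rule assms)
qed simp

text \<open>
  A Borel function equal to \<open>f\<close> almost everywhere need not be periodic. Composing it with
  \<open>cell_part\<close> makes it periodic, and only countably many translates of its exceptional null set
  enter, so that it still agrees with \<open>f\<close> almost everywhere.
\<close>

lemma torus_borel_representative:
  fixes f :: "real ^ 'n \<Rightarrow> 'b::euclidean_space"
  assumes per: "torus_periodic f" and meas: "f \<in> borel_measurable lebesgue"
  obtains f' where "f' \<in> borel_measurable borel" "torus_periodic f'" "AE x in lborel. f x = f' x"
proof -
  have "\<exists>g\<in>borel_measurable lborel. AE x in lborel. f x \<bullet> j = g x" for j
    by (rule completion_ex_borel_measurable_real)
      (use meas in \<open>auto intro: borel_measurable_inner\<close>)
  then obtain g where g: "\<And>j. g j \<in> borel_measurable lborel" "\<And>j. AE x in lborel. f x \<bullet> j = g j x"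
    by metis
  define h where "h x = (\<Sum>j\<in>Basis. g j x *\<^sub>R j)" for x
  have [measurable]: "g j \<in> borel_measurable borel" for j using g(1) by simp
  have hm [measurable]: "h \<in> borel_measurable borel" unfolding h_def by measurable
  have "AE x in lborel. \<forall>j\<in>Basis. f x \<bullet> j = g j x"
    using g(2) by (intro AE_ball_countable') (auto simp: countable_finite)
  then have fh: "AE x in lborel. f x = h x"
    by eventually_elim (metis (no_types, lifting) h_def euclidean_representation sum.cong)
  let ?Z = "{k :: real ^ 'n. \<forall>i. k $ i \<in> \<int>}"
  have "AE x in lborel. \<forall>k\<in>?Z. f (x + k) = h (x + k)"
    using fh by (intro AE_ball_countable' lattice_countable AE_lborel_shift)
  then have "AE x in lborel. f x = h (cell_part x)"
  proof eventually_elim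
    case (elim x)
    have "(\<chi> i. - of_int \<lfloor>x $ i\<rfloor>) \<in> ?Z" by simp
    from elim[rule_format, OF this] show ?case
      using torus_periodic_cell_part[OF per, of x] by (simp add: cell_part_eq)
  qed
  moreover have "torus_periodic (\<lambda>x. h (cell_part x))" by (rule cell_part_periodic)
  moreover have "(\<lambda>x. h (cell_part x)) \<in> borel_measurable borel" by measurable
  ultimately show ?thesis using that by blast
qed

text \<open>
  In a complete measure space almost everywhere equality preserves measurability. This applies in
  space, to pass between a function and its Borel representative, and in time, to limits that exist
  only almost everywhere.
\<close>

lemma (in complete_measure) borel_measurable_AE_cong:
  assumes g: "g \<in> borel_measurable M" and eq: "AE x in M. f x = g x"
  shows "f \<in> borel_measurable M"
proof (rule measurableI)
  fix A :: "'b set" assume A: "A \<in> sets borel"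
  show "f -` A \<inter> space M \<in> sets M"
  proof (rule in_sets_AE)
    show "AE x in M. (x \<in> g -` A \<inter> space M) = (x \<in> f -` A \<inter> space M)"
      using eq by eventually_elim auto
    show "g -` A \<inter> space M \<in> sets M" using g A by (rule measurable_sets)
  qed auto
qed simp

lemma complete_measure_lebesgue_on:
  fixes S :: "'a::euclidean_space set"
  assumes "S \<in> sets lebesgue" shows "complete_measure (lebesgue_on S)"
proof
  fix A B :: "'a set" assume "A \<subseteq> B" "B \<in> null_sets (lebesgue_on S)"
  then have "B \<in> null_sets lebesgue" "B \<subseteq> S" using assms by (auto simp: null_sets_restrict_space)
  then have "A \<in> null_sets lebesgue" "A \<subseteq> S"
    using \<open>A \<subseteq> B\<close> completion.complete2[of A B lborel] by auto
  then show "A \<in> sets (lebesgue_on S)" using assms by (simp add: sets_restrict_space_iff null_setsD2)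
qed

lemma lebesgue_measurable_AE_cong:
  assumes "g \<in> borel_measurable borel" "AE x in lborel. f x = g x"
  shows "f \<in> borel_measurable lebesgue"
  by (rule completion.borel_measurable_AE_cong[OF borel_imp_lebesgue[OF assms(1)]])
    (simp add: AE_completion_iff assms(2))

lemma integral_torus_measure_AE:
  fixes f :: "real ^ 'n \<Rightarrow> 'b::euclidean_space"
  assumes g: "g \<in> borel_measurable borel" and eq: "AE x in lborel. f x = g x"
  shows "(\<integral>x. f x \<partial>torus_measure) = (\<integral>x. g x \<partial>unit_cube)"
proof -
  have "(\<integral>x. f x \<partial>torus_measure) = (\<integral>x. g x \<partial>torus_measure)"
    using lebesgue_measurable_AE_cong[OF g eq] borel_imp_lebesgue[OF g]
    by (intro integral_cong_AE borel_measurable_torus_measure AE_lborel_imp_torus eq)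
  then show ?thesis using integral_torus_measure[OF g] by simp
qed

lemma integral_lebesgue_AE:
  fixes f :: "real ^ 'n \<Rightarrow> 'b::euclidean_space"
  assumes g: "g \<in> borel_measurable borel" and eq: "AE x in lborel. f x = g x"
  shows "(\<integral>x. f x \<partial>lebesgue) = (\<integral>x. g x \<partial>lborel)"
proof -
  have "(\<integral>x. f x \<partial>lebesgue) = (\<integral>x. g x \<partial>lebesgue)"
    using lebesgue_measurable_AE_cong[OF g eq] borel_imp_lebesgue[OF g]
    by (intro integral_cong_AE) (auto simp: AE_completion_iff eq)
  then show ?thesis using integral_completion[of g lborel] g by simp
qed

section \<open>Inequalities\<close>

text \<open>
  The third weight \<open>1 - \<alpha> - \<beta>\<close> sits on the value \<open>1\<close>. Integrated over a probability space it
  accounts for the slack in Hoelder's inequality when \<open>1 / p + 1 / q\<close> is strictly below one half.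
\<close>

lemma weighted_am_gm:
  fixes x y :: real
  assumes "0 \<le> x" "0 \<le> y" "0 < \<alpha>" "0 < \<beta>" "\<alpha> + \<beta> \<le> 1"
  shows "x powr \<alpha> * y powr \<beta> \<le> \<alpha> * x + \<beta> * y + (1 - \<alpha> - \<beta>)"
proof (cases "x = 0 \<or> y = 0")
  case True
  then show ?thesis using assms by auto
next
  case False
  then have xy: "x > 0" "y > 0" using assms by auto
  define m where "m = \<alpha> * x + \<beta> * y + (1 - \<alpha> - \<beta>)"
  have "\<alpha> * x > 0" "\<beta> * y > 0" using xy assms by simp_all
  then have m: "m > 0" using assms(5) unfolding m_def by linarith
  \<comment> \<open>The logarithm lies below its tangent at the weighted mean \<open>m\<close>; the tangent terms average to zero.\<close>
  have ln_le: "ln z \<le> ln m + z / m - 1" if "z > 0" for z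
    using ln_le_minus_one[of "z / m"] that m by (simp add: ln_div)
  have "\<alpha> * ln x + \<beta> * ln y + (1 - \<alpha> - \<beta>) * ln 1 \<le>
      \<alpha> * (ln m + x / m - 1) + \<beta> * (ln m + y / m - 1) + (1 - \<alpha> - \<beta>) * (ln m + 1 / m - 1)"
    using assms xy by (intro add_mono mult_left_mono ln_le) auto
  also have "\<dots> = ln m - 1 + (\<alpha> * x + \<beta> * y + (1 - \<alpha> - \<beta>)) / m"
    by (simp add: algebra_simps add_divide_distrib diff_divide_distrib)
  also have "\<dots> = ln m" using m by (simp add: m_def[symmetric])
  finally have "exp (\<alpha> * ln x + \<beta> * ln y) \<le> exp (ln m)" by simp
  then show ?thesis using xy m by (simp add: powr_def exp_add m_def)
qed

text \<open>
  Normalise \<open>f\<close> and \<open>g\<close> by their norm bounds, apply the weighted inequality between the means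
  pointwise to the powers \<open>f\<^sup>q\<close> and \<open>g\<^sup>p\<close> and integrate; the three weights add up to one.
\<close>

lemma Holder_half_pos:
  fixes f g :: "'a \<Rightarrow> real"
  assumes M: "emeasure M (space M) = 1"
    and [measurable]: "f \<in> borel_measurable M" "g \<in> borel_measurable M"
    and nonneg: "\<And>x. 0 \<le> f x" "\<And>x. 0 \<le> g x"
    and pq: "p > 0" "q > 0" "1 / p + 1 / q \<le> 1 / 2"
    and AB: "A > 0" "B > 0"
    and f: "(\<integral>\<^sup>+x. ennreal (f x powr q) \<partial>M) \<le> ennreal (A powr q)"
    and g: "(\<integral>\<^sup>+x. ennreal (g x powr p) \<partial>M) \<le> ennreal (B powr p)"
  shows "(\<integral>\<^sup>+x. ennreal ((f x * g x)\<^sup>2) \<partial>M) \<le> ennreal ((A * B)\<^sup>2)"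
proof -
  \<comment> \<open>With these weights \<open>X powr \<alpha>\<close> and \<open>Y powr \<beta>\<close> are the normalised squares of \<open>f\<close> and \<open>g\<close>.\<close>
  define \<alpha> \<beta> \<gamma> where "\<alpha> = 2 / q" and "\<beta> = 2 / p" and "\<gamma> = 1 - \<alpha> - \<beta>"
  have ab: "\<alpha> > 0" "\<beta> > 0" "\<alpha> + \<beta> \<le> 1" using pq by (auto simp: \<alpha>_def \<beta>_def)
  then have c: "\<gamma> \<ge> 0" by (simp add: \<gamma>_def)
  define X Y where "X x = f x powr q / A powr q" and "Y x = g x powr p / B powr p" for x
  have [measurable]: "X \<in> borel_measurable M" "Y \<in> borel_measurable M"
    unfolding X_def Y_def by measurable
  have XY: "X x \<ge> 0" "Y x \<ge> 0" for x by (auto simp: X_def Y_def)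
  have pw: "(f x * g x)\<^sup>2 \<le> (A * B)\<^sup>2 * (\<alpha> * X x + \<beta> * Y x + \<gamma>)" for x
  proof -
    have sq: "(z powr r / C powr r) powr (2 / r) = z\<^sup>2 / C\<^sup>2" if "z \<ge> 0" "C > 0" "r > 0" for z C r :: real
      using that by (cases "z = 0") (simp_all add: powr_divide powr_powr)
    have "(f x * g x)\<^sup>2 = (A * B)\<^sup>2 * (X x powr \<alpha> * Y x powr \<beta>)"
      unfolding X_def Y_def \<alpha>_def \<beta>_def using sq nonneg AB pq by (simp add: power_mult_distrib)
    also have "\<dots> \<le> (A * B)\<^sup>2 * (\<alpha> * X x + \<beta> * Y x + \<gamma>)"
      unfolding \<gamma>_def using XY ab by (intro mult_left_mono weighted_am_gm) auto
    finally show ?thesis .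
  qed
  have normalised: "(\<integral>\<^sup>+x. ennreal (h x / D) \<partial>M) \<le> 1"
    if [measurable]: "h \<in> borel_measurable M" and h: "\<And>x. 0 \<le> h x" "(\<integral>\<^sup>+x. ennreal (h x) \<partial>M) \<le> ennreal D"
      and D: "D > 0" for h :: "'a \<Rightarrow> real" and D
  proof -
    have "(\<integral>\<^sup>+x. ennreal (h x / D) \<partial>M) = (\<integral>\<^sup>+x. ennreal (h x) * ennreal (1 / D) \<partial>M)"
      using h(1) D by (intro nn_integral_cong) (simp flip: ennreal_mult)
    also have "\<dots> = (\<integral>\<^sup>+x. ennreal (h x) \<partial>M) * ennreal (1 / D)"
      by (rule nn_integral_multc) measurable
    also have "\<dots> \<le> ennreal D * ennreal (1 / D)" by (intro mult_right_mono h(2)) simp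
    also have "\<dots> = 1" using D by (simp flip: ennreal_mult)
    finally show ?thesis .
  qed
  have X1: "(\<integral>\<^sup>+x. ennreal (X x) \<partial>M) \<le> 1" and Y1: "(\<integral>\<^sup>+x. ennreal (Y x) \<partial>M) \<le> 1"
    unfolding X_def Y_def by (rule normalised; use f g AB in simp)+
  have "(\<integral>\<^sup>+x. ennreal ((f x * g x)\<^sup>2) \<partial>M) \<le>
      (\<integral>\<^sup>+x. ennreal ((A * B)\<^sup>2) * (ennreal \<alpha> * ennreal (X x) + ennreal \<beta> * ennreal (Y x) + ennreal \<gamma>) \<partial>M)"
  proof (rule nn_integral_mono)
    fix x
    have "ennreal ((f x * g x)\<^sup>2) \<le> ennreal ((A * B)\<^sup>2 * (\<alpha> * X x + \<beta> * Y x + \<gamma>))"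
      by (intro ennreal_leI pw)
    also have "\<dots> = ennreal ((A * B)\<^sup>2) * (ennreal \<alpha> * ennreal (X x) + ennreal \<beta> * ennreal (Y x) + ennreal \<gamma>)"
      using XY[of x] ab c by (simp add: ennreal_mult ennreal_plus)
    finally show "ennreal ((f x * g x)\<^sup>2) \<le> ennreal ((A * B)\<^sup>2) * (ennreal \<alpha> * ennreal (X x) + ennreal \<beta> * ennreal (Y x) + ennreal \<gamma>)" .
  qed
  also have "\<dots> = ennreal ((A * B)\<^sup>2) * (ennreal \<alpha> * (\<integral>\<^sup>+x. ennreal (X x) \<partial>M)
      + ennreal \<beta> * (\<integral>\<^sup>+x. ennreal (Y x) \<partial>M) + ennreal \<gamma>)"
    by (simp add: nn_integral_cmult nn_integral_add M)
  also have "\<dots> \<le> ennreal ((A * B)\<^sup>2) * (ennreal \<alpha> * 1 + ennreal \<beta> * 1 + ennreal \<gamma>)"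
    by (intro mult_left_mono add_mono X1 Y1) auto
  also have "ennreal \<alpha> * 1 + ennreal \<beta> * 1 + ennreal \<gamma> = ennreal (\<alpha> + \<beta> + \<gamma>)"
    using ab c by (simp add: ennreal_plus)
  finally show ?thesis by (simp add: \<gamma>_def)
qed

text \<open>
  Vanishing norm bounds are reached from positive ones by letting \<open>e\<close> tend to zero.
\<close>

lemma Holder_half:
  fixes f g :: "'a \<Rightarrow> real"
  assumes M: "emeasure M (space M) = 1"
    and meas: "f \<in> borel_measurable M" "g \<in> borel_measurable M"
    and nonneg: "\<And>x. 0 \<le> f x" "\<And>x. 0 \<le> g x"
    and pq: "p > 0" "q > 0" "1 / p + 1 / q \<le> 1 / 2"
    and AB: "A \<ge> 0" "B \<ge> 0"
    and f: "(\<integral>\<^sup>+x. ennreal (f x powr q) \<partial>M) \<le> ennreal (A powr q)"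
    and g: "(\<integral>\<^sup>+x. ennreal (g x powr p) \<partial>M) \<le> ennreal (B powr p)"
  shows "(\<integral>\<^sup>+x. ennreal ((f x * g x)\<^sup>2) \<partial>M) \<le> ennreal ((A * B)\<^sup>2)"
proof (rule tendsto_lowerbound)
  show "((\<lambda>e. ennreal (((A + e) * (B + e))\<^sup>2)) \<longlongrightarrow> ennreal ((A * B)\<^sup>2)) (at_right (0::real))"
    by (rule tendsto_eq_intros refl | simp)+
  show "\<forall>\<^sub>F e in at_right (0::real). (\<integral>\<^sup>+x. ennreal ((f x * g x)\<^sup>2) \<partial>M) \<le> ennreal (((A + e) * (B + e))\<^sup>2)"
    using eventually_at_right_less[of 0]
  proof eventually_elim
    case (elim e)
    have "ennreal (A powr q) \<le> ennreal ((A + e) powr q)" "ennreal (B powr p) \<le> ennreal ((B + e) powr p)"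
      using elim AB pq by (auto intro!: ennreal_leI powr_mono2)
    then show ?case
      using elim AB order_trans[OF f] order_trans[OF g] by (intro Holder_half_pos[OF M meas nonneg pq]) auto
  qed
qed simp

text \<open>
  Jensen's inequality for the square. It holds for every measurable \<open>H\<close>: where the average does not
  exist the integral is zero by convention, and where the right-hand side is infinite there is
  nothing to prove.
\<close>

lemma norm_weighted_average_sq_le:
  fixes H :: "'a \<Rightarrow> 'b::euclidean_space" and k :: "'a \<Rightarrow> real"
  assumes [measurable]: "k \<in> borel_measurable M" "H \<in> borel_measurable M"
    and k0: "\<And>y. 0 \<le> k y" and k1: "(\<integral>\<^sup>+y. ennreal (k y) \<partial>M) = 1"
  shows "ennreal ((norm (\<integral>y. k y *\<^sub>R H y \<partial>M))\<^sup>2) \<le> (\<integral>\<^sup>+y. ennreal (k y) * ennreal ((norm (H y))\<^sup>2) \<partial>M)"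
proof (cases "integrable M (\<lambda>y. k y *\<^sub>R H y) \<and> integrable M (\<lambda>y. k y * (norm (H y))\<^sup>2)")
  case True
  have ik: "integrable M k" "integral\<^sup>L M k = 1"
    using k0 k1 by (auto intro!: integrableI_nonneg simp: integral_eq_nn_integral)
  have iH: "integrable M (\<lambda>y. k y * norm (H y))"
    using True integrable_norm[of M "\<lambda>y. k y *\<^sub>R H y"] k0 by simp
  define c where "c = (\<integral>y. k y * norm (H y) \<partial>M)"
  have "norm (\<integral>y. k y *\<^sub>R H y \<partial>M) \<le> c"
    unfolding c_def using integral_norm_bound[of M "\<lambda>y. k y *\<^sub>R H y"] k0 by simp
  then have "(norm (\<integral>y. k y *\<^sub>R H y \<partial>M))\<^sup>2 \<le> c\<^sup>2" by (intro power_mono) auto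
  also have "c\<^sup>2 \<le> (\<integral>y. k y * (norm (H y))\<^sup>2 \<partial>M)"
  proof -
    \<comment> \<open>The variance of \<open>norm (H y)\<close> under the probability density \<open>k\<close> is nonnegative.\<close>
    have "0 \<le> (\<integral>y. k y * (norm (H y) - c)\<^sup>2 \<partial>M)"
      using k0 by (intro integral_nonneg_AE) auto
    also have "\<dots> = (\<integral>y. k y * (norm (H y))\<^sup>2 - 2 * c * (k y * norm (H y)) + c\<^sup>2 * k y \<partial>M)"
      by (simp add: power2_diff algebra_simps)
    also have "\<dots> = (\<integral>y. k y * (norm (H y))\<^sup>2 \<partial>M) - 2 * c * c + c\<^sup>2 * 1"
      using True iH ik by (simp add: c_def)
    finally show ?thesis by (simp add: power2_eq_square)
  qed
  finally have "ennreal ((norm (\<integral>y. k y *\<^sub>R H y \<partial>M))\<^sup>2) \<le> ennreal (\<integral>y. k y * (norm (H y))\<^sup>2 \<partial>M)"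
    by (rule ennreal_leI)
  also have "\<dots> = (\<integral>\<^sup>+y. ennreal (k y * (norm (H y))\<^sup>2) \<partial>M)"
    using True k0 by (subst nn_integral_eq_integral) auto
  also have "\<dots> = (\<integral>\<^sup>+y. ennreal (k y) * ennreal ((norm (H y))\<^sup>2) \<partial>M)"
    using k0 by (simp add: ennreal_mult)
  finally show ?thesis .
next
  case False
  show ?thesis
  proof (cases "integrable M (\<lambda>y. k y *\<^sub>R H y)")
    case True
    with False have "\<not> integrable M (\<lambda>y. k y * (norm (H y))\<^sup>2)" by simp
    then have "(\<integral>\<^sup>+y. ennreal (k y * (norm (H y))\<^sup>2) \<partial>M) = \<infinity>"
      using k0 by (subst (asm) integrable_iff_bounded) (auto simp: less_top[symmetric])
    then show ?thesis using k0 by (simp add: ennreal_mult)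
  qed (simp add: not_integrable_integral_eq)
qed

section \<open>Continuity of translations\<close>

abbreviation power_integral :: "real \<Rightarrow> (real ^ 'n \<Rightarrow> 'b::real_normed_vector) \<Rightarrow> ennreal" where
  "power_integral p f \<equiv> \<integral>\<^sup>+x. ennreal (norm (f x) powr p) \<partial>unit_cube"

text \<open>
  Convergence in measure of the translates: \<open>min 1 (norm (u - v))\<close> is a bounded metric, so almost
  everywhere approximation of \<open>f\<close> by continuous functions is approximation in the integrated metric,
  by dominated convergence. For a continuous function the claim is dominated convergence again.
\<close>

lemma translation_in_measure:
  fixes f :: "real ^ 'n \<Rightarrow> 'b::euclidean_space"
  assumes [measurable]: "f \<in> borel_measurable borel"
    and y: "y \<longlonglongrightarrow> 0" "\<And>m::nat. norm (y m) \<le> 1"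
  shows "(\<lambda>m. \<integral>\<^sup>+x. ennreal (min 1 (norm (f (x - y m) - f x))) \<partial>unit_cube) \<longlonglongrightarrow> 0"
proof (rule tendsto_zero_ennreal)
  fix r :: real assume r: "0 < r"
  let ?d = "\<lambda>u v :: 'b. ennreal (min 1 (norm (u - v)))"
  \<comment> \<open>A box that contains every translate of the unit cube by a vector of norm at most one.\<close>
  let ?J = "indicator (cbox (- 1) (2 :: real ^ 'n)) :: real ^ 'n \<Rightarrow> ennreal"
  have tri: "?d u v \<le> ?d u z + ?d z v" for u v z
  proof -
    have "norm (u - v) \<le> norm (u - z) + norm (z - v)" by norm
    then have "min 1 (norm (u - v)) \<le> min 1 (norm (u - z)) + min 1 (norm (z - v))"
      using norm_ge_zero[of "u - z"] norm_ge_zero[of "z - v"] by linarith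
    then show ?thesis by (simp flip: ennreal_plus)
  qed
  have "f measurable_on UNIV"
    by (subst measurable_on_iff_borel_measurable)
      (auto intro!: measurable_restrict_space1 borel_imp_lebesgue)
  then obtain N g where N: "negligible N" and gc: "\<And>n. continuous_on UNIV (g n)"
    and glim: "\<And>x. x \<notin> N \<Longrightarrow> (\<lambda>n. g n x) \<longlonglongrightarrow> f x"
    unfolding measurable_on_def by auto
  have [measurable]: "g n \<in> borel_measurable borel" for n
    by (rule borel_measurable_continuous_onI[OF gc])
  have "AE x in lebesgue. x \<notin> N" using N by (intro AE_not_in) (simp add: negligible_iff_null_sets)
  then have "AE x in lborel. x \<notin> N" by (simp add: AE_completion_iff)
  then have AEg: "AE x in lborel. (\<lambda>n. g n x) \<longlonglongrightarrow> f x" by eventually_elim (rule glim)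
  have "(\<lambda>n. \<integral>\<^sup>+x. ?d (f x) (g n x) * ?J x \<partial>lborel) \<longlonglongrightarrow> (\<integral>\<^sup>+x. 0 \<partial>(lborel :: (real ^ 'n) measure))"
  proof (rule nn_integral_dominated_convergence[where w = ?J])
    show "AE x in lborel. ?d (f x) (g n x) * ?J x \<le> ?J x" for n
      by (auto simp: indicator_def)
    show "(\<integral>\<^sup>+x. ?J x \<partial>lborel) < \<infinity>" by (simp add: emeasure_lborel_cbox_eq)
    show "AE x in lborel. (\<lambda>n. ?d (f x) (g n x) * ?J x) \<longlonglongrightarrow> 0"
      using AEg
    proof eventually_elim
      case (elim x)
      have "(\<lambda>n. min 1 (norm (f x - g n x))) \<longlonglongrightarrow> min 1 (norm (f x - f x))"
        by (intro tendsto_intros elim)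
      then have "(\<lambda>n. ?d (f x) (g n x)) \<longlonglongrightarrow> ennreal 0" by (intro tendsto_ennrealI) simp
      then have "(\<lambda>n. ?d (f x) (g n x)) \<longlonglongrightarrow> 0" by simp
      then show ?case by (auto simp: indicator_def)
    qed
  qed measurable
  then have "(\<lambda>n. \<integral>\<^sup>+x. ?d (f x) (g n x) * ?J x \<partial>lborel) \<longlonglongrightarrow> 0" by simp
  then have "\<forall>\<^sub>F n in sequentially. (\<integral>\<^sup>+x. ?d (f x) (g n x) * ?J x \<partial>lborel) < ennreal (r / 3)"
    using r by (intro order_tendstoD) auto
  then obtain n where n: "(\<integral>\<^sup>+x. ?d (f x) (g n x) * ?J x \<partial>lborel) < ennreal (r / 3)"
    by (auto simp: eventually_sequentially)
  have near: "(\<integral>\<^sup>+x. ?d (f (x - a)) (g n (x - a)) \<partial>unit_cube) < ennreal (r / 3)" if "norm a \<le> 1" for a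
  proof -
    have "(\<integral>\<^sup>+x. ?d (f (x - a)) (g n (x - a)) \<partial>unit_cube) =
        (\<integral>\<^sup>+x. ?d (f (x - a)) (g n (x - a)) * indicator (cbox 0 1) x \<partial>lborel)"
      by (rule nn_integral_unit_cube) measurable
    also have "\<dots> \<le> (\<integral>\<^sup>+x. ?d (f (x + (- a))) (g n (x + (- a))) * ?J (x + (- a)) \<partial>lborel)"
    proof (rule nn_integral_mono)
      fix x :: "real ^ 'n"
      have "x \<in> cbox 0 1 \<Longrightarrow> x + - a \<in> cbox (- 1) 2"
      proof -
        assume x: "x \<in> cbox 0 1"
        have "\<bar>a $ i\<bar> \<le> 1" for i using component_le_norm_cart[of a i] that by linarith
        then show ?thesis using x
          by (auto simp: mem_box_cart abs_le_iff) (smt (verit))+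
      qed
      then show "?d (f (x - a)) (g n (x - a)) * indicator (cbox 0 1) x
          \<le> ?d (f (x + (- a))) (g n (x + (- a))) * ?J (x + (- a))"
        by (auto simp: indicator_def)
    qed
    also have "\<dots> = (\<integral>\<^sup>+x. ?d (f x) (g n x) * ?J x \<partial>lborel)"
      by (rule nn_integral_lborel_shift) measurable
    finally show ?thesis using n by simp
  qed
  have "(\<lambda>m. \<integral>\<^sup>+x. ?d (g n (x - y m)) (g n x) \<partial>unit_cube) \<longlonglongrightarrow> (\<integral>\<^sup>+x. 0 \<partial>(unit_cube :: (real ^ 'n) measure))"
  proof (rule nn_integral_dominated_convergence[where w = "\<lambda>_. 1"])
    show "AE x in unit_cube. (\<lambda>m. ?d (g n (x - y m)) (g n x)) \<longlonglongrightarrow> 0"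
    proof (rule AE_I2)
      fix x :: "real ^ 'n"
      have "(\<lambda>m. x - y m) \<longlonglongrightarrow> x - 0" by (intro tendsto_intros y)
      then have "(\<lambda>m. g n (x - y m)) \<longlonglongrightarrow> g n x"
        using gc[of n] by (intro continuous_on_tendsto_compose[of UNIV "g n"]) auto
      then have "(\<lambda>m. min 1 (norm (g n (x - y m) - g n x))) \<longlonglongrightarrow> min 1 (norm (g n x - g n x))"
        by (intro tendsto_intros)
      then have "(\<lambda>m. ?d (g n (x - y m)) (g n x)) \<longlonglongrightarrow> ennreal 0" by (intro tendsto_ennrealI) simp
      then show "(\<lambda>m. ?d (g n (x - y m)) (g n x)) \<longlonglongrightarrow> 0" by simp
    qed
  qed (auto simp: emeasure_unit_cube)
  then have "\<forall>\<^sub>F m in sequentially. (\<integral>\<^sup>+x. ?d (g n (x - y m)) (g n x) \<partial>unit_cube) < ennreal (r / 3)"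
    using r by (intro order_tendstoD) auto
  then show "\<forall>\<^sub>F m in sequentially. (\<integral>\<^sup>+x. ?d (f (x - y m)) (f x) \<partial>unit_cube) < ennreal r"
  proof eventually_elim
    case (elim m)
    have "(\<integral>\<^sup>+x. ?d (f (x - y m)) (f x) \<partial>unit_cube) \<le>
        (\<integral>\<^sup>+x. ?d (f (x - y m)) (g n (x - y m)) + (?d (g n (x - y m)) (g n x) + ?d (f x) (g n x)) \<partial>unit_cube)"
    proof (rule nn_integral_mono)
      fix x
      show "?d (f (x - y m)) (f x) \<le>
          ?d (f (x - y m)) (g n (x - y m)) + (?d (g n (x - y m)) (g n x) + ?d (f x) (g n x))"
        using tri[of "f (x - y m)" "f x" "g n (x - y m)"] tri[of "g n (x - y m)" "f x" "g n x"]
        by (auto simp: norm_minus_commute[of "g n x"] intro: order_trans add_left_mono)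
    qed
    also have "\<dots> = (\<integral>\<^sup>+x. ?d (f (x - y m)) (g n (x - y m)) \<partial>unit_cube) +
        ((\<integral>\<^sup>+x. ?d (g n (x - y m)) (g n x) \<partial>unit_cube) + (\<integral>\<^sup>+x. ?d (f x) (g n x) \<partial>unit_cube))"
      by (simp add: nn_integral_add)
    also have "\<dots> < ennreal (r / 3) + (ennreal (r / 3) + ennreal (r / 3))"
      using near[OF y(2)[of m]] near[of 0] elim by (intro add_strict_mono) auto
    also have "\<dots> = ennreal r" using r by (simp flip: ennreal_plus)
    finally show ?case .
  qed
qed

text \<open>
  Splits a power of a difference into a bounded part, controlled by the metric of convergence in
  measure, and tails that are uniformly integrable over all translates.
\<close>

lemma norm_diff_powr_le:
  fixes u v :: "'b::real_normed_vector"
  assumes p: "p \<ge> 1" and M: "M \<ge> 0"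
  shows "norm (u - v) powr p \<le> ((2 * M) powr p + 1) * min 1 (norm (u - v)) +
    2 powr p * ((if norm u > M then norm u powr p else 0) + (if norm v > M then norm v powr p else 0))"
    (is "_ \<le> ?A + ?B")
proof -
  have n: "norm (u - v) \<le> norm u + norm v" by norm
  have A0: "?A \<ge> 0" and B0: "?B \<ge> 0" by auto
  show ?thesis
  proof (cases "norm u \<le> M \<and> norm v \<le> M")
    case True
    have "norm (u - v) powr p \<le> ?A"
    proof (cases "norm (u - v) \<le> 1")
      case True
      have "norm (u - v) powr p \<le> norm (u - v) powr 1"
        using True p by (intro powr_mono') auto
      also have "\<dots> = norm (u - v)" by simp
      also have "\<dots> \<le> ((2 * M) powr p + 1) * norm (u - v)" by (simp add: algebra_simps)
      finally show ?thesis using True by simp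
    next
      case False
      have "norm (u - v) powr p \<le> (2 * M) powr p"
        using n \<open>norm u \<le> M \<and> norm v \<le> M\<close> p by (intro powr_mono2) auto
      then show ?thesis using False by simp
    qed
    then show ?thesis using B0 by linarith
  next
    case False
    define m where "m = max (norm u) (norm v)"
    have "norm (u - v) powr p \<le> (2 * m) powr p"
      using n p by (intro powr_mono2) (auto simp: m_def)
    also have "\<dots> = 2 powr p * m powr p" by (simp add: powr_mult m_def)
    also have "\<dots> \<le> ?B" using False by (auto simp: m_def max_def)
    finally show ?thesis using A0 by linarith
  qed
qed

text \<open>
  Translations are continuous in \<open>L\<^sup>p\<close> for finite \<open>p\<close>. By periodicity the tail beyond the level \<open>M\<close> has
  the same integral for \<open>f\<close> and all its translates, so a single large \<open>M\<close> makes both tails small;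
  the remaining bounded part tends to zero by convergence in measure.
\<close>

lemma translation_continuous_Lp:
  fixes f :: "real ^ 'n \<Rightarrow> 'b::euclidean_space"
  assumes f [measurable]: "f \<in> borel_measurable borel" and per: "torus_periodic f"
    and p: "p \<ge> 1" and fin: "power_integral p f < \<infinity>"
    and e: "e > 0"
  obtains \<eta> where "\<eta> > 0"
    "\<And>y. norm y < \<eta> \<Longrightarrow> (\<integral>\<^sup>+x. ennreal (norm (f (x - y) - f x) powr p) \<partial>unit_cube) \<le> ennreal e"
proof -
  define tail where "tail M z = (if norm z > M then norm z powr p else 0)" for M and z :: 'b
  have [measurable]: "tail M \<in> borel_measurable borel" for M unfolding tail_def by measurable
  have "(\<lambda>n. \<integral>\<^sup>+x. ennreal (tail (real n) (f x)) \<partial>unit_cube) \<longlonglongrightarrow> (\<integral>\<^sup>+x. 0 \<partial>(unit_cube :: (real ^ 'n) measure))"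
  proof (rule nn_integral_dominated_convergence[where w = "\<lambda>x. ennreal (norm (f x) powr p)"])
    show "AE x in unit_cube. (\<lambda>n. ennreal (tail (real n) (f x))) \<longlonglongrightarrow> 0"
    proof (rule AE_I2)
      fix x
      obtain n0 where "norm (f x) \<le> real n0" using real_arch_simple by blast
      then have "\<forall>\<^sub>F n in sequentially. ennreal (tail (real n) (f x)) = 0"
        unfolding eventually_sequentially tail_def by (intro exI[of _ n0]) auto
      then show "(\<lambda>n. ennreal (tail (real n) (f x))) \<longlonglongrightarrow> 0" by (rule tendsto_eventually)
    qed
    show "AE x in unit_cube. ennreal (tail (real n) (f x)) \<le> ennreal (norm (f x) powr p)" for n
      by (auto simp: tail_def)
  qed (use fin in auto)
  then have tl: "(\<lambda>n. \<integral>\<^sup>+x. ennreal (tail (real n) (f x)) \<partial>unit_cube) \<longlonglongrightarrow> 0" by simp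
  define c where "c = 2 powr p"
  have c: "c > 0" by (simp add: c_def)
  have "\<forall>\<^sub>F n in sequentially. (\<integral>\<^sup>+x. ennreal (tail (real n) (f x)) \<partial>unit_cube) < ennreal (e / (4 * c))"
    using e c by (intro order_tendstoD[OF tl]) auto
  then obtain n where n: "(\<integral>\<^sup>+x. ennreal (tail (real n) (f x)) \<partial>unit_cube) < ennreal (e / (4 * c))"
    by (auto simp: eventually_sequentially)
  define M where "M = real n"
  define K where "K = (2 * M) powr p + 1"
  have K: "K > 0" by (simp add: K_def add_nonneg_pos)
  have "\<forall>\<^sub>F y in at 0. norm y < 1 \<longrightarrow>
      (\<integral>\<^sup>+x. ennreal (min 1 (norm (f (x - y) - f x))) \<partial>unit_cube) < ennreal (e / (2 * K))"
  proof (rule sequentially_imp_eventually_at, intro allI impI, elim conjE)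
    fix s :: "nat \<Rightarrow> real ^ 'n" assume s: "s \<longlonglongrightarrow> 0"
    define s' where "s' m = (if norm (s m) < 1 then s m else 0)" for m
    have "\<forall>\<^sub>F m in sequentially. norm (s m) < 1"
      using order_tendstoD(2)[OF tendsto_norm[OF s], of 1] by simp
    then have "\<forall>\<^sub>F m in sequentially. s m = s' m"
      by eventually_elim (simp add: s'_def)
    then have "s' \<longlonglongrightarrow> 0" using s by (rule Lim_transform_eventually[rotated])
    moreover have "norm (s' m) \<le> 1" for m by (auto simp: s'_def)
    ultimately have "(\<lambda>m. \<integral>\<^sup>+x. ennreal (min 1 (norm (f (x - s' m) - f x))) \<partial>unit_cube) \<longlonglongrightarrow> 0"
      by (intro translation_in_measure f)
    then have "\<forall>\<^sub>F m in sequentially.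
        (\<integral>\<^sup>+x. ennreal (min 1 (norm (f (x - s' m) - f x))) \<partial>unit_cube) < ennreal (e / (2 * K))"
      using e K by (intro order_tendstoD) auto
    then show "\<forall>\<^sub>F m in sequentially. norm (s m) < 1 \<longrightarrow>
        (\<integral>\<^sup>+x. ennreal (min 1 (norm (f (x - s m) - f x))) \<partial>unit_cube) < ennreal (e / (2 * K))"
      by eventually_elim (auto simp: s'_def)
  qed
  then obtain \<eta> where \<eta>: "\<eta> > 0" "\<And>y. y \<noteq> 0 \<Longrightarrow> norm y < \<eta> \<Longrightarrow> norm y < 1 \<Longrightarrow>
      (\<integral>\<^sup>+x. ennreal (min 1 (norm (f (x - y) - f x))) \<partial>unit_cube) < ennreal (e / (2 * K))"
    unfolding eventually_at by (auto simp: dist_norm)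
  show ?thesis
  proof (rule that[of "min 1 \<eta>"])
    fix y :: "real ^ 'n" assume y: "norm y < min 1 \<eta>"
    show "(\<integral>\<^sup>+x. ennreal (norm (f (x - y) - f x) powr p) \<partial>unit_cube) \<le> ennreal e"
    proof (cases "y = 0")
      case False
      have tp: "torus_periodic (\<lambda>x. ennreal (tail M (f x)))"
        by (rule torus_periodic_comp[OF per])
      have sh: "(\<integral>\<^sup>+x. ennreal (tail M (f (x - y))) \<partial>unit_cube) = (\<integral>\<^sup>+x. ennreal (tail M (f x)) \<partial>unit_cube)"
        using nn_integral_torus_shift[OF _ tp, of "- y"] by simp
      have "(\<integral>\<^sup>+x. ennreal (norm (f (x - y) - f x) powr p) \<partial>unit_cube) \<le>
          (\<integral>\<^sup>+x. ennreal K * ennreal (min 1 (norm (f (x - y) - f x))) +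
            ennreal c * (ennreal (tail M (f (x - y))) + ennreal (tail M (f x))) \<partial>unit_cube)"
      proof (rule nn_integral_mono)
        fix x
        have "norm (f (x - y) - f x) powr p \<le> K * min 1 (norm (f (x - y) - f x)) +
            c * (tail M (f (x - y)) + tail M (f x))"
          unfolding K_def c_def tail_def by (rule norm_diff_powr_le) (auto simp: p M_def)
        then have "ennreal (norm (f (x - y) - f x) powr p) \<le> ennreal (K * min 1 (norm (f (x - y) - f x)) +
            c * (tail M (f (x - y)) + tail M (f x)))" by (rule ennreal_leI)
        also have "\<dots> = ennreal K * ennreal (min 1 (norm (f (x - y) - f x))) +
            ennreal c * (ennreal (tail M (f (x - y))) + ennreal (tail M (f x)))"
          using K c by (simp add: tail_def ennreal_mult ennreal_plus)
        finally show "ennreal (norm (f (x - y) - f x) powr p) \<le>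
            ennreal K * ennreal (min 1 (norm (f (x - y) - f x))) +
            ennreal c * (ennreal (tail M (f (x - y))) + ennreal (tail M (f x)))" .
      qed
      also have "\<dots> = ennreal K * (\<integral>\<^sup>+x. ennreal (min 1 (norm (f (x - y) - f x))) \<partial>unit_cube) +
          ennreal c * ((\<integral>\<^sup>+x. ennreal (tail M (f x)) \<partial>unit_cube) + (\<integral>\<^sup>+x. ennreal (tail M (f x)) \<partial>unit_cube))"
        by (simp add: nn_integral_add nn_integral_cmult sh)
      also have "\<dots> \<le> ennreal K * ennreal (e / (2 * K)) + ennreal c * (ennreal (e / (4 * c)) + ennreal (e / (4 * c)))"
        using \<eta>(2)[OF False] y n unfolding M_def
        by (intro add_mono mult_left_mono) (auto intro: less_imp_le)
      also have "\<dots> = ennreal e"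
        using e c K by (simp add: ennreal_mult[symmetric] ennreal_plus[symmetric] field_simps del: ennreal_plus)
      finally show ?thesis .
    qed (use e p in simp)
  qed (use \<eta> in auto)
qed

section \<open>Lebesgue spaces on the torus\<close>

lemma torus_Lp_norm_nonneg [simp]: "0 \<le> torus_Lp_norm p f"
  by (simp add: torus_Lp_norm_def)

lemma torus_Lp_norm_powr:
  assumes "p > 0" shows "torus_Lp_norm p f powr p = (\<integral>x. norm (f x) powr p \<partial>torus_measure)"
  using assms by (simp add: torus_Lp_norm_def powr_powr integral_nonneg_AE)

lemma nn_integral_torus_measure_AE:
  assumes g: "g \<in> borel_measurable borel" and eq: "AE x in lborel. f x = g x"
  shows "(\<integral>\<^sup>+x. f x \<partial>torus_measure) = (\<integral>\<^sup>+x. g x \<partial>unit_cube)"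
proof -
  have "(\<integral>\<^sup>+x. f x \<partial>torus_measure) = (\<integral>\<^sup>+x. g x \<partial>torus_measure)"
    by (intro nn_integral_cong_AE AE_lborel_imp_torus eq)
  then show ?thesis using nn_integral_torus_measure[OF g] by simp
qed

text \<open>
  The commutator field is estimated for such representatives, by nonnegative integrals over
  \<open>unit_cube\<close>, and the result is carried back to the original function by \<open>torus_LpI\<close>.
\<close>

lemma torus_Lp_borel_representative:
  fixes f :: "real ^ 'n \<Rightarrow> 'b::euclidean_space"
  assumes f: "f \<in> torus_Lp p" and p: "p > 0"
  obtains f' where "f' \<in> borel_measurable borel" "torus_periodic f'" "AE x in lborel. f x = f' x"
    "power_integral p f' = ennreal (torus_Lp_norm p f powr p)"
proof -
  have f1: "torus_periodic f" "f \<in> borel_measurable lebesgue"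
    "integrable torus_measure (\<lambda>x. norm (f x) powr p)" using f by (auto simp: torus_Lp_def)
  from torus_borel_representative[OF f1(1,2)] obtain f'
    where f': "f' \<in> borel_measurable borel" "torus_periodic f'" "AE x in lborel. f x = f' x" .
  note [measurable] = f'(1)
  have "power_integral p f' = (\<integral>\<^sup>+x. ennreal (norm (f x) powr p) \<partial>torus_measure)"
    by (rule nn_integral_torus_measure_AE[symmetric]) (use f'(3) in \<open>measurable, eventually_elim, simp\<close>)
  also have "\<dots> = ennreal (torus_Lp_norm p f powr p)"
    using f1(3) by (subst nn_integral_eq_integral) (auto simp: torus_Lp_norm_powr[OF p])
  finally show ?thesis using f' that by blast
qed

lemma torus_LpI:
  fixes f :: "real ^ 'n \<Rightarrow> 'b::euclidean_space"
  assumes per: "torus_periodic f" and f': "f' \<in> borel_measurable borel" "AE x in lborel. f x = f' x"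
    and p: "p > 0" and C: "C \<ge> 0"
    and bound: "power_integral p f' \<le> ennreal (C powr p)"
  shows "f \<in> torus_Lp p" "torus_Lp_norm p f \<le> C"
proof -
  note [measurable] = f'(1)
  have fm: "f \<in> borel_measurable lebesgue" by (rule lebesgue_measurable_AE_cong[OF f'])
  note fm' = borel_measurable_torus_measure[OF fm]
  have eq: "(\<integral>\<^sup>+x. ennreal (norm (f x) powr p) \<partial>torus_measure) = power_integral p f'"
    by (rule nn_integral_torus_measure_AE) (use f'(2) in \<open>measurable, eventually_elim, simp\<close>)
  have int: "integrable torus_measure (\<lambda>x. norm (f x) powr p)"
    unfolding integrable_iff_bounded using fm' eq bound
    by (auto simp: le_less_trans[OF bound])
  then show "f \<in> torus_Lp p" using per fm by (simp add: torus_Lp_def)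
  have "ennreal (torus_Lp_norm p f powr p) \<le> ennreal (C powr p)"
    using int bound eq by (subst (asm) nn_integral_eq_integral) (auto simp: torus_Lp_norm_powr[OF p])
  then have "torus_Lp_norm p f powr p \<le> C powr p" by (simp add: ennreal_le_iff)
  then show "torus_Lp_norm p f \<le> C"
    using p C by (meson powr_less_mono2 torus_Lp_norm_nonneg not_le)
qed

lemma norm_add_powr_le:
  fixes u v :: "'b::real_normed_vector"
  assumes "p > 0"
  shows "norm (u + v) powr p \<le> 2 powr p * (norm u powr p + norm v powr p)"
proof -
  define m where "m = max (norm u) (norm v)"
  have "norm (u + v) \<le> 2 * m" unfolding m_def by norm
  then have "norm (u + v) powr p \<le> (2 * m) powr p" using assms by (intro powr_mono2) auto
  also have "\<dots> = 2 powr p * m powr p" by (simp add: powr_mult m_def)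
  also have "\<dots> \<le> 2 powr p * (norm u powr p + norm v powr p)"
    by (intro mult_left_mono) (auto simp: m_def max_def)
  finally show ?thesis .
qed

lemma torus_Lp_add:
  fixes f g :: "real ^ 'n \<Rightarrow> 'b::euclidean_space"
  assumes f: "f \<in> torus_Lp p" and g: "g \<in> torus_Lp p" and p: "p > 0"
  shows "(\<lambda>x. f x + g x) \<in> torus_Lp p"
proof -
  have m: "f \<in> borel_measurable lebesgue" "g \<in> borel_measurable lebesgue"
    using f g by (auto simp: torus_Lp_def)
  note m' = m[THEN borel_measurable_torus_measure]
  have "integrable torus_measure (\<lambda>x. 2 powr p * (norm (f x) powr p + norm (g x) powr p))"
    using f g by (auto simp: torus_Lp_def)
  then have "integrable torus_measure (\<lambda>x. norm (f x + g x) powr p)"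
    by (rule Bochner_Integration.integrable_bound) (use m' in \<open>auto intro!: AE_I2 norm_add_powr_le[OF p]\<close>)
  then show ?thesis using f g m by (auto simp: torus_Lp_def torus_periodic_def)
qed

lemma torus_Lp_scaleR:
  fixes f :: "real ^ 'n \<Rightarrow> 'b::euclidean_space"
  assumes f: "f \<in> torus_Lp p"
  shows "(\<lambda>x. c *\<^sub>R f x) \<in> torus_Lp p"
  using f by (auto simp: torus_Lp_def torus_periodic_def powr_mult)

lemma torus_Lp_diff:
  fixes f g :: "real ^ 'n \<Rightarrow> 'b::euclidean_space"
  assumes f: "f \<in> torus_Lp p" and g: "g \<in> torus_Lp p" and p: "p > 0"
  shows "(\<lambda>x. f x - g x) \<in> torus_Lp p"
  using torus_Lp_add[OF f torus_Lp_scaleR[OF g, of "-1"] p] by simp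

section \<open>The commutator field\<close>

definition prob_kernel :: "(real ^ 'n \<Rightarrow> real) \<Rightarrow> bool" where
  "prob_kernel k \<longleftrightarrow> k \<in> borel_measurable borel \<and> (\<forall>y. 0 \<le> k y) \<and> (\<integral>\<^sup>+y. ennreal (k y) \<partial>lborel) = 1"

text \<open>
  The vector field whose divergence is the commutator, up to sign. In terms of convolutions it is
  \<open>(w b) * k - (w * k) b\<close>; written as one average of \<open>w\<close> times an increment of \<open>b\<close> it is visibly small
  when \<open>k\<close> concentrates at the origin.
\<close>

definition commutator_field ::
    "(real ^ 'n \<Rightarrow> real) \<Rightarrow> (real ^ 'n \<Rightarrow> 'b::euclidean_space) \<Rightarrow> (real ^ 'n \<Rightarrow> real) \<Rightarrow> real ^ 'n \<Rightarrow> 'b" where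
  "commutator_field k b w x = (\<integral>y. k y *\<^sub>R (w (x - y) *\<^sub>R (b (x - y) - b x)) \<partial>lebesgue)"

lemma commutator_field_periodic:
  assumes "torus_periodic b" "torus_periodic w"
  shows "torus_periodic (commutator_field k b w)"
proof -
  have "b (x + z - y) = b (x - y)" "w (x + z - y) = w (x - y)" if "\<forall>i. z $ i \<in> \<int>" for x y z
  proof -
    have "x + z - y = (x - y) + z" by simp
    then show "b (x + z - y) = b (x - y)" "w (x + z - y) = w (x - y)"
      using assms that unfolding torus_periodic_def by metis+
  qed
  then show ?thesis using assms unfolding torus_periodic_def commutator_field_def by simp
qed

text \<open>
  Joint integrability from a uniform bound on the \<open>x\<close>-slices. It supplies the hypotheses of Fubini's
  theorem and the almost everywhere existence of all kernel averages.
\<close>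

lemma kernel_average_integrable:
  fixes G :: "real ^ 'n \<Rightarrow> real ^ 'n \<Rightarrow> 'b::euclidean_space"
  assumes k: "prob_kernel k"
    and G [measurable]: "(\<lambda>z. G (fst z) (snd z)) \<in> borel_measurable (borel \<Otimes>\<^sub>M borel)"
    and bound: "\<And>y. (\<integral>\<^sup>+x. ennreal ((norm (G x y))\<^sup>2) \<partial>unit_cube) \<le> ennreal C"
  shows "integrable (unit_cube \<Otimes>\<^sub>M lborel) (\<lambda>z. k (snd z) *\<^sub>R G (fst z) (snd z))"
proof -
  have [measurable]: "k \<in> borel_measurable borel" and k0: "\<And>y. 0 \<le> k y"
    and k1: "(\<integral>\<^sup>+y. ennreal (k y) \<partial>lborel) = 1" using k by (auto simp: prob_kernel_def)
  have [measurable]: "(\<lambda>z. G (fst z) (snd z)) \<in> borel_measurable (unit_cube \<Otimes>\<^sub>M lborel)"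
    using G by (subst measurable_cong_sets[OF sets_pair_measure_cong[OF sets_unit_cube sets_lborel] refl])
  have [measurable]: "(\<lambda>x. G x y) \<in> borel_measurable borel" for y
    using measurable_compose[OF measurable_Pair2' G, of y] by simp
  show ?thesis unfolding integrable_iff_bounded
  proof
    let ?m = "\<lambda>y. (\<integral>\<^sup>+x. ennreal (norm (k y *\<^sub>R G x y)) \<partial>unit_cube)"
    have "(\<integral>\<^sup>+z. ennreal (norm (k (snd z) *\<^sub>R G (fst z) (snd z))) \<partial>(unit_cube \<Otimes>\<^sub>M lborel)) =
        (\<integral>\<^sup>+y. ?m y \<partial>lborel)"
      by (subst cube_space.nn_integral_snd[symmetric]) auto
    also have "\<dots> \<le> (\<integral>\<^sup>+y. ennreal (k y) * ennreal (1 + max 0 C) \<partial>lborel)"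
    proof (rule nn_integral_mono)
      fix y
      have "?m y \<le>
          (\<integral>\<^sup>+x. ennreal (k y) * (1 + ennreal ((norm (G x y))\<^sup>2)) \<partial>unit_cube)"
      proof (rule nn_integral_mono)
        fix x
        \<comment> \<open>The cube has measure one, so a square bound controls the integral itself.\<close>
        have "norm (G x y) \<le> 1 + (norm (G x y))\<^sup>2"
          using zero_le_power2[of "norm (G x y) - 1"] by (simp add: power2_diff)
            (smt (verit) norm_ge_zero zero_le_power2)
        then have "k y * norm (G x y) \<le> k y * (1 + (norm (G x y))\<^sup>2)" by (intro mult_left_mono k0)
        then have "ennreal (norm (k y *\<^sub>R G x y)) \<le> ennreal (k y * (1 + (norm (G x y))\<^sup>2))"
          using k0 by (intro ennreal_leI) simp
        also have "\<dots> = ennreal (k y) * (1 + ennreal ((norm (G x y))\<^sup>2))"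
          by (simp only: ennreal_mult ennreal_plus ennreal_1 add_nonneg_nonneg zero_le_one zero_le_power2 k0)
        finally show "ennreal (norm (k y *\<^sub>R G x y)) \<le> ennreal (k y) * (1 + ennreal ((norm (G x y))\<^sup>2))" .
      qed
      also have "\<dots> = ennreal (k y) * (1 + (\<integral>\<^sup>+x. ennreal ((norm (G x y))\<^sup>2) \<partial>unit_cube))"
        by (simp add: nn_integral_cmult nn_integral_add emeasure_unit_cube)
      also have "\<dots> \<le> ennreal (k y) * (1 + ennreal C)" by (intro mult_left_mono add_left_mono bound) simp
      also have "\<dots> \<le> ennreal (k y) * (1 + ennreal (max 0 C))"
        by (intro mult_left_mono add_left_mono ennreal_leI) auto
      finally show "?m y \<le> ennreal (k y) * ennreal (1 + max 0 C)"
        by (simp only: ennreal_plus ennreal_1 zero_le_one max.cobounded1)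
    qed
    also have "\<dots> < \<infinity>" by (simp add: nn_integral_multc k1)
    finally show "(\<integral>\<^sup>+z. ennreal (norm (k (snd z) *\<^sub>R G (fst z) (snd z))) \<partial>(unit_cube \<Otimes>\<^sub>M lborel)) < \<infinity>" .
  qed measurable
qed

lemma commutator_field_borel [measurable]:
  fixes b :: "real ^ 'n \<Rightarrow> 'b::euclidean_space"
  assumes [measurable]: "k \<in> borel_measurable borel" "b \<in> borel_measurable borel" "w \<in> borel_measurable borel"
  shows "commutator_field k b w \<in> borel_measurable borel"
proof -
  have "commutator_field k b w x = (\<integral>y. k y *\<^sub>R (w (x - y) *\<^sub>R (b (x - y) - b x)) \<partial>lborel)" for x
    unfolding commutator_field_def by (rule integral_completion) measurable
  then have "commutator_field k b w = (\<lambda>x. \<integral>y. k y *\<^sub>R (w (x - y) *\<^sub>R (b (x - y) - b x)) \<partial>lborel)" by (rule ext)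
  then show ?thesis by simp
qed

text \<open>
  Jensen's inequality under the probability density \<open>k\<close>, then Tonelli's theorem: the norm of the
  field is at most the largest norm of \<open>w (x - y) *\<^sub>R (b (x - y) - b x)\<close> for \<open>y\<close> in the support of \<open>k\<close>.
\<close>

lemma commutator_field_sq_le:
  fixes b :: "real ^ 'n \<Rightarrow> 'b::euclidean_space"
  assumes k: "prob_kernel k"
    and [measurable]: "b \<in> borel_measurable borel" "w \<in> borel_measurable borel"
    and bound: "\<And>y. k y \<noteq> 0 \<Longrightarrow> (\<integral>\<^sup>+x. ennreal ((\<bar>w (x - y)\<bar> * norm (b (x - y) - b x))\<^sup>2) \<partial>unit_cube) \<le> C"
  shows "(\<integral>\<^sup>+x. ennreal ((norm (commutator_field k b w x))\<^sup>2) \<partial>unit_cube) \<le> C"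
proof -
  let ?h = "\<lambda>x y. ennreal ((\<bar>w (x - y)\<bar> * norm (b (x - y) - b x))\<^sup>2)"
  have [measurable]: "k \<in> borel_measurable borel" and k0: "\<And>y. 0 \<le> k y"
    and k1: "(\<integral>\<^sup>+y. ennreal (k y) \<partial>lborel) = 1" using k by (auto simp: prob_kernel_def)
  have "(\<integral>\<^sup>+x. ennreal ((norm (commutator_field k b w x))\<^sup>2) \<partial>unit_cube) \<le>
      (\<integral>\<^sup>+x. (\<integral>\<^sup>+y. ennreal (k y) * ?h x y \<partial>lborel) \<partial>unit_cube)"
  proof (rule nn_integral_mono)
    fix x
    have "commutator_field k b w x = (\<integral>y. k y *\<^sub>R (w (x - y) *\<^sub>R (b (x - y) - b x)) \<partial>lborel)"
      unfolding commutator_field_def by (rule integral_completion) measurable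
    then show "ennreal ((norm (commutator_field k b w x))\<^sup>2) \<le>
        (\<integral>\<^sup>+y. ennreal (k y) * ?h x y \<partial>lborel)"
      using norm_weighted_average_sq_le[of k lborel "\<lambda>y. w (x - y) *\<^sub>R (b (x - y) - b x)"] k0 k1
      by simp
  qed
  also have "\<dots> = (\<integral>\<^sup>+y. (\<integral>\<^sup>+x. ennreal (k y) * ?h x y \<partial>unit_cube) \<partial>lborel)"
    by (rule cube_space.Fubini'[symmetric]) measurable
  also have "\<dots> \<le> (\<integral>\<^sup>+y. ennreal (k y) * C \<partial>lborel)"
  proof (rule nn_integral_mono)
    fix y
    have "(\<integral>\<^sup>+x. ennreal (k y) * ?h x y \<partial>unit_cube) =
        ennreal (k y) * (\<integral>\<^sup>+x. ?h x y \<partial>unit_cube)"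
      by (rule nn_integral_cmult) measurable
    also have "\<dots> \<le> ennreal (k y) * C"
      by (cases "k y = 0") (auto intro!: mult_left_mono bound)
    finally show "(\<integral>\<^sup>+x. ennreal (k y) * ?h x y \<partial>unit_cube) \<le> ennreal (k y) * C" .
  qed
  also have "\<dots> = C" by (simp add: nn_integral_multc k1)
  finally show ?thesis .
qed

lemma commutator_field_AE_cong:
  fixes b :: "real ^ 'n \<Rightarrow> 'b::euclidean_space"
  assumes [measurable]: "k \<in> borel_measurable borel" "b' \<in> borel_measurable borel" "w' \<in> borel_measurable borel"
    and b: "AE x in lborel. b x = b' x" and w: "AE x in lborel. w x = w' x"
  shows "AE x in lborel. commutator_field k b w x = commutator_field k b' w' x"
  using b
proof eventually_elim
  case (elim x)
  have "AE y in lborel. k y *\<^sub>R (w (x - y) *\<^sub>R (b (x - y) - b x)) = k y *\<^sub>R (w' (x - y) *\<^sub>R (b' (x - y) - b' x))"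
    using AE_lborel_reflect[OF b, of x] AE_lborel_reflect[OF w, of x] by eventually_elim (simp add: elim)
  then have "commutator_field k b w x = (\<integral>y. k y *\<^sub>R (w' (x - y) *\<^sub>R (b' (x - y) - b' x)) \<partial>lborel)"
    unfolding commutator_field_def by (intro integral_lebesgue_AE) measurable
  also have "\<dots> = commutator_field k b' w' x"
    unfolding commutator_field_def by (rule integral_completion[symmetric]) measurable
  finally show ?case .
qed

lemma nn_integral_Lp_shift:
  fixes f :: "real ^ 'n \<Rightarrow> 'b::euclidean_space"
  assumes "f \<in> borel_measurable borel" "torus_periodic f"
  shows "(\<integral>\<^sup>+x. ennreal (norm (f (x - a)) powr p) \<partial>unit_cube) = power_integral p f"
  using nn_integral_torus_shift[OF _ torus_periodic_comp[OF assms(2)], of "\<lambda>z. ennreal (norm z powr p)" "- a"] assms(1)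
  by simp

text \<open>
  Hoelder's inequality for independently translated factors: each translation preserves the norm.
\<close>

lemma product_shift_sq_le:
  fixes b :: "real ^ 'n \<Rightarrow> 'b::euclidean_space" and w :: "real ^ 'n \<Rightarrow> real"
  assumes pq: "p > 0" "q > 0" "1 / p + 1 / q \<le> 1 / 2" and AB: "A \<ge> 0" "B \<ge> 0"
    and [measurable]: "b \<in> borel_measurable borel" "w \<in> borel_measurable borel"
    and per: "torus_periodic b" "torus_periodic w"
    and b: "power_integral p b \<le> ennreal (B powr p)"
    and w: "power_integral q w \<le> ennreal (A powr q)"
  shows "(\<integral>\<^sup>+x. ennreal ((\<bar>w (x - a)\<bar> * norm (b (x - c)))\<^sup>2) \<partial>unit_cube) \<le> ennreal ((A * B)\<^sup>2)"
proof (rule Holder_half[OF _ _ _ _ _ pq AB])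
  show "(\<integral>\<^sup>+x. ennreal (\<bar>w (x - a)\<bar> powr q) \<partial>unit_cube) \<le> ennreal (A powr q)"
    using nn_integral_Lp_shift[of w a q] per w by simp
  show "(\<integral>\<^sup>+x. ennreal (norm (b (x - c)) powr p) \<partial>unit_cube) \<le> ennreal (B powr p)"
    using nn_integral_Lp_shift[of b c p] per b by simp
qed (auto simp: emeasure_unit_cube)

lemma oscillation_product_sq_le:
  fixes b :: "real ^ 'n \<Rightarrow> 'b::euclidean_space" and w :: "real ^ 'n \<Rightarrow> real"
  assumes pq: "p > 0" "q > 0" "1 / p + 1 / q \<le> 1 / 2" and AB: "A \<ge> 0" "B \<ge> 0"
    and meas [measurable]: "b \<in> borel_measurable borel" "w \<in> borel_measurable borel"
    and per: "torus_periodic b" "torus_periodic w"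
    and b: "power_integral p b \<le> ennreal (B powr p)"
    and w: "power_integral q w \<le> ennreal (A powr q)"
  shows "(\<integral>\<^sup>+x. ennreal ((\<bar>w (x - y)\<bar> * norm (b (x - y) - b x))\<^sup>2) \<partial>unit_cube) \<le> ennreal ((2 * A * B)\<^sup>2)"
proof -
  let ?h = "\<lambda>x. ennreal ((\<bar>w (x - y)\<bar> * norm (b (x - y) - b x))\<^sup>2)"
  note P = product_shift_sq_le[OF pq AB meas per b w]
  have "(\<integral>\<^sup>+x. ?h x \<partial>unit_cube) \<le>
      (\<integral>\<^sup>+x. 2 * (ennreal ((\<bar>w (x - y)\<bar> * norm (b (x - y)))\<^sup>2) + ennreal ((\<bar>w (x - y)\<bar> * norm (b (x - 0)))\<^sup>2)) \<partial>unit_cube)"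
  proof (rule nn_integral_mono)
    fix x
    define u v where "u = \<bar>w (x - y)\<bar> * norm (b (x - y))" and "v = \<bar>w (x - y)\<bar> * norm (b x)"
    have "\<bar>w (x - y)\<bar> * norm (b (x - y) - b x) \<le> u + v"
      unfolding u_def v_def distrib_left[symmetric] by (intro mult_left_mono norm_triangle_ineq4) simp
    then have "(\<bar>w (x - y)\<bar> * norm (b (x - y) - b x))\<^sup>2 \<le> (u + v)\<^sup>2" by (intro power_mono) auto
    also have "\<dots> \<le> 2 * (u\<^sup>2 + v\<^sup>2)" using zero_le_power2[of "u - v"] by (simp add: power2_sum power2_diff)
    finally have "?h x \<le> ennreal (2 * (u\<^sup>2 + v\<^sup>2))"
      by (rule ennreal_leI)
    also have "\<dots> = 2 * (ennreal (u\<^sup>2) + ennreal (v\<^sup>2))" by (simp add: ennreal_mult ennreal_plus)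
    finally show "?h x \<le>
        2 * (ennreal ((\<bar>w (x - y)\<bar> * norm (b (x - y)))\<^sup>2) + ennreal ((\<bar>w (x - y)\<bar> * norm (b (x - 0)))\<^sup>2))"
      by (simp add: u_def v_def)
  qed
  also have "\<dots> = 2 * ((\<integral>\<^sup>+x. ennreal ((\<bar>w (x - y)\<bar> * norm (b (x - y)))\<^sup>2) \<partial>unit_cube) +
      (\<integral>\<^sup>+x. ennreal ((\<bar>w (x - y)\<bar> * norm (b (x - 0)))\<^sup>2) \<partial>unit_cube))"
    by (simp add: nn_integral_cmult nn_integral_add)
  also have "\<dots> \<le> 2 * (ennreal ((A * B)\<^sup>2) + ennreal ((A * B)\<^sup>2))"
    by (intro mult_left_mono add_mono P) simp
  also have "\<dots> = ennreal (2 * ((A * B)\<^sup>2 + (A * B)\<^sup>2))"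
    by (simp only: ennreal_plus ennreal_mult[of 2 "(A * B)\<^sup>2 + (A * B)\<^sup>2"] ennreal_numeral
        add_nonneg_nonneg zero_le_numeral zero_le_power2)
  also have "2 * ((A * B)\<^sup>2 + (A * B)\<^sup>2) = (2 * A * B)\<^sup>2" by (simp add: power_mult_distrib)
  finally show ?thesis .
qed

lemma powr_2_eq: "x \<ge> 0 \<Longrightarrow> x powr 2 = (x::real)\<^sup>2"
  by (simp add: powr_numeral)

text \<open>
  The bound that is uniform in the kernel. It serves as the dominating function in time and makes the
  field a bounded bilinear expression in \<open>(b, w)\<close>.
\<close>

lemma commutator_field_L2:
  fixes b :: "real ^ 'n \<Rightarrow> 'b::euclidean_space" and w :: "real ^ 'n \<Rightarrow> real"
  assumes pq: "p > 0" "q > 0" "1 / p + 1 / q \<le> 1 / 2" and k: "prob_kernel k"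
    and b: "b \<in> torus_Lp p" and w: "w \<in> torus_Lp q"
  shows "commutator_field k b w \<in> torus_Lp 2"
    "torus_Lp_norm 2 (commutator_field k b w) \<le> 2 * torus_Lp_norm q w * torus_Lp_norm p b"
proof -
  have [measurable]: "k \<in> borel_measurable borel" using k by (simp add: prob_kernel_def)
  obtain b' where b' [measurable]: "b' \<in> borel_measurable borel" and b'': "torus_periodic b'" "AE x in lborel. b x = b' x"
    "power_integral p b' = ennreal (torus_Lp_norm p b powr p)"
    by (rule torus_Lp_borel_representative[OF b pq(1)])
  obtain w' where w' [measurable]: "w' \<in> borel_measurable borel" and w'': "torus_periodic w'" "AE x in lborel. w x = w' x"
    "power_integral q w' = ennreal (torus_Lp_norm q w powr q)"
    by (rule torus_Lp_borel_representative[OF w pq(2)])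
  have per: "torus_periodic (commutator_field k b w)"
    using b w by (intro commutator_field_periodic) (auto simp: torus_Lp_def)
  have eq: "AE x in lborel. commutator_field k b w x = commutator_field k b' w' x"
    by (intro commutator_field_AE_cong b'' w'') measurable
  have "(\<integral>\<^sup>+x. ennreal ((norm (commutator_field k b' w' x))\<^sup>2) \<partial>unit_cube) \<le> ennreal ((2 * torus_Lp_norm q w * torus_Lp_norm p b)\<^sup>2)"
    by (intro commutator_field_sq_le[OF k b' w'] oscillation_product_sq_le[OF pq _ _ b' w' b''(1) w''(1)])
      (use b''(3) w''(3) in auto)
  then have le: "(\<integral>\<^sup>+x. ennreal (norm (commutator_field k b' w' x) powr 2) \<partial>unit_cube) \<le>
      ennreal ((2 * torus_Lp_norm q w * torus_Lp_norm p b) powr 2)"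
    by (simp add: powr_2_eq)
  show "commutator_field k b w \<in> torus_Lp 2"
    "torus_Lp_norm 2 (commutator_field k b w) \<le> 2 * torus_Lp_norm q w * torus_Lp_norm p b"
    by (rule torus_LpI[OF per _ eq _ _ le]; simp)+
qed

text \<open>
  Continuity of translations enters here: it gives one radius \<open>\<eta>\<close> for all kernels supported in that
  radius and for all \<open>w\<close>.
\<close>

lemma commutator_field_small:
  fixes b :: "real ^ 'n \<Rightarrow> 'b::euclidean_space"
  assumes pq: "p > 0" "q > 0" "1 / p + 1 / q \<le> 1 / 2" and b: "b \<in> torus_Lp p" and e: "e > 0"
  obtains \<eta> where "\<eta> > 0" "\<And>k w. prob_kernel k \<Longrightarrow> (\<And>y. k y \<noteq> 0 \<Longrightarrow> norm y < \<eta>) \<Longrightarrow> w \<in> torus_Lp q \<Longrightarrow>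
    torus_Lp_norm 2 (commutator_field k b w) \<le> torus_Lp_norm q w * e"
proof -
  obtain b' where b' [measurable]: "b' \<in> borel_measurable borel" and b'': "torus_periodic b'" "AE x in lborel. b x = b' x"
    "power_integral p b' = ennreal (torus_Lp_norm p b powr p)"
    by (rule torus_Lp_borel_representative[OF b pq(1)])
  \<comment> \<open>A positive \<open>1 / q\<close> leaves \<open>1 / p\<close> strictly below one half.\<close>
  have "1 / q > 0" using pq by simp
  then have "1 / p < 1" using pq(3) by linarith
  then have p1: "p \<ge> 1" using pq by (simp add: field_simps)
  obtain \<eta> where \<eta>: "\<eta> > 0"
    "\<And>y. norm y < \<eta> \<Longrightarrow> (\<integral>\<^sup>+x. ennreal (norm (b' (x - y) - b' x) powr p) \<partial>unit_cube) \<le> ennreal (e powr p)"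
    by (rule translation_continuous_Lp[OF b' b''(1) p1, of "e powr p"]) (use b''(3) e in auto)
  show ?thesis
  proof (rule that[OF \<eta>(1)])
    fix k :: "real ^ 'n \<Rightarrow> real" and w :: "real ^ 'n \<Rightarrow> real"
    assume k: "prob_kernel k" and supp: "\<And>y. k y \<noteq> 0 \<Longrightarrow> norm y < \<eta>" and w: "w \<in> torus_Lp q"
    have [measurable]: "k \<in> borel_measurable borel" using k by (simp add: prob_kernel_def)
    obtain w' where w' [measurable]: "w' \<in> borel_measurable borel" and w'': "torus_periodic w'" "AE x in lborel. w x = w' x"
      "power_integral q w' = ennreal (torus_Lp_norm q w powr q)"
      by (rule torus_Lp_borel_representative[OF w pq(2)])
    have per: "torus_periodic (commutator_field k b w)"
      using b w by (intro commutator_field_periodic) (auto simp: torus_Lp_def)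
    have eq: "AE x in lborel. commutator_field k b w x = commutator_field k b' w' x"
      by (intro commutator_field_AE_cong b'' w'') measurable
    have "(\<integral>\<^sup>+x. ennreal ((norm (commutator_field k b' w' x))\<^sup>2) \<partial>unit_cube) \<le> ennreal ((torus_Lp_norm q w * e)\<^sup>2)"
    proof (rule commutator_field_sq_le[OF k b' w'])
      fix y assume "k y \<noteq> 0"
      then have y: "norm y < \<eta>" by (rule supp)
      show "(\<integral>\<^sup>+x. ennreal ((\<bar>w' (x - y)\<bar> * norm (b' (x - y) - b' x))\<^sup>2) \<partial>unit_cube) \<le> ennreal ((torus_Lp_norm q w * e)\<^sup>2)"
      proof (rule Holder_half[OF _ _ _ _ _ pq])
        show "(\<integral>\<^sup>+x. ennreal (\<bar>w' (x - y)\<bar> powr q) \<partial>unit_cube) \<le> ennreal (torus_Lp_norm q w powr q)"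
          using nn_integral_Lp_shift[of w' y q] w'' by simp
      qed (use e \<eta>(2)[OF y] in \<open>auto simp: emeasure_unit_cube\<close>)
    qed
    then have le: "(\<integral>\<^sup>+x. ennreal (norm (commutator_field k b' w' x) powr 2) \<partial>unit_cube) \<le>
        ennreal ((torus_Lp_norm q w * e) powr 2)"
      using e by (simp add: powr_2_eq)
    show "torus_Lp_norm 2 (commutator_field k b w) \<le> torus_Lp_norm q w * e"
      by (rule torus_LpI(2)[OF per _ eq _ _ le]) (use e in auto)
  qed
qed

lemma commutator_field_integrable:
  fixes b :: "real ^ 'n \<Rightarrow> 'b::euclidean_space" and w :: "real ^ 'n \<Rightarrow> real"
  assumes pq: "p > 0" "q > 0" "1 / p + 1 / q \<le> 1 / 2" and k: "prob_kernel k"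
    and b: "b \<in> torus_Lp p" and w: "w \<in> torus_Lp q"
  shows "AE x in torus_measure. integrable lebesgue (\<lambda>y. k y *\<^sub>R (w (x - y) *\<^sub>R (b (x - y) - b x)))"
proof -
  have [measurable]: "k \<in> borel_measurable borel" using k by (simp add: prob_kernel_def)
  obtain b' where b' [measurable]: "b' \<in> borel_measurable borel" and b'': "torus_periodic b'" "AE x in lborel. b x = b' x"
    "power_integral p b' = ennreal (torus_Lp_norm p b powr p)"
    by (rule torus_Lp_borel_representative[OF b pq(1)])
  obtain w' where w' [measurable]: "w' \<in> borel_measurable borel" and w'': "torus_periodic w'" "AE x in lborel. w x = w' x"
    "power_integral q w' = ennreal (torus_Lp_norm q w powr q)"
    by (rule torus_Lp_borel_representative[OF w pq(2)])
  have "integrable (unit_cube \<Otimes>\<^sub>M lborel) (\<lambda>z. k (snd z) *\<^sub>R (w' (fst z - snd z) *\<^sub>R (b' (fst z - snd z) - b' (fst z))))"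
  proof (rule kernel_average_integrable[OF k])
    show "(\<integral>\<^sup>+x. ennreal ((norm (w' (x - y) *\<^sub>R (b' (x - y) - b' x)))\<^sup>2) \<partial>unit_cube) \<le>
        ennreal ((2 * torus_Lp_norm q w * torus_Lp_norm p b)\<^sup>2)" for y
      using oscillation_product_sq_le[OF pq _ _ b' w' b''(1) w''(1), of "torus_Lp_norm q w" "torus_Lp_norm p b" y]
        b''(3) w''(3) by simp
  qed measurable
  from cube_space.AE_integrable_fst'[OF this]
  have "AE x in unit_cube. integrable lborel (\<lambda>y. k y *\<^sub>R (w' (x - y) *\<^sub>R (b' (x - y) - b' x)))" by simp
  moreover have "AE x in unit_cube. b x = b' x" by (rule AE_lborel_imp_unit_cube[OF b''(2)])
  ultimately have "AE x in unit_cube. integrable lebesgue (\<lambda>y. k y *\<^sub>R (w (x - y) *\<^sub>R (b (x - y) - b x)))"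
  proof eventually_elim
    case (elim x)
    let ?I' = "\<lambda>y. k y *\<^sub>R (w' (x - y) *\<^sub>R (b' (x - y) - b' x))"
    have eq: "AE y in lborel. k y *\<^sub>R (w (x - y) *\<^sub>R (b (x - y) - b x)) = ?I' y"
      using AE_lborel_reflect[OF b''(2), of x] AE_lborel_reflect[OF w''(2), of x]
      by eventually_elim (simp add: elim)
    have "integrable lebesgue ?I'" using elim(1) by (subst integrable_completion) auto
    moreover have "(\<lambda>y. k y *\<^sub>R (w (x - y) *\<^sub>R (b (x - y) - b x))) \<in> borel_measurable lebesgue"
      by (rule lebesgue_measurable_AE_cong[OF _ eq]) measurable
    ultimately show ?case
      by (rule Bochner_Integration.integrable_cong_AE_imp)
        (use eq in \<open>auto simp: AE_completion_iff eq_commute\<close>)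
  qed
  then show ?thesis by (rule AE_unit_cube_imp_torus)
qed

text \<open>
  Bilinearity of the field, arranged so that every term contains a difference and the other factor is
  \<open>b\<close>, \<open>w\<close> or again a difference: with \<open>b\<close> and \<open>w\<close> fixed, the field converges as soon as the differences
  tend to zero.
\<close>

lemma commutator_field_diff:
  fixes b s :: "real ^ 'n \<Rightarrow> 'b::euclidean_space" and w v :: "real ^ 'n \<Rightarrow> real"
  assumes pq: "p > 0" "q > 0" "1 / p + 1 / q \<le> 1 / 2" and k: "prob_kernel k"
    and bs: "b \<in> torus_Lp p" "s \<in> torus_Lp p" and wv: "w \<in> torus_Lp q" "v \<in> torus_Lp q"
  shows "AE x in torus_measure. commutator_field k b w x - commutator_field k s v x =
    commutator_field k (\<lambda>x. b x - s x) w x + commutator_field k b (\<lambda>x. w x - v x) x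
      - commutator_field k (\<lambda>x. b x - s x) (\<lambda>x. w x - v x) x"
proof -
  note I = commutator_field_integrable[OF pq k]
  note d = torus_Lp_diff[OF bs pq(1)] torus_Lp_diff[OF wv pq(2)]
  from I[OF bs(1) wv(1)] I[OF bs(2) wv(2)] I[OF d(1) wv(1)] I[OF bs(1) d(2)] I[OF d(1) d(2)]
  show ?thesis
  proof eventually_elim
    case (elim x)
    show ?case unfolding commutator_field_def
      by (subst Bochner_Integration.integral_diff[OF elim(1,2), symmetric],
          subst Bochner_Integration.integral_add[OF elim(3,4), symmetric],
          subst Bochner_Integration.integral_diff[OF Bochner_Integration.integrable_add[OF elim(3,4)] elim(5), symmetric])
        (simp add: algebra_simps scaleR_left_diff_distrib)
  qed
qed

section \<open>Gradients of smooth functions\<close>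

lemma has_derivative_grad:
  fixes u :: "real ^ 'n \<Rightarrow> real"
  assumes "u differentiable at x"
  shows "(u has_derivative (\<lambda>h. grad u x \<bullet> h)) (at x)"
proof -
  have d: "(u has_derivative frechet_derivative u (at x)) (at x)"
    using assms by (simp add: frechet_derivative_works)
  interpret L: bounded_linear "frechet_derivative u (at x)" by (rule has_derivative_bounded_linear[OF d])
  have "frechet_derivative u (at x) h = grad u x \<bullet> h" for h
  proof -
    have "frechet_derivative u (at x) h = frechet_derivative u (at x) (\<Sum>i\<in>UNIV. (h $ i) *\<^sub>R axis i 1)"
      using basis_expansion[of h] by (simp add: scalar_mult_eq_scaleR)
    also have "\<dots> = (\<Sum>i\<in>UNIV. h $ i * frechet_derivative u (at x) (axis i 1))"
      by (simp add: L.sum L.scaleR)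
    also have "\<dots> = grad u x \<bullet> h" by (simp add: grad_def inner_vec_def mult.commute)
    finally show ?thesis .
  qed
  then have "frechet_derivative u (at x) = (\<lambda>h. grad u x \<bullet> h)" by (rule ext)
  with d show ?thesis by simp
qed

lemma grad_eqI:
  fixes u :: "real ^ 'n \<Rightarrow> real"
  assumes "(u has_derivative (\<lambda>h. D \<bullet> h)) (at x)"
  shows "grad u x = D"
  unfolding grad_def frechet_derivative_at[OF assms, symmetric] by (simp add: vec_eq_iff inner_axis)

lemma smooth_has_derivative:
  fixes u :: "real ^ 'n \<Rightarrow> real"
  assumes "smooth_function u"
  shows "(u has_derivative (\<lambda>h. grad u x \<bullet> h)) (at x)"
proof -
  have "Ck_function (Suc 0) u" using assms unfolding smooth_function_def by blast
  then show ?thesis by (intro has_derivative_grad) simp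
qed

lemma smooth_directional_derivative:
  fixes u :: "real ^ 'n \<Rightarrow> real"
  assumes "smooth_function u"
  shows "smooth_function (\<lambda>x. frechet_derivative u (at x) v)"
  unfolding smooth_function_def
proof
  fix k
  have "Ck_function (Suc k) u" using assms unfolding smooth_function_def by blast
  then show "Ck_function k (\<lambda>x. frechet_derivative u (at x) v)" by simp
qed

lemma has_derivative_everywhere_continuous:
  assumes "\<And>x. (u has_derivative u' x) (at x)"
  shows "continuous_on UNIV u"
  using assms by (meson continuous_at_imp_continuous_on has_derivative_continuous)

lemma smooth_continuous: "smooth_function u \<Longrightarrow> continuous_on UNIV u"
  unfolding smooth_function_def by (metis Ck_function.simps(1))

lemma smooth_continuous_grad:
  fixes u :: "real ^ 'n \<Rightarrow> real"
  assumes "smooth_function u" shows "continuous_on UNIV (grad u)"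
proof -
  have "continuous_on UNIV (\<lambda>x. \<chi> i. frechet_derivative u (at x) (axis i 1))"
    by (intro continuous_on_vec_lambda smooth_continuous smooth_directional_derivative assms)
  then show ?thesis by (simp add: grad_def[abs_def])
qed

lemma torus_periodic_grad:
  fixes u :: "real ^ 'n \<Rightarrow> real"
  assumes u: "\<And>x. (u has_derivative (\<lambda>h. grad u x \<bullet> h)) (at x)" and per: "torus_periodic u"
  shows "torus_periodic (grad u)"
  unfolding torus_periodic_def
proof (intro allI impI)
  fix k x :: "real ^ 'n" assume k: "\<forall>i. k $ i \<in> \<int>"
  have "((\<lambda>x. u (x + k)) has_derivative (\<lambda>h. grad u (x + k) \<bullet> h)) (at x)"
    by (rule has_derivative_compose[of "\<lambda>x. x + k" "\<lambda>h. h", OF _ u]) (auto intro!: derivative_eq_intros)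
  moreover have "(\<lambda>x. u (x + k)) = u" using per k by (auto simp: torus_periodic_def)
  ultimately show "grad u (x + k) = grad u x" using grad_eqI[of u "grad u (x + k)" x] by simp
qed

lemma torus_periodic_continuous_bounded:
  fixes f :: "real ^ 'n \<Rightarrow> 'b::real_normed_vector"
  assumes "continuous_on UNIV f" and per: "torus_periodic f"
  obtains C where "C > 0" "\<And>x. norm (f x) \<le> C"
proof -
  have "compact (f ` cbox 0 1)"
    by (intro compact_continuous_image continuous_on_subset[OF assms(1)]) auto
  then have "bounded (f ` cbox 0 1)" by (rule compact_imp_bounded)
  then obtain C where C: "C > 0" "\<And>z. z \<in> f ` cbox 0 1 \<Longrightarrow> norm z \<le> C" unfolding bounded_pos by blast
  have "norm (f x) \<le> C" for x
  proof -
    have "cell_part x \<in> cbox 0 1" by (simp add: cell_part_def mem_box_cart frac_lt_1 less_imp_le)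
    then show ?thesis using C(2)[OF imageI[of "cell_part x" _ f]] torus_periodic_cell_part[OF per, of x] by simp
  qed
  with C(1) that show ?thesis by blast
qed

lemma torus_smoothD:
  fixes \<phi> :: "real ^ 'n \<Rightarrow> real"
  assumes "\<phi> \<in> torus_smooth"
  shows "(\<phi> has_derivative (\<lambda>h. grad \<phi> x \<bullet> h)) (at x)"
    "continuous_on UNIV \<phi>" "continuous_on UNIV (grad \<phi>)"
    "torus_periodic \<phi>" "torus_periodic (grad \<phi>)"
    "\<phi> \<in> borel_measurable borel" "grad \<phi> \<in> borel_measurable borel"
proof -
  have s: "smooth_function \<phi>" and per: "torus_periodic \<phi>" using assms by (auto simp: torus_smooth_def)
  note d = smooth_has_derivative[OF s] and c = smooth_continuous[OF s] and cg = smooth_continuous_grad[OF s]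
  show "(\<phi> has_derivative (\<lambda>h. grad \<phi> x \<bullet> h)) (at x)" by (rule d)
  show "continuous_on UNIV \<phi>" "continuous_on UNIV (grad \<phi>)" "torus_periodic \<phi>" by (fact c cg per)+
  show "torus_periodic (grad \<phi>)" by (rule torus_periodic_grad[OF d per])
  show "\<phi> \<in> borel_measurable borel" "grad \<phi> \<in> borel_measurable borel"
    by (rule borel_measurable_continuous_onI[OF c] borel_measurable_continuous_onI[OF cg])+
qed

lemma torus_smooth_bounded:
  fixes \<phi> :: "real ^ 'n \<Rightarrow> real"
  assumes \<phi>: "\<phi> \<in> torus_smooth"
  shows "\<exists>C>0. (\<forall>x. \<bar>\<phi> x\<bar> \<le> C) \<and> (\<forall>x. norm (grad \<phi> x) \<le> C)"
proof -
  note D = torus_smoothD[OF \<phi>]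
  obtain C1 where C1: "C1 > 0" "\<And>x. norm (\<phi> x) \<le> C1"
    using torus_periodic_continuous_bounded[OF D(2,4)] by blast
  obtain C2 where C2: "C2 > 0" "\<And>x. norm (grad \<phi> x) \<le> C2"
    using torus_periodic_continuous_bounded[OF D(3,5)] by blast
  have "\<bar>\<phi> x\<bar> \<le> max C1 C2" "norm (grad \<phi> x) \<le> max C1 C2" for x
    using C1(2)[of x] C2(2)[of x] by simp_all
  then show ?thesis using C1(1) by (intro exI[of _ "max C1 C2"]) auto
qed

section \<open>Differentiation under the integral\<close>

lemma gradient_bound_Lipschitz:
  fixes u :: "real ^ 'n \<Rightarrow> real"
  assumes u: "\<And>x. (u has_derivative (\<lambda>h. D x \<bullet> h)) (at x)" and D: "\<And>x. norm (D x) \<le> L"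
  shows "\<bar>u x - u y\<bar> \<le> L * norm (x - y)"
proof -
  have "norm (u x - u y) \<le> L * norm (x - y)"
  proof (rule differentiable_bound[of UNIV u "\<lambda>x h. D x \<bullet> h"])
    fix z
    show "(u has_derivative (\<lambda>h. D z \<bullet> h)) (at z within UNIV)" using u by simp
    show "onorm (\<lambda>h. D z \<bullet> h) \<le> L"
    proof (rule onorm_bound)
      show "0 \<le> L" using D[of z] norm_ge_zero order_trans by blast
      fix h
      have "norm (D z \<bullet> h) \<le> norm (D z) * norm h" by (rule Cauchy_Schwarz_ineq2[folded real_norm_def])
      also have "\<dots> \<le> L * norm h" by (intro mult_right_mono D) simp
      finally show "norm (D z \<bullet> h) \<le> L * norm h" .
    qed
  qed auto
  then show ?thesis by simp
qed

text \<open>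
  The difference quotients along any sequence tending to zero are dominated by \<open>2 * L * \<bar>g y\<bar>\<close>, because
  a bounded gradient makes \<open>u\<close> Lipschitz.
\<close>

lemma convolution_has_derivative:
  fixes g u :: "real ^ 'n \<Rightarrow> real"
  assumes g: "integrable lborel g"
    and u: "\<And>x. (u has_derivative (\<lambda>h. D x \<bullet> h)) (at x)"
    and Dm [measurable]: "D \<in> borel_measurable borel"
    and D: "\<And>x. norm (D x) \<le> L" and K: "\<And>x. \<bar>u x\<bar> \<le> K"
  shows "((\<lambda>x. \<integral>y. g y * u (x - y) \<partial>lborel) has_derivative
    (\<lambda>h. (\<integral>y. g y *\<^sub>R D (x - y) \<partial>lborel) \<bullet> h)) (at x)"
proof -
  define F where "F x = (\<integral>y. g y * u (x - y) \<partial>lborel)" for x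
  define J where "J = (\<integral>y. g y *\<^sub>R D (x - y) \<partial>lborel)"
  have um [measurable]: "u \<in> borel_measurable borel"
    by (rule borel_measurable_continuous_onI[OF has_derivative_everywhere_continuous[OF u]])
  have gm [measurable]: "g \<in> borel_measurable borel" using g by auto
  have iF: "integrable lborel (\<lambda>y. g y * u (z - y))" for z
    by (rule Bochner_Integration.integrable_bound[of _ "\<lambda>y. K * g y"])
      (use g K in \<open>auto intro!: AE_I2 mult_right_mono simp: abs_mult mult.commute[of "\<bar>g _\<bar>"] intro: order_trans[OF K abs_ge_self]\<close>)
  have iJ: "integrable lborel (\<lambda>y. g y *\<^sub>R D (x - y))"
    by (rule Bochner_Integration.integrable_bound[of _ "\<lambda>y. L * g y"])
      (use g D in \<open>auto intro!: AE_I2 mult_right_mono simp: abs_mult mult.commute[of "\<bar>g _\<bar>"] intro: order_trans[OF D abs_ge_self]\<close>)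
  have "((\<lambda>h. norm (F (x + h) - F x - J \<bullet> h) / norm h) \<longlongrightarrow> 0) (at 0)"
  proof (subst LIMSEQ_SEQ_conv[symmetric], intro allI impI, elim conjE)
    fix S :: "nat \<Rightarrow> real ^ 'n" assume S0: "\<forall>n. S n \<noteq> 0" and S: "S \<longlonglongrightarrow> 0"
    let ?r = "\<lambda>n y. u (x - y + S n) - u (x - y) - D (x - y) \<bullet> S n"
    define Q where "Q n y = g y * (?r n y / norm (S n))" for n y
    have "(\<lambda>n. \<integral>y. Q n y \<partial>lborel) \<longlonglongrightarrow> (\<integral>y. 0 \<partial>(lborel :: (real ^ 'n) measure))"
    proof (rule integral_dominated_convergence[where w = "\<lambda>y. 2 * L * \<bar>g y\<bar>"])
      show "AE y in lborel. (\<lambda>n. Q n y) \<longlonglongrightarrow> 0"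
      proof (rule AE_I2)
        fix y
        have "((\<lambda>h. norm (u (x - y + h) - u (x - y) - D (x - y) \<bullet> h) / norm h) \<longlongrightarrow> 0) (at 0)"
          using u[of "x - y"] by (simp add: has_derivative_at)
        then have "(\<lambda>n. norm (?r n y) / norm (S n)) \<longlonglongrightarrow> 0"
          using S S0 by (subst (asm) LIMSEQ_SEQ_conv[symmetric]) blast
        then have "(\<lambda>n. norm (?r n y / norm (S n))) \<longlonglongrightarrow> 0"
          by simp
        then have "(\<lambda>n. ?r n y / norm (S n)) \<longlonglongrightarrow> 0"
          by (rule tendsto_norm_zero_cancel)
        then show "(\<lambda>n. Q n y) \<longlonglongrightarrow> 0" unfolding Q_def by (rule tendsto_mult_right_zero)
      qed
      show "AE y in lborel. norm (Q n y) \<le> 2 * L * \<bar>g y\<bar>" for n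
      proof (rule AE_I2)
        fix y
        have 1: "\<bar>u (x - y + S n) - u (x - y)\<bar> \<le> L * norm (S n)"
          using gradient_bound_Lipschitz[OF u D, of "x - y + S n" "x - y"] by simp
        have "\<bar>D (x - y) \<bullet> S n\<bar> \<le> norm (D (x - y)) * norm (S n)" by (rule Cauchy_Schwarz_ineq2)
        also have "\<dots> \<le> L * norm (S n)" by (intro mult_right_mono D) simp
        finally have "\<bar>?r n y\<bar> \<le> 2 * L * norm (S n)"
          using 1 by linarith
        then have "\<bar>?r n y\<bar> / norm (S n) \<le> 2 * L"
          using S0 by (simp add: pos_divide_le_eq)
        then have "\<bar>g y\<bar> * (\<bar>?r n y\<bar> / norm (S n)) \<le> \<bar>g y\<bar> * (2 * L)"
          by (intro mult_left_mono) auto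
        then show "norm (Q n y) \<le> 2 * L * \<bar>g y\<bar>" by (simp add: Q_def abs_mult mult_ac)
      qed
    qed (use g in \<open>auto simp: Q_def[abs_def]\<close>)
    then have "(\<lambda>n. norm (\<integral>y. Q n y \<partial>lborel)) \<longlonglongrightarrow> 0" by (simp add: tendsto_rabs_zero)
    moreover have "norm (\<integral>y. Q n y \<partial>lborel) = norm (F (x + S n) - F x - J \<bullet> S n) / norm (S n)" for n
    proof -
      have eq: "Q n y = (g y * u (x + S n - y) - g y * u (x - y) - (g y *\<^sub>R D (x - y)) \<bullet> S n) / norm (S n)" for y
        by (simp add: Q_def algebra_simps diff_divide_distrib)
      have "(\<integral>y. Q n y \<partial>lborel) = (F (x + S n) - F x - J \<bullet> S n) / norm (S n)"
        unfolding eq F_def J_def using iF integrable_inner_left[of "S n", OF iJ] iJ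
          integral_inner_left[of "S n" lborel "\<lambda>y. g y *\<^sub>R D (x - y)"]
        by (simp del: inner_scaleR_left)
      then show ?thesis by simp
    qed
    ultimately show "(\<lambda>n. norm (F (x + S n) - F x - J \<bullet> S n) / norm (S n)) \<longlonglongrightarrow> 0" by simp
  qed
  then show ?thesis
    unfolding has_derivative_at F_def[abs_def, symmetric] J_def[symmetric]
    by (auto intro: bounded_linear_inner_right)
qed

section \<open>Integration by parts on the torus\<close>

text \<open>
  The integral of a periodic function does not see translations, so all its difference quotients
  integrate to zero, and so does their limit.
\<close>

lemma integral_periodic_derivative:
  fixes F :: "real ^ 'n \<Rightarrow> real"
  assumes F: "\<And>x. (F has_derivative (\<lambda>h. D x \<bullet> h)) (at x)"
    and [measurable]: "D \<in> borel_measurable borel"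
    and D: "\<And>x. norm (D x) \<le> L" and K: "\<And>x. \<bar>F x\<bar> \<le> K" and per: "torus_periodic F"
  shows "(\<integral>x. D x \<bullet> v \<partial>unit_cube) = 0"
proof -
  have Fm [measurable]: "F \<in> borel_measurable borel"
    by (rule borel_measurable_continuous_onI[OF has_derivative_everywhere_continuous[OF F]])
  define h where "h n = inverse (real (Suc n))" for n
  have h: "h n > 0" for n by (simp add: h_def)
  have h0: "filterlim h (at 0) sequentially"
    unfolding h_def using LIMSEQ_inverse_real_of_nat by (auto simp: filterlim_at)
  define q where "q n x = (F (x + h n *\<^sub>R v) - F x) / h n" for n x
  have iF: "integrable unit_cube (\<lambda>x. F (x + a))" for a
    by (rule unit_cube.integrable_const_bound[where B = K]) (auto simp: K)
  have "(\<integral>x. q n x \<partial>unit_cube) = 0" for n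
    unfolding q_def using iF[of "h n *\<^sub>R v"] iF[of 0] integral_torus_shift[OF Fm per, of "h n *\<^sub>R v"]
    by simp
  moreover have "(\<lambda>n. \<integral>x. q n x \<partial>unit_cube) \<longlonglongrightarrow> (\<integral>x. D x \<bullet> v \<partial>unit_cube)"
  proof (rule integral_dominated_convergence[where w = "\<lambda>_. L * norm v"])
    show "AE x in unit_cube. (\<lambda>n. q n x) \<longlonglongrightarrow> D x \<bullet> v"
    proof (rule AE_I2)
      fix x
      have "((\<lambda>t. F (x + t *\<^sub>R v)) has_derivative (\<lambda>t. D (x + 0 *\<^sub>R v) \<bullet> (t *\<^sub>R v))) (at 0)"
        by (rule has_derivative_compose[of "\<lambda>t. x + t *\<^sub>R v" "\<lambda>t. t *\<^sub>R v", OF _ F]) (auto intro!: derivative_eq_intros)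
      then have "((\<lambda>t. F (x + t *\<^sub>R v)) has_field_derivative (D x \<bullet> v)) (at 0)"
        by (simp add: has_field_derivative_def mult_commute_abs)
      then have "((\<lambda>t. (F (x + t *\<^sub>R v) - F x) / t) \<longlongrightarrow> D x \<bullet> v) (at 0)"
        by (simp add: has_field_derivative_iff)
      from filterlim_compose[OF this h0] show "(\<lambda>n. q n x) \<longlonglongrightarrow> D x \<bullet> v" unfolding q_def .
    qed
    show "AE x in unit_cube. norm (q n x) \<le> L * norm v" for n
    proof (rule AE_I2)
      fix x
      have "\<bar>F (x + h n *\<^sub>R v) - F x\<bar> \<le> h n * (L * norm v)"
        using gradient_bound_Lipschitz[OF F D, of "x + h n *\<^sub>R v" x] h[of n] by (simp add: mult_ac)
      then show "norm (q n x) \<le> L * norm v"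
        using h[of n] by (simp add: q_def pos_divide_le_eq mult.commute)
    qed
  qed (auto simp: q_def[abs_def])
  ultimately show ?thesis by (simp add: LIMSEQ_const_iff)
qed

lemma borel_measurable_component [measurable (raw)]:
  fixes f :: "'a \<Rightarrow> real ^ 'n"
  assumes "f \<in> borel_measurable M" shows "(\<lambda>x. f x $ i) \<in> borel_measurable M"
  using borel_measurable_inner[OF assms borel_measurable_const[of "axis i 1"]] by (simp add: inner_axis)

lemma torus_integration_by_parts:
  fixes \<phi> \<psi> :: "real ^ 'n \<Rightarrow> real"
  assumes "\<phi> \<in> torus_smooth" "\<psi> \<in> torus_smooth"
  shows "(\<integral>x. \<phi> x * grad \<psi> x $ i \<partial>torus_measure) = - (\<integral>x. grad \<phi> x $ i * \<psi> x \<partial>torus_measure)"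
proof -
  note \<phi> = torus_smoothD[OF assms(1)] and \<psi> = torus_smoothD[OF assms(2)]
  note [measurable] = \<phi>(6,7) \<psi>(6,7)
  obtain A where A: "A > 0" "\<And>x. \<bar>\<phi> x\<bar> \<le> A" "\<And>x. norm (grad \<phi> x) \<le> A"
    using torus_smooth_bounded[OF assms(1)] by blast
  obtain B where B: "B > 0" "\<And>x. \<bar>\<psi> x\<bar> \<le> B" "\<And>x. norm (grad \<psi> x) \<le> B"
    using torus_smooth_bounded[OF assms(2)] by blast
  define D where "D x = \<phi> x *\<^sub>R grad \<psi> x + \<psi> x *\<^sub>R grad \<phi> x" for x
  have cm: "\<bar>z $ i\<bar> \<le> norm z" for z :: "real ^ 'n" by (rule component_le_norm_cart)
  have "(\<integral>x. D x \<bullet> axis i 1 \<partial>unit_cube) = 0"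
  proof (rule integral_periodic_derivative[of "\<lambda>x. \<phi> x * \<psi> x" D "A * B + B * A" "A * B"])
    show "((\<lambda>x. \<phi> x * \<psi> x) has_derivative (\<lambda>h. D x \<bullet> h)) (at x)" for x
      by (rule has_derivative_eq_rhs[OF has_derivative_mult[OF \<phi>(1) \<psi>(1)]]) (auto simp: D_def algebra_simps)
    show "norm (D x) \<le> A * B + B * A" for x
      unfolding D_def using A B
      by (intro norm_triangle_le add_mono) (auto intro!: mult_mono simp: less_imp_le)
    show "\<bar>\<phi> x * \<psi> x\<bar> \<le> A * B" for x using A B by (auto intro!: mult_mono simp: abs_mult less_imp_le)
    show "torus_periodic (\<lambda>x. \<phi> x * \<psi> x)" by (rule torus_periodic_comp2[OF \<phi>(4) \<psi>(4)])
  qed (simp add: D_def[abs_def])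
  moreover have "integrable unit_cube (\<lambda>x. \<phi> x * grad \<psi> x $ i)"
    by (rule unit_cube.integrable_const_bound[where B = "A * B"])
      (use A B order_trans[OF cm B(3)] in \<open>auto intro!: AE_I2 mult_mono simp: abs_mult less_imp_le\<close>)
  moreover have "integrable unit_cube (\<lambda>x. grad \<phi> x $ i * \<psi> x)"
    by (rule unit_cube.integrable_const_bound[where B = "A * B"])
      (use A B order_trans[OF cm A(3)] in \<open>auto intro!: AE_I2 mult_mono simp: abs_mult less_imp_le\<close>)
  ultimately have "(\<integral>x. \<phi> x * grad \<psi> x $ i \<partial>unit_cube) = - (\<integral>x. grad \<phi> x $ i * \<psi> x \<partial>unit_cube)"
    by (simp add: D_def inner_axis inner_add_left mult.commute[of "\<psi> _"])
  then show ?thesis by (subst (1 2) integral_torus_measure) auto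
qed

section \<open>Mollified functions are smooth\<close>

lemma integral_lborel_reflect:
  fixes f :: "'a::euclidean_space \<Rightarrow> 'b::euclidean_space"
  assumes [measurable]: "f \<in> borel_measurable borel"
  shows "(\<integral>x. f (a - x) \<partial>lborel) = (\<integral>x. f x \<partial>lborel)"
proof -
  have "(\<integral>x. f x \<partial>lborel) = (\<integral>x. f x \<partial>distr lborel borel (\<lambda>x. a - x))"
    by (simp only: lborel_distr_reflect)
  also have "\<dots> = (\<integral>x. f (a - x) \<partial>lborel)" by (subst integral_distr) auto
  finally show ?thesis by simp
qed

text \<open>
  The constant \<open>c\<close> has to be arbitrary in the induction: each derivative brings out a factor \<open>a\<close>.
\<close>

lemma Ck_function_rescale:
  fixes u :: "'a::real_normed_vector \<Rightarrow> real"
  assumes "Ck_function k u" shows "Ck_function k (\<lambda>x. c * u (a *\<^sub>R x))"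
  using assms
proof (induction k arbitrary: u c)
  case 0
  then have "continuous_on UNIV u" by simp
  then have "continuous_on UNIV (\<lambda>x. u (a *\<^sub>R x))"
    by (rule continuous_on_compose2) (auto intro!: continuous_intros)
  then show ?case by (auto intro!: continuous_intros)
next
  case (Suc k)
  have d: "((\<lambda>x. c * u (a *\<^sub>R x)) has_derivative (\<lambda>v. c * frechet_derivative u (at (a *\<^sub>R x)) (a *\<^sub>R v))) (at x)" for x
  proof -
    have "(u has_derivative frechet_derivative u (at (a *\<^sub>R x))) (at (a *\<^sub>R x))"
      using Suc.prems by (simp add: frechet_derivative_works)
    then have "((\<lambda>x. u (a *\<^sub>R x)) has_derivative (\<lambda>v. frechet_derivative u (at (a *\<^sub>R x)) (a *\<^sub>R v))) (at x)"
      by (rule has_derivative_compose[of "\<lambda>x. a *\<^sub>R x" "\<lambda>v. a *\<^sub>R v", rotated]) (auto intro!: derivative_eq_intros)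
    then show ?thesis by (rule has_derivative_mult_right)
  qed
  have fd: "frechet_derivative (\<lambda>x. c * u (a *\<^sub>R x)) (at x) v = (c * a) * frechet_derivative u (at (a *\<^sub>R x)) v" for x v
  proof -
    have "u differentiable at (a *\<^sub>R x)" using Suc.prems by simp
    then have "linear (frechet_derivative u (at (a *\<^sub>R x)))" by (rule linear_frechet_derivative)
    then show ?thesis by (simp add: frechet_derivative_at[OF d, symmetric] linear_scale)
  qed
  have "Ck_function k (\<lambda>x. (c * a) * frechet_derivative u (at (a *\<^sub>R x)) v)" for v
    by (rule Suc.IH) (use Suc.prems in simp)
  moreover have "(\<lambda>x. c * u (a *\<^sub>R x)) differentiable at x" for x
    using d unfolding differentiable_def by blast
  ultimately show ?case by (simp add: fd)
qed

lemma smooth_rescaled: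
  fixes u :: "real ^ 'n \<Rightarrow> real"
  assumes "smooth_function u" shows "smooth_function (rescaled u \<delta>)"
proof -
  have "rescaled u \<delta> = (\<lambda>y. (1 / \<delta> ^ CARD('n)) * u (inverse \<delta> *\<^sub>R y))"
    by (auto simp: rescaled_def)
  then show ?thesis using assms Ck_function_rescale unfolding smooth_function_def by metis
qed

lemma continuous_bounded_support_bounded:
  fixes u :: "'a::euclidean_space \<Rightarrow> 'b::real_normed_vector"
  assumes "continuous_on UNIV u" "\<And>z. u z \<noteq> 0 \<Longrightarrow> norm z \<le> R"
  obtains K where "K > 0" "\<And>x. norm (u x) \<le> K"
proof -
  have "compact (u ` cball 0 R)"
    by (intro compact_continuous_image continuous_on_subset[OF assms(1)]) auto
  then have "bounded (u ` cball 0 R)" by (rule compact_imp_bounded)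
  then obtain K where K: "K > 0" "\<And>z. z \<in> u ` cball 0 R \<Longrightarrow> norm z \<le> K" unfolding bounded_pos by blast
  have "norm (u x) \<le> K" for x
  proof (cases "u x = 0")
    case False
    then have "x \<in> cball 0 R" using assms(2)[of x] by simp
    then show ?thesis using K(2) by blast
  qed (use K in auto)
  with K that show ?thesis by blast
qed

lemma frechet_derivative_support:
  fixes u :: "real ^ 'n \<Rightarrow> real"
  assumes supp: "\<And>z. u z \<noteq> 0 \<Longrightarrow> norm z \<le> R" and z: "norm z > R"
  shows "frechet_derivative u (at z) = (\<lambda>v. 0)"
proof -
  have "(u has_derivative (\<lambda>v. 0)) (at z)"
  proof (rule has_derivative_transform_within_open[where f = "\<lambda>_. 0"])
    show "open {z :: real ^ 'n. norm z > R}" by (intro open_Collect_less continuous_intros)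
    show "\<And>x. x \<in> {z. norm z > R} \<Longrightarrow> 0 = u x" using supp by force
  qed (use z in auto)
  from frechet_derivative_at[OF this] show ?thesis by simp
qed

text \<open>
  Here the weight \<open>\<psi>\<close> is bounded rather than integrable. For points near \<open>x\<close> only its values on a ball
  matter, because \<open>\<kappa>\<close> has bounded support, and cutting \<open>\<psi>\<close> off outside that ball makes it integrable.
\<close>

lemma convolution_bounded_has_derivative:
  fixes \<psi> \<kappa> :: "real ^ 'n \<Rightarrow> real"
  assumes [measurable]: "\<psi> \<in> borel_measurable borel" and B: "\<And>y. \<bar>\<psi> y\<bar> \<le> B"
    and \<kappa>: "smooth_function \<kappa>" and supp: "\<And>z. \<kappa> z \<noteq> 0 \<Longrightarrow> norm z \<le> R"
  shows "((\<lambda>x. \<integral>y. \<psi> y * \<kappa> (x - y) \<partial>lborel) has_derivative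
    (\<lambda>h. \<integral>y. \<psi> y * frechet_derivative \<kappa> (at (x - y)) h \<partial>lborel)) (at x)"
proof -
  note d = smooth_has_derivative[OF \<kappa>]
  have fd: "frechet_derivative \<kappa> (at z) h = grad \<kappa> z \<bullet> h" for z h
    using frechet_derivative_at[OF d] by simp
  have gsupp: "norm z \<le> R" if "grad \<kappa> z \<noteq> 0" for z
  proof (rule ccontr)
    assume "\<not> norm z \<le> R"
    then have "frechet_derivative \<kappa> (at z) = (\<lambda>v. 0)" by (intro frechet_derivative_support[OF supp]) auto
    then show False using that by (simp add: grad_def vec_eq_iff)
  qed
  obtain K where K: "K > 0" "\<And>x. norm (\<kappa> x) \<le> K"
    using continuous_bounded_support_bounded[OF smooth_continuous[OF \<kappa>] supp] by blast
  obtain L where L: "L > 0" "\<And>x. norm (grad \<kappa> x) \<le> L"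
    using continuous_bounded_support_bounded[OF smooth_continuous_grad[OF \<kappa>] gsupp] by blast
  have gm [measurable]: "grad \<kappa> \<in> borel_measurable borel"
    by (intro borel_measurable_continuous_onI smooth_continuous_grad \<kappa>)
  define g where "g y = \<psi> y * indicator (cball x (R + 1)) y" for y
  have [measurable]: "g \<in> borel_measurable borel" unfolding g_def
    by (intro borel_measurable_times borel_measurable_indicator) (auto intro: borel_closed)
  have g: "integrable lborel g"
  proof (rule Bochner_Integration.integrable_bound)
    show "integrable lborel (\<lambda>y. B * indicator (cball x (R + 1)) y)"
      by (intro integrable_mult_right integrable_real_indicator) (use emeasure_bounded_finite[OF bounded_cball, of x "R + 1"] in auto)
    show "AE y in lborel. norm (g y) \<le> norm (B * indicator (cball x (R + 1)) y)"
      using B order_trans[OF B abs_ge_self] by (intro AE_I2) (auto simp: g_def indicator_def)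
  qed simp
  have main: "((\<lambda>z. \<integral>y. g y * \<kappa> (z - y) \<partial>lborel) has_derivative
      (\<lambda>h. (\<integral>y. g y *\<^sub>R grad \<kappa> (x - y) \<partial>lborel) \<bullet> h)) (at x)"
    by (rule convolution_has_derivative[OF g d gm L(2)]) (use K in auto)
  have cut: "g y * \<kappa> (z - y) = \<psi> y * \<kappa> (z - y)" if "z \<in> ball x 1" for z y
  proof (cases "\<kappa> (z - y) = 0")
    case False
    then have "norm (z - y) \<le> R" by (rule supp)
    moreover have "dist x y \<le> dist x z + dist z y" by (rule dist_triangle)
    ultimately have "y \<in> cball x (R + 1)" using that by (simp add: dist_norm)
    then show ?thesis by (simp add: g_def)
  qed simp
  have "((\<lambda>x. \<integral>y. \<psi> y * \<kappa> (x - y) \<partial>lborel) has_derivative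
      (\<lambda>h. (\<integral>y. g y *\<^sub>R grad \<kappa> (x - y) \<partial>lborel) \<bullet> h)) (at x)"
    by (rule has_derivative_transform_within_open[OF main, of "ball x 1"]) (auto simp: cut)
  moreover have "(\<integral>y. g y *\<^sub>R grad \<kappa> (x - y) \<partial>lborel) \<bullet> h = (\<integral>y. \<psi> y * frechet_derivative \<kappa> (at (x - y)) h \<partial>lborel)" for h
  proof -
    have "integrable lborel (\<lambda>y. g y *\<^sub>R grad \<kappa> (x - y))"
    proof (rule Bochner_Integration.integrable_bound[of _ "\<lambda>y. L * g y"])
      show "AE y in lborel. norm (g y *\<^sub>R grad \<kappa> (x - y)) \<le> norm (L * g y)"
        using L by (intro AE_I2) (auto simp: abs_mult mult.commute[of L] intro!: mult_left_mono)
    qed (use g in auto)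
    then have "(\<integral>y. g y *\<^sub>R grad \<kappa> (x - y) \<partial>lborel) \<bullet> h = (\<integral>y. (g y *\<^sub>R grad \<kappa> (x - y)) \<bullet> h \<partial>lborel)"
      by (subst integral_inner_left) auto
    also have "\<dots> = (\<integral>y. \<psi> y * frechet_derivative \<kappa> (at (x - y)) h \<partial>lborel)"
    proof (rule Bochner_Integration.integral_cong)
      fix y
      show "(g y *\<^sub>R grad \<kappa> (x - y)) \<bullet> h = \<psi> y * frechet_derivative \<kappa> (at (x - y)) h"
        using gsupp[of "x - y"] by (cases "grad \<kappa> (x - y) = 0") (auto simp: g_def fd dist_norm)
    qed simp
    finally show ?thesis .
  qed
  ultimately show ?thesis by simp
qed

text \<open>
  The derivative of the convolution with \<open>\<kappa>\<close> is the convolution with a derivative of \<open>\<kappa>\<close>, which is again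
  smooth with the same support bound; hence the induction over all such \<open>\<kappa>\<close>.
\<close>

lemma smooth_convolution:
  fixes \<psi> \<kappa> :: "real ^ 'n \<Rightarrow> real"
  assumes \<psi>: "\<psi> \<in> borel_measurable borel" "\<And>y. \<bar>\<psi> y\<bar> \<le> B"
    and \<kappa>: "smooth_function \<kappa>" and supp: "\<And>z. \<kappa> z \<noteq> 0 \<Longrightarrow> norm z \<le> R"
  shows "smooth_function (\<lambda>x. \<integral>y. \<psi> y * \<kappa> (x - y) \<partial>lborel)"
  unfolding smooth_function_def
proof
  fix k
  show "Ck_function k (\<lambda>x. \<integral>y. \<psi> y * \<kappa> (x - y) \<partial>lborel)"
    using \<kappa> supp
  proof (induction k arbitrary: \<kappa>)
    case 0
    then show ?case
      using has_derivative_everywhere_continuous[OF convolution_bounded_has_derivative[OF \<psi> 0]] by simp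
  next
    case (Suc k)
    note d = convolution_bounded_has_derivative[OF \<psi> Suc.prems]
    have "Ck_function k (\<lambda>x. \<integral>y. \<psi> y * frechet_derivative \<kappa> (at (x - y)) v \<partial>lborel)" for v
    proof (rule Suc.IH)
      show "smooth_function (\<lambda>z. frechet_derivative \<kappa> (at z) v)"
        by (rule smooth_directional_derivative) fact
      show "norm z \<le> R" if "frechet_derivative \<kappa> (at z) v \<noteq> 0" for z
        using frechet_derivative_support[of \<kappa> R z] Suc.prems(2) that by fastforce
    qed
    then show ?case using d by (auto simp: differentiable_def frechet_derivative_at[OF d, symmetric])
  qed
qed

lemma torus_conv_smooth:
  fixes \<psi> \<kappa> :: "real ^ 'n \<Rightarrow> real"
  assumes \<psi>: "\<psi> \<in> borel_measurable borel" "\<And>y. \<bar>\<psi> y\<bar> \<le> B" "torus_periodic \<psi>"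
    and \<kappa>: "smooth_function \<kappa>" and supp: "\<And>z. \<kappa> z \<noteq> 0 \<Longrightarrow> norm z \<le> R"
  shows "torus_conv \<psi> \<kappa> \<in> torus_smooth"
proof -
  note [measurable] = \<psi>(1)
  have [measurable]: "\<kappa> \<in> borel_measurable borel"
    by (intro borel_measurable_continuous_onI smooth_continuous \<kappa>)
  have "torus_conv \<psi> \<kappa> x = (\<integral>y. \<psi> y * \<kappa> (x - y) \<partial>lborel)" for x
  proof -
    have "torus_conv \<psi> \<kappa> x = (\<integral>y. \<psi> (x - y) * \<kappa> y \<partial>lborel)"
      unfolding torus_conv_def by (rule integral_completion) measurable
    also have "\<dots> = (\<integral>y. \<psi> y * \<kappa> (x - y) \<partial>lborel)"
      using integral_lborel_reflect[of "\<lambda>y. \<psi> (x - y) * \<kappa> y" x] by simp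
    finally show ?thesis .
  qed
  then have "torus_conv \<psi> \<kappa> = (\<lambda>x. \<integral>y. \<psi> y * \<kappa> (x - y) \<partial>lborel)" by (rule ext)
  then have "smooth_function (torus_conv \<psi> \<kappa>)" using smooth_convolution[OF \<psi>(1,2) \<kappa> supp] by simp
  moreover have "torus_periodic (torus_conv \<psi> \<kappa>)"
  proof -
    have "\<psi> (x + z - y) = \<psi> (x - y)" if "\<forall>i. z $ i \<in> \<int>" for x y z
    proof -
      have "x + z - y = (x - y) + z" by simp
      then show ?thesis using \<psi>(3) that unfolding torus_periodic_def by metis
    qed
    then show ?thesis unfolding torus_periodic_def torus_conv_def by simp
  qed
  ultimately show ?thesis by (simp add: torus_smooth_def)
qed

section \<open>Square integrable and bounded functions\<close>

lemma torus_L2_sq: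
  fixes f :: "real ^ 'n \<Rightarrow> 'b::euclidean_space"
  assumes "f \<in> torus_Lp 2"
  shows "integrable torus_measure (\<lambda>x. (norm (f x))\<^sup>2)"
    "(torus_Lp_norm 2 f)\<^sup>2 = (\<integral>x. (norm (f x))\<^sup>2 \<partial>torus_measure)"
proof -
  have eq: "norm (f x) powr 2 = (norm (f x))\<^sup>2" for x by (simp add: powr_2_eq)
  show "integrable torus_measure (\<lambda>x. (norm (f x))\<^sup>2)" using assms by (simp add: torus_Lp_def eq)
  show "(torus_Lp_norm 2 f)\<^sup>2 = (\<integral>x. (norm (f x))\<^sup>2 \<partial>torus_measure)"
    using torus_Lp_norm_powr[of 2 f] by (simp add: eq powr_2_eq)
qed

lemma torus_L2_inner:
  fixes f g :: "real ^ 'n \<Rightarrow> 'b::euclidean_space"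
  assumes f: "f \<in> torus_Lp 2" and g: "g \<in> torus_Lp 2"
  shows "integrable torus_measure (\<lambda>x. f x \<bullet> g x)"
    "\<bar>\<integral>x. f x \<bullet> g x \<partial>torus_measure\<bar> \<le> torus_Lp_norm 2 f * torus_Lp_norm 2 g"
proof -
  have m: "f \<in> borel_measurable lebesgue" "g \<in> borel_measurable lebesgue" using f g by (auto simp: torus_Lp_def)
  note m' [measurable] = m[THEN borel_measurable_torus_measure]
  note F = torus_L2_sq[OF f] and G = torus_L2_sq[OF g]
  have "integrable torus_measure (\<lambda>x. (norm (f x))\<^sup>2 + (norm (g x))\<^sup>2)" using F G by simp
  then show I: "integrable torus_measure (\<lambda>x. f x \<bullet> g x)"
  proof (rule Bochner_Integration.integrable_bound)
    show "AE x in torus_measure. norm (f x \<bullet> g x) \<le> norm ((norm (f x))\<^sup>2 + (norm (g x))\<^sup>2)"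
    proof (rule AE_I2)
      fix x
      have "\<bar>f x \<bullet> g x\<bar> \<le> norm (f x) * norm (g x)" by (rule Cauchy_Schwarz_ineq2)
      also have "\<dots> \<le> (norm (f x))\<^sup>2 + (norm (g x))\<^sup>2"
      proof -
        have "0 \<le> (norm (f x) - norm (g x))\<^sup>2" "0 \<le> norm (f x) * norm (g x)" by auto
        then show ?thesis unfolding power2_diff by linarith
      qed
      finally show "norm (f x \<bullet> g x) \<le> norm ((norm (f x))\<^sup>2 + (norm (g x))\<^sup>2)" by simp
    qed
  qed (use m' in simp)
  define a b c where "a = torus_Lp_norm 2 f" and "b = torus_Lp_norm 2 g" and "c = (\<integral>x. f x \<bullet> g x \<partial>torus_measure)"
  \<comment> \<open>The squared norm of \<open>f + t g\<close>; its discriminant gives the Cauchy-Schwarz inequality.\<close>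
  have quad: "0 \<le> a\<^sup>2 + 2 * t * c + t\<^sup>2 * b\<^sup>2" for t
  proof -
    have "0 \<le> (\<integral>x. (norm (f x + t *\<^sub>R g x))\<^sup>2 \<partial>torus_measure)" by (intro integral_nonneg_AE) auto
    also have "\<dots> = (\<integral>x. (norm (f x))\<^sup>2 + 2 * t * (f x \<bullet> g x) + t\<^sup>2 * (norm (g x))\<^sup>2 \<partial>torus_measure)"
    proof -
      have "(norm (f x + t *\<^sub>R g x))\<^sup>2 = (norm (f x))\<^sup>2 + 2 * t * (f x \<bullet> g x) + t\<^sup>2 * (norm (g x))\<^sup>2" for x
        unfolding power2_norm_eq_inner
        by (simp add: inner_add_left inner_add_right inner_commute[of "g x" "f x"] power2_eq_square algebra_simps)
      then show ?thesis by simp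
    qed
    also have "\<dots> = a\<^sup>2 + 2 * t * c + t\<^sup>2 * b\<^sup>2" using F G I by (simp add: a_def b_def c_def)
    finally show ?thesis .
  qed
  have ab: "a \<ge> 0" "b \<ge> 0" by (simp_all add: a_def b_def)
  have "c\<^sup>2 \<le> (a * b)\<^sup>2"
  proof (cases "b = 0")
    case True
    have "c = 0"
    proof (rule ccontr)
      assume "c \<noteq> 0"
      then show False using quad[of "- (a\<^sup>2 + 1) / (2 * c)"] True by (simp add: field_simps)
    qed
    then show ?thesis by simp
  next
    case False
    then have "0 \<le> a\<^sup>2 - c\<^sup>2 / b\<^sup>2"
      using quad[of "- c / b\<^sup>2"] by (simp add: field_simps power2_eq_square)
    then show ?thesis using False by (simp add: field_simps power_mult_distrib)
  qed
  then have "\<bar>c\<bar> \<le> a * b" using ab by (metis abs_le_square_iff abs_of_nonneg mult_nonneg_nonneg)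
  then show "\<bar>\<integral>x. f x \<bullet> g x \<partial>torus_measure\<bar> \<le> torus_Lp_norm 2 f * torus_Lp_norm 2 g"
    by (simp add: a_def b_def c_def)
qed

lemma torus_Lp_bounded:
  fixes g :: "real ^ 'n \<Rightarrow> 'b::euclidean_space"
  assumes [measurable]: "g \<in> borel_measurable borel" and per: "torus_periodic g"
    and C: "\<And>x. norm (g x) \<le> C" and p: "p > 0"
  shows "g \<in> torus_Lp p"
proof (rule torus_LpI(1)[OF per])
  show "0 \<le> C" using C[of 0] norm_ge_zero order_trans by blast
  have "power_integral p g \<le> (\<integral>\<^sup>+x. ennreal (C powr p) \<partial>(unit_cube :: (real ^ 'n) measure))"
    using C p by (intro nn_integral_mono ennreal_leI powr_mono2) auto
  also have "\<dots> = ennreal (C powr p)" by (simp add: emeasure_unit_cube)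
  finally show "power_integral p g \<le> ennreal (C powr p)" .
qed (use p in auto)

lemma torus_smooth_Lp:
  fixes \<phi> :: "real ^ 'n \<Rightarrow> real"
  assumes \<phi>: "\<phi> \<in> torus_smooth" and p: "p > 0"
  shows "\<phi> \<in> torus_Lp p" "grad \<phi> \<in> torus_Lp p"
proof -
  obtain C where "\<And>x. \<bar>\<phi> x\<bar> \<le> C" "\<And>x. norm (grad \<phi> x) \<le> C" using torus_smooth_bounded[OF \<phi>] by blast
  then show "\<phi> \<in> torus_Lp p" "grad \<phi> \<in> torus_Lp p"
    using torus_smoothD[OF \<phi>] p by (auto intro!: torus_Lp_bounded[where C = C])
qed

lemma torus_Lp_component:
  fixes f :: "real ^ 'n \<Rightarrow> real ^ 'm"
  assumes "f \<in> torus_Lp p" "p > 0"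
  shows "(\<lambda>x. f x $ i) \<in> torus_Lp p"
proof -
  have f: "torus_periodic f" "f \<in> borel_measurable lebesgue" "integrable torus_measure (\<lambda>x. norm (f x) powr p)"
    using assms(1) by (auto simp: torus_Lp_def)
  have m: "(\<lambda>x. f x $ i) \<in> borel_measurable lebesgue" using f(2) by (rule borel_measurable_component)
  note m' [measurable] = borel_measurable_torus_measure[OF m]
  have "integrable torus_measure (\<lambda>x. norm (f x $ i) powr p)"
    by (rule Bochner_Integration.integrable_bound[OF f(3)])
      (use assms(2) in \<open>auto intro!: AE_I2 powr_mono2 component_le_norm_cart\<close>)
  then show ?thesis using f(1) m by (simp add: torus_Lp_def torus_periodic_def)
qed

lemma torus_L2_component_inner:
  fixes f :: "real ^ 'n \<Rightarrow> real ^ 'm" and u :: "real ^ 'n \<Rightarrow> real"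
  assumes "f \<in> torus_Lp 2" "u \<in> torus_Lp 2"
  shows "integrable torus_measure (\<lambda>x. f x $ i * u x)"
  using torus_L2_inner(1)[OF torus_Lp_component[OF assms(1)] assms(2)] by simp

section \<open>Rescaled kernels\<close>

lemma convolution_kernelD:
  assumes "convolution_kernel \<rho>"
  shows "smooth_function \<rho>" "prob_kernel \<rho>" "\<exists>R>0. \<forall>y. \<rho> y \<noteq> 0 \<longrightarrow> norm y \<le> R"
proof -
  show s: "smooth_function \<rho>" using assms by (simp add: convolution_kernel_def)
  have m: "\<rho> \<in> borel_measurable borel" by (rule borel_measurable_continuous_onI[OF smooth_continuous[OF s]])
  have "(\<integral>y. \<rho> y \<partial>lebesgue) = 1" using assms by (simp add: convolution_kernel_def)
  then have one: "(\<integral>y. \<rho> y \<partial>lborel) = 1" using integral_completion[of \<rho> lborel] m by simp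
  then have "integrable lborel \<rho>" using not_integrable_integral_eq by fastforce
  then have "(\<integral>\<^sup>+y. ennreal (\<rho> y) \<partial>lborel) = 1"
    using assms one by (subst nn_integral_eq_integral) (auto simp: convolution_kernel_def)
  then show "prob_kernel \<rho>" using assms m by (simp add: prob_kernel_def convolution_kernel_def)
  have "bounded (closure {y. \<rho> y \<noteq> 0})" using assms compact_imp_bounded by (auto simp: convolution_kernel_def)
  then obtain R where R: "R > 0" "\<And>y. y \<in> closure {y. \<rho> y \<noteq> 0} \<Longrightarrow> norm y \<le> R" unfolding bounded_pos by blast
  then show "\<exists>R>0. \<forall>y. \<rho> y \<noteq> 0 \<longrightarrow> norm y \<le> R"
    using closure_subset[of "{y. \<rho> y \<noteq> 0}"] by blast
qed

lemma prob_kernel_rescaled: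
  fixes \<rho> :: "real ^ 'n \<Rightarrow> real"
  assumes \<rho>: "prob_kernel \<rho>" and \<delta>: "\<delta> > 0"
  shows "prob_kernel (rescaled \<rho> \<delta>)"
proof -
  have [measurable]: "\<rho> \<in> borel_measurable borel" and r0: "\<And>y. 0 \<le> \<rho> y"
    and r1: "(\<integral>\<^sup>+y. ennreal (\<rho> y) \<partial>lborel) = 1" using \<rho> by (auto simp: prob_kernel_def)
  have m [measurable]: "rescaled \<rho> \<delta> \<in> borel_measurable borel" unfolding rescaled_def by measurable
  have "(\<integral>\<^sup>+y. ennreal (rescaled \<rho> \<delta> y) \<partial>lborel) =
      (\<integral>\<^sup>+y. ennreal (rescaled \<rho> \<delta> y) \<partial>density (distr lborel borel (\<lambda>x :: real ^ 'n. 0 + \<delta> *\<^sub>R x)) (\<lambda>_. ennreal (\<bar>\<delta>\<bar> ^ DIM(real ^ 'n))))"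
    by (rule arg_cong[where f = "\<lambda>M. \<integral>\<^sup>+y. ennreal (rescaled \<rho> \<delta> y) \<partial>M"], rule lborel_affine)
      (use \<delta> in simp)
  also have "\<dots> = (\<integral>\<^sup>+x. ennreal (\<delta> ^ CARD('n)) * ennreal (rescaled \<rho> \<delta> (\<delta> *\<^sub>R x)) \<partial>lborel)"
    using \<delta> by (simp add: nn_integral_density nn_integral_distr)
  also have "\<dots> = (\<integral>\<^sup>+x. ennreal (\<rho> x) \<partial>lborel)"
    using \<delta> r0 by (intro nn_integral_cong) (simp add: rescaled_def ennreal_mult[symmetric])
  finally show ?thesis using r0 r1 \<delta> m by (auto simp: prob_kernel_def rescaled_def)
qed

lemma rescaled_support:
  fixes \<rho> :: "real ^ 'n \<Rightarrow> real"
  assumes "\<And>y. \<rho> y \<noteq> 0 \<Longrightarrow> norm y \<le> R" "\<delta> > 0" "rescaled \<rho> \<delta> y \<noteq> 0"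
  shows "norm y \<le> \<delta> * R"
proof -
  have "\<rho> (y /\<^sub>R \<delta>) \<noteq> 0" using assms(3) by (auto simp: rescaled_def)
  then have "norm (y /\<^sub>R \<delta>) \<le> R" by (rule assms(1))
  then show ?thesis using assms(2) by (simp add: field_simps)
qed

section \<open>Uniqueness of weak gradients\<close>

text \<open>
  The bounded field \<open>\<psi> = h / (1 + \<bar>h\<bar>)\<close> detects \<open>h\<close>, since \<open>h \<bullet> \<psi>\<close> is positive wherever \<open>h\<close> does not vanish.
  Mollifications of \<open>\<psi>\<close> are smooth test functions, orthogonal to \<open>h\<close>, and they converge to \<open>\<psi>\<close> in \<open>L\<^sup>2\<close>:
  their error is the commutator field of \<open>\<psi>\<close> with the constant function one. Both are
  bounded, hence admissible for the exponents \<open>p = q = 4\<close> with \<open>1 / p + 1 / q = 1 / 2\<close>.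
\<close>

lemma torus_fundamental_lemma:
  fixes h :: "real ^ 'n \<Rightarrow> real ^ 'n"
  assumes \<rho>: "convolution_kernel (\<rho> :: real ^ 'n \<Rightarrow> real)" and h: "h \<in> torus_Lp 2"
    and orth: "\<And>\<phi> i. \<phi> \<in> torus_smooth \<Longrightarrow> (\<integral>x. h x $ i * \<phi> x \<partial>torus_measure) = 0"
  shows "AE x in torus_measure. h x = 0"
proof -
  obtain R where R: "R > 0" "\<And>y. \<rho> y \<noteq> 0 \<Longrightarrow> norm y \<le> R" using convolution_kernelD(3)[OF \<rho>] by blast
  obtain h' where h' [measurable]: "h' \<in> borel_measurable borel" and h'': "torus_periodic h'" "AE x in lborel. h x = h' x"
    "power_integral 2 h' = ennreal (torus_Lp_norm 2 h powr 2)"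
    by (rule torus_Lp_borel_representative[OF h]) simp
  define \<psi> where "\<psi> x = (1 / (1 + norm (h' x))) *\<^sub>R h' x" for x
  have \<psi>m [measurable]: "\<psi> \<in> borel_measurable borel" unfolding \<psi>_def by measurable
  have \<psi>1: "norm (\<psi> x) \<le> 1" for x
  proof -
    have "0 < 1 + norm (h' x)" by (smt (verit) norm_ge_zero)
    then show ?thesis by (simp add: \<psi>_def divide_le_eq)
  qed
  have \<psi>per: "torus_periodic \<psi>" unfolding \<psi>_def by (rule torus_periodic_comp[OF h''(1)])
  have \<psi>L: "\<psi> \<in> torus_Lp r" if "r > 0" for r by (rule torus_Lp_bounded[OF \<psi>m \<psi>per \<psi>1 that])
  define one :: "real ^ 'n \<Rightarrow> real" where "one = (\<lambda>_. 1)"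
  have one: "one \<in> torus_Lp 4" by (rule torus_Lp_bounded[where C = 1]) (auto simp: one_def torus_periodic_def)
  define c where "c = torus_Lp_norm 4 one"
  have c: "c \<ge> 0" by (simp add: c_def)
  have small: "\<bar>\<integral>x. h x \<bullet> \<psi> x \<partial>torus_measure\<bar> \<le> torus_Lp_norm 2 h * (c * \<epsilon>)" if \<epsilon>: "\<epsilon> > 0" for \<epsilon>
  proof -
    obtain \<eta> where \<eta>: "\<eta> > 0" "\<And>k w. prob_kernel k \<Longrightarrow> (\<And>y. k y \<noteq> 0 \<Longrightarrow> norm y < \<eta>) \<Longrightarrow> w \<in> torus_Lp 4 \<Longrightarrow>
        torus_Lp_norm 2 (commutator_field k \<psi> w) \<le> torus_Lp_norm 4 w * \<epsilon>"
      using commutator_field_small[of 4 4 \<psi> \<epsilon>] \<psi>L[of 4] \<epsilon> by auto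
    define \<delta> where "\<delta> = \<eta> / (2 * R)"
    have \<delta>: "\<delta> > 0" "\<delta> * R < \<eta>" using \<eta>(1) R(1) by (simp_all add: \<delta>_def)
    define k where "k = rescaled \<rho> \<delta>"
    have k: "prob_kernel k" unfolding k_def by (intro prob_kernel_rescaled convolution_kernelD \<rho> \<delta>)
    have ks: "smooth_function k" unfolding k_def by (intro smooth_rescaled convolution_kernelD(1)[OF \<rho>])
    have ksupp: "norm y \<le> \<delta> * R" if "k y \<noteq> 0" for y using rescaled_support[of \<rho> R \<delta> y] R(2) \<delta>(1) that by (simp add: k_def)
    have km [measurable]: "k \<in> borel_measurable borel" and k0: "\<And>y. 0 \<le> k y"
      and k1: "(\<integral>\<^sup>+y. ennreal (k y) \<partial>lborel) = 1" using k by (auto simp: prob_kernel_def)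
    have ik: "integrable lborel k" "integral\<^sup>L lborel k = 1"
      using k0 k1 by (auto intro!: integrableI_nonneg simp: integral_eq_nn_integral)
    define E where "E = commutator_field k \<psi> one"
    have E: "E \<in> torus_Lp 2" unfolding E_def
      by (rule commutator_field_L2(1)[of 4 4]) (use k one \<psi>L[of 4] in auto)
    have E\<epsilon>: "torus_Lp_norm 2 E \<le> c * \<epsilon>"
      unfolding E_def c_def using ksupp \<delta>(2) by (intro \<eta>(2) k one) force
    define m where "m x = (\<chi> i. torus_conv (\<lambda>x. \<psi> x $ i) k x)" for x
    have Em: "E x = m x - \<psi> x" for x
    proof -
      have i1: "integrable lborel (\<lambda>y. k y *\<^sub>R \<psi> (x - y))"
      proof (rule Bochner_Integration.integrable_bound[OF ik(1)])
        show "AE y in lborel. norm (k y *\<^sub>R \<psi> (x - y)) \<le> norm (k y)"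
          using k0 \<psi>1 by (intro AE_I2) (auto intro: mult_left_le)
      qed measurable
      have i2: "integrable lborel (\<lambda>y. k y *\<^sub>R \<psi> x)" using ik(1) by simp
      have "E x = (\<integral>y. k y *\<^sub>R (one (x - y) *\<^sub>R (\<psi> (x - y) - \<psi> x)) \<partial>lborel)"
        unfolding E_def commutator_field_def one_def by (rule integral_completion) measurable
      also have "\<dots> = (\<integral>y. k y *\<^sub>R \<psi> (x - y) - k y *\<^sub>R \<psi> x \<partial>lborel)"
        by (simp add: one_def scaleR_diff_right)
      also have "\<dots> = (\<integral>y. k y *\<^sub>R \<psi> (x - y) \<partial>lborel) - \<psi> x"
        using i1 i2 ik by simp
      also have "(\<integral>y. k y *\<^sub>R \<psi> (x - y) \<partial>lborel) = m x"
        unfolding vec_eq_iff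
      proof
        fix i
        have "(\<integral>y. k y *\<^sub>R \<psi> (x - y) \<partial>lborel) $ i = (\<integral>y. (k y *\<^sub>R \<psi> (x - y)) $ i \<partial>lborel)"
          by (rule integral_bounded_linear[OF bounded_linear_vec_nth i1, symmetric])
        also have "\<dots> = (\<integral>y. \<psi> (x - y) $ i * k y \<partial>lborel)" by (simp add: mult.commute)
        also have "\<dots> = m x $ i"
          unfolding m_def torus_conv_def by simp (rule integral_completion[symmetric], measurable)
        finally show "(\<integral>y. k y *\<^sub>R \<psi> (x - y) \<partial>lborel) $ i = m x $ i" .
      qed
      finally show ?thesis .
    qed
    have ms: "(\<lambda>x. m x $ i) \<in> torus_smooth" for i
    proof -
      have "torus_conv (\<lambda>x. \<psi> x $ i) k \<in> torus_smooth"
        by (rule torus_conv_smooth[OF _ _ _ ks ksupp, of _ 1])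
          (use \<psi>1 component_le_norm_cart[of "\<psi> _" i] in \<open>auto intro: order_trans torus_periodic_comp[OF \<psi>per]\<close>)
      then show ?thesis by (simp add: m_def)
    qed
    have "(\<integral>x. h x \<bullet> m x \<partial>torus_measure) = (\<Sum>i\<in>UNIV. \<integral>x. h x $ i * m x $ i \<partial>torus_measure)"
      unfolding inner_vec_def inner_real_def
      by (intro Bochner_Integration.integral_sum torus_L2_component_inner h torus_smooth_Lp ms) simp
    also have "\<dots> = 0" using orth[OF ms] by simp
    finally have hm: "(\<integral>x. h x \<bullet> m x \<partial>torus_measure) = 0" .
    have "(\<integral>x. h x \<bullet> m x \<partial>torus_measure) = (\<integral>x. h x \<bullet> E x + h x \<bullet> \<psi> x \<partial>torus_measure)"
      by (simp add: Em inner_diff_right)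
    also have "\<dots> = (\<integral>x. h x \<bullet> E x \<partial>torus_measure) + (\<integral>x. h x \<bullet> \<psi> x \<partial>torus_measure)"
      using torus_L2_inner(1)[OF h E] torus_L2_inner(1)[OF h \<psi>L[of 2]] by simp
    finally have "\<bar>\<integral>x. h x \<bullet> \<psi> x \<partial>torus_measure\<bar> = \<bar>\<integral>x. h x \<bullet> E x \<partial>torus_measure\<bar>" using hm by linarith
    also have "\<dots> \<le> torus_Lp_norm 2 h * torus_Lp_norm 2 E" by (rule torus_L2_inner(2)[OF h E])
    also have "\<dots> \<le> torus_Lp_norm 2 h * (c * \<epsilon>)" by (intro mult_left_mono E\<epsilon>) simp
    finally show ?thesis .
  qed
  have "\<bar>\<integral>x. h x \<bullet> \<psi> x \<partial>torus_measure\<bar> \<le> 0"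
  proof (rule field_le_epsilon)
    fix e :: real assume e: "e > 0"
    define N where "N = torus_Lp_norm 2 h * c"
    have N: "N \<ge> 0" using c by (simp add: N_def)
    have "\<bar>\<integral>x. h x \<bullet> \<psi> x \<partial>torus_measure\<bar> \<le> N * (e / (N + 1))"
      using small[of "e / (N + 1)"] N e by (simp add: N_def mult.assoc)
    also have "\<dots> \<le> e" using N e by (simp add: field_simps)
    finally show "\<bar>\<integral>x. h x \<bullet> \<psi> x \<partial>torus_measure\<bar> \<le> 0 + e" by simp
  qed
  then have zero: "(\<integral>x. h x \<bullet> \<psi> x \<partial>torus_measure) = 0" by simp
  have hh': "AE x in torus_measure. h x = h' x" by (rule AE_lborel_imp_torus[OF h''(2)])
  have pos: "0 < 1 + norm z" for z :: "real ^ 'n" by (smt (verit) norm_ge_zero)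
  have "AE x in torus_measure. 0 \<le> h x \<bullet> \<psi> x"
    using hh' by eventually_elim (simp add: \<psi>_def)
  then have "AE x in torus_measure. h x \<bullet> \<psi> x = 0"
    using integral_nonneg_eq_0_iff_AE[OF torus_L2_inner(1)[OF h \<psi>L[of 2]]] zero by simp
  then show ?thesis using hh'
  proof eventually_elim
    case (elim x)
    then have "(1 / (1 + norm (h' x))) * (h' x \<bullet> h' x) = 0" by (simp add: \<psi>_def)
    moreover have "1 + norm (h' x) \<noteq> 0" using pos[of "h' x"] by simp
    ultimately have "h' x = 0" by simp
    then show ?case using elim by simp
  qed
qed

lemma weak_grad_unique:
  fixes f :: "real ^ 'n \<Rightarrow> real"
  assumes \<rho>: "convolution_kernel (\<rho> :: real ^ 'n \<Rightarrow> real)" and g: "g1 \<in> torus_Lp 2" "g2 \<in> torus_Lp 2"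
    and wg: "has_weak_grad f g1" "has_weak_grad f g2"
  shows "AE x in torus_measure. g1 x = g2 x"
proof -
  have "AE x in torus_measure. g1 x - g2 x = 0"
  proof (rule torus_fundamental_lemma[OF \<rho> torus_Lp_diff[OF g]])
    fix \<phi> :: "real ^ 'n \<Rightarrow> real" and i assume \<phi>: "\<phi> \<in> torus_smooth"
    have "(\<integral>x. (g1 x - g2 x) $ i * \<phi> x \<partial>torus_measure) =
        (\<integral>x. g1 x $ i * \<phi> x \<partial>torus_measure) - (\<integral>x. g2 x $ i * \<phi> x \<partial>torus_measure)"
      using torus_L2_component_inner[OF g(1) torus_smooth_Lp(1)[OF \<phi>], of i]
        torus_L2_component_inner[OF g(2) torus_smooth_Lp(1)[OF \<phi>], of i]
      by (simp add: left_diff_distrib)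
    also have "\<dots> = 0"
    proof -
      have "(\<integral>x. f x * grad \<phi> x $ i \<partial>torus_measure) = - (\<integral>x. g1 x $ i * \<phi> x \<partial>torus_measure)"
        "(\<integral>x. f x * grad \<phi> x $ i \<partial>torus_measure) = - (\<integral>x. g2 x $ i * \<phi> x \<partial>torus_measure)"
        using wg \<phi> unfolding has_weak_grad_def by blast+
      then show ?thesis by linarith
    qed
    finally show "(\<integral>x. (g1 x - g2 x) $ i * \<phi> x \<partial>torus_measure) = 0" .
  qed simp
  then show ?thesis by eventually_elim simp
qed

lemma torus_H1_weak_grad:
  assumes "f \<in> torus_H1"
  shows "f \<in> torus_Lp 2" "weak_grad f \<in> torus_Lp 2" "has_weak_grad f (weak_grad f)"
proof -
  show "f \<in> torus_Lp 2" using assms by (simp add: torus_H1_def)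
  have "\<exists>g. g \<in> torus_Lp 2 \<and> has_weak_grad f g" using assms by (auto simp: torus_H1_def)
  then have "weak_grad f \<in> torus_Lp 2 \<and> has_weak_grad f (weak_grad f)"
    unfolding weak_grad_def by (rule someI_ex)
  then show "weak_grad f \<in> torus_Lp 2" "has_weak_grad f (weak_grad f)" by auto
qed

lemma has_weak_grad_in_H1:
  assumes \<rho>: "convolution_kernel (\<rho> :: real ^ 'n \<Rightarrow> real)"
    and "f \<in> torus_Lp 2" "g \<in> torus_Lp 2" "has_weak_grad f (g :: real ^ 'n \<Rightarrow> real ^ 'n)"
  shows "f \<in> torus_H1" "AE x in torus_measure. weak_grad f x = g x"
proof -
  show H: "f \<in> torus_H1" using assms by (auto simp: torus_H1_def)
  show "AE x in torus_measure. weak_grad f x = g x"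
    by (rule weak_grad_unique[OF \<rho> torus_H1_weak_grad(2)[OF H] assms(3) torus_H1_weak_grad(3)[OF H] assms(4)])
qed

lemma torus_smooth_weak_grad:
  assumes \<rho>: "convolution_kernel (\<rho> :: real ^ 'n \<Rightarrow> real)" and \<phi>: "(\<phi> :: real ^ 'n \<Rightarrow> real) \<in> torus_smooth"
  shows "\<phi> \<in> torus_H1" "AE x in torus_measure. weak_grad \<phi> x = grad \<phi> x"
proof -
  have "has_weak_grad \<phi> (grad \<phi>)"
    unfolding has_weak_grad_def using torus_integration_by_parts[OF \<phi>] by blast
  then show "\<phi> \<in> torus_H1" "AE x in torus_measure. weak_grad \<phi> x = grad \<phi> x"
    using has_weak_grad_in_H1[OF \<rho> torus_smooth_Lp[OF \<phi>]] by simp_all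
qed

lemma torus_H1_add:
  assumes \<rho>: "convolution_kernel (\<rho> :: real ^ 'n \<Rightarrow> real)" and f: "f \<in> torus_H1" and g: "(g :: real ^ 'n \<Rightarrow> real) \<in> torus_H1"
  shows "(\<lambda>x. f x + g x) \<in> torus_H1"
    "AE x in torus_measure. weak_grad (\<lambda>x. f x + g x) x = weak_grad f x + weak_grad g x"
proof -
  note F = torus_H1_weak_grad[OF f] and G = torus_H1_weak_grad[OF g]
  have L: "(\<lambda>x. f x + g x) \<in> torus_Lp 2" "(\<lambda>x. weak_grad f x + weak_grad g x) \<in> torus_Lp 2"
    using F G by (auto intro!: torus_Lp_add)
  have W: "has_weak_grad (\<lambda>x. f x + g x) (\<lambda>x. weak_grad f x + weak_grad g x)"
    unfolding has_weak_grad_def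
  proof (intro ballI allI)
    fix \<phi> :: "real ^ 'n \<Rightarrow> real" and i assume \<phi>: "\<phi> \<in> torus_smooth"
    note S = torus_smooth_Lp[OF \<phi>, of 2]
    have "integrable torus_measure (\<lambda>x. f x * grad \<phi> x $ i)" "integrable torus_measure (\<lambda>x. g x * grad \<phi> x $ i)"
      using torus_L2_component_inner[OF S(2) F(1), of i] torus_L2_component_inner[OF S(2) G(1), of i]
      by (simp_all add: mult.commute)
    moreover have "integrable torus_measure (\<lambda>x. weak_grad f x $ i * \<phi> x)" "integrable torus_measure (\<lambda>x. weak_grad g x $ i * \<phi> x)"
      using torus_L2_component_inner[OF F(2) S(1), of i] torus_L2_component_inner[OF G(2) S(1), of i] by simp_all
    ultimately show "(\<integral>x. (f x + g x) * grad \<phi> x $ i \<partial>torus_measure) =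
        - (\<integral>x. (weak_grad f x + weak_grad g x) $ i * \<phi> x \<partial>torus_measure)"
      using F(3) G(3) \<phi> unfolding has_weak_grad_def by (simp add: distrib_right)
  qed
  show "(\<lambda>x. f x + g x) \<in> torus_H1"
    "AE x in torus_measure. weak_grad (\<lambda>x. f x + g x) x = weak_grad f x + weak_grad g x"
    by (rule has_weak_grad_in_H1[OF \<rho> L W])+
qed

lemma torus_H1_scale:
  assumes \<rho>: "convolution_kernel (\<rho> :: real ^ 'n \<Rightarrow> real)" and f: "(f :: real ^ 'n \<Rightarrow> real) \<in> torus_H1"
  shows "(\<lambda>x. c * f x) \<in> torus_H1"
    "AE x in torus_measure. weak_grad (\<lambda>x. c * f x) x = c *\<^sub>R weak_grad f x"
proof -
  note F = torus_H1_weak_grad[OF f]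
  have L: "(\<lambda>x. c * f x) \<in> torus_Lp 2" using torus_Lp_scaleR[OF F(1), of c] by simp
  have L': "(\<lambda>x. c *\<^sub>R weak_grad f x) \<in> torus_Lp 2" by (rule torus_Lp_scaleR[OF F(2)])
  have W: "has_weak_grad (\<lambda>x. c * f x) (\<lambda>x. c *\<^sub>R weak_grad f x)"
    using F(3) unfolding has_weak_grad_def by (simp add: mult.assoc)
  show "(\<lambda>x. c * f x) \<in> torus_H1"
    "AE x in torus_measure. weak_grad (\<lambda>x. c * f x) x = c *\<^sub>R weak_grad f x"
    by (rule has_weak_grad_in_H1[OF \<rho> L L' W])+
qed

text \<open>
  Makes the supremum in the dual norm range over a nonempty set.
\<close>

lemma torus_H1_zero:
  assumes \<rho>: "convolution_kernel (\<rho> :: real ^ 'n \<Rightarrow> real)"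
  shows "(\<lambda>_ :: real ^ 'n. 0 :: real) \<in> torus_H1" "torus_H1_norm (\<lambda>_ :: real ^ 'n. 0 :: real) = 0"
proof -
  have L: "(\<lambda>_ :: real ^ 'n. 0 :: 'b::euclidean_space) \<in> torus_Lp 2"
    by (rule torus_Lp_bounded[where C = 0]) (auto simp: torus_periodic_def)
  have w: "has_weak_grad (\<lambda>_ :: real ^ 'n. 0) (\<lambda>_. 0)" by (simp add: has_weak_grad_def)
  show H: "(\<lambda>_ :: real ^ 'n. 0 :: real) \<in> torus_H1" by (rule has_weak_grad_in_H1(1)[OF \<rho> L L w])
  have "AE x in torus_measure. weak_grad (\<lambda>_ :: real ^ 'n. 0) x = 0" by (rule has_weak_grad_in_H1(2)[OF \<rho> L L w])
  then have "AE x in torus_measure. (norm (weak_grad (\<lambda>_ :: real ^ 'n. 0) x))\<^sup>2 = 0"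
    by eventually_elim simp
  then have "(\<integral>x. (norm (weak_grad (\<lambda>_ :: real ^ 'n. 0) x))\<^sup>2 \<partial>torus_measure) = 0"
    by (rule integral_eq_zero_AE)
  then show "torus_H1_norm (\<lambda>_ :: real ^ 'n. 0 :: real) = 0"
    unfolding torus_H1_norm_def by (simp add: torus_L2_sq(2)[OF torus_H1_weak_grad(2)[OF H]] torus_L2_sq(2)[OF L])
qed

section \<open>Functionals given by vector fields\<close>

text \<open>
  The functional \<open>- div G\<close> on the Sobolev space, tested against weak gradients.
\<close>

definition flux_functional :: "(real ^ 'n \<Rightarrow> real ^ 'n) \<Rightarrow> (real ^ 'n \<Rightarrow> real) \<Rightarrow> real" where
  "flux_functional G f = (\<integral>x. G x \<bullet> weak_grad f x \<partial>torus_measure)"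

lemma flux_functional_bound:
  assumes "G \<in> torus_Lp 2" "f \<in> torus_H1"
  shows "\<bar>flux_functional G f\<bar> \<le> torus_Lp_norm 2 G * torus_H1_norm f"
proof -
  have "\<bar>flux_functional G f\<bar> \<le> torus_Lp_norm 2 G * torus_Lp_norm 2 (weak_grad f)"
    unfolding flux_functional_def by (rule torus_L2_inner(2)[OF assms(1) torus_H1_weak_grad(2)[OF assms(2)]])
  also have "torus_Lp_norm 2 (weak_grad f) \<le> torus_H1_norm f"
    unfolding torus_H1_norm_def by (rule real_le_rsqrt) simp
  finally show ?thesis by (simp add: mult_left_mono)
qed

lemma integral_torus_cong_AE:
  fixes f g :: "real ^ 'n \<Rightarrow> real"
  assumes "integrable torus_measure f" "integrable torus_measure g" "AE x in torus_measure. f x = g x"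
  shows "(\<integral>x. f x \<partial>torus_measure) = (\<integral>x. g x \<partial>torus_measure)"
  using assms by (intro integral_cong_AE) auto

text \<open>
  The gradient of a sum is fixed by an arbitrary choice; uniqueness up to null sets makes the
  functional linear nevertheless.
\<close>

lemma flux_functional_in_Hm1:
  assumes \<rho>: "convolution_kernel (\<rho> :: real ^ 'n \<Rightarrow> real)" and G: "(G :: real ^ 'n \<Rightarrow> real ^ 'n) \<in> torus_Lp 2"
  shows "flux_functional G \<in> torus_Hm1"
proof -
  have I: "integrable torus_measure (\<lambda>x. G x \<bullet> weak_grad f x)" if "f \<in> torus_H1" for f
    by (rule torus_L2_inner(1)[OF G torus_H1_weak_grad(2)[OF that]])
  have "flux_functional G (\<lambda>x. f x + g x) = flux_functional G f + flux_functional G g"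
    if fg: "f \<in> torus_H1" "g \<in> torus_H1" for f g
  proof -
    note A = torus_H1_add[OF \<rho> fg]
    have "flux_functional G (\<lambda>x. f x + g x) = (\<integral>x. G x \<bullet> weak_grad f x + G x \<bullet> weak_grad g x \<partial>torus_measure)"
      unfolding flux_functional_def
    proof (rule integral_torus_cong_AE)
      show "AE x in torus_measure. G x \<bullet> weak_grad (\<lambda>x. f x + g x) x = G x \<bullet> weak_grad f x + G x \<bullet> weak_grad g x"
        using A(2) by eventually_elim (simp add: inner_add_right)
    qed (use I[OF A(1)] I[OF fg(1)] I[OF fg(2)] in auto)
    then show ?thesis using I[OF fg(1)] I[OF fg(2)] by (simp add: flux_functional_def)
  qed
  moreover have "flux_functional G (\<lambda>x. c * f x) = c * flux_functional G f" if f: "f \<in> torus_H1" for f c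
  proof -
    note A = torus_H1_scale[OF \<rho> f, of c]
    have "flux_functional G (\<lambda>x. c * f x) = (\<integral>x. c * (G x \<bullet> weak_grad f x) \<partial>torus_measure)"
      unfolding flux_functional_def
    proof (rule integral_torus_cong_AE)
      show "AE x in torus_measure. G x \<bullet> weak_grad (\<lambda>x. c * f x) x = c * (G x \<bullet> weak_grad f x)"
        using A(2) by eventually_elim simp
    qed (use I[OF A(1)] I[OF f] in auto)
    then show ?thesis by (simp add: flux_functional_def)
  qed
  moreover have "\<exists>C. \<forall>f\<in>torus_H1. \<bar>flux_functional G f\<bar> \<le> C * torus_H1_norm f"
    using flux_functional_bound[OF G] by blast
  ultimately show ?thesis by (simp add: torus_Hm1_def)
qed

lemma torus_H1_norm_nonneg: "0 \<le> torus_H1_norm f"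
  by (simp add: torus_H1_norm_def)

lemma torus_Hm1_bounded:
  "\<Lambda> \<in> torus_Hm1 \<Longrightarrow> \<exists>C. \<forall>f\<in>torus_H1. \<bar>\<Lambda> f\<bar> \<le> C * torus_H1_norm f"
  by (simp add: torus_Hm1_def)

lemma torus_Hm1_norm_le:
  assumes \<rho>: "convolution_kernel (\<rho> :: real ^ 'n \<Rightarrow> real)" and C: "C \<ge> 0"
    and bound: "\<And>f :: real ^ 'n \<Rightarrow> real. f \<in> torus_H1 \<Longrightarrow> \<bar>\<Lambda> f\<bar> \<le> C * torus_H1_norm f"
  shows "torus_Hm1_norm \<Lambda> \<le> C"
  unfolding torus_Hm1_norm_def
proof (rule cSUP_least)
  show "{f :: real ^ 'n \<Rightarrow> real. f \<in> torus_H1 \<and> torus_H1_norm f \<le> 1} \<noteq> {}"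
    using torus_H1_zero[OF \<rho>] by (metis (mono_tags, lifting) empty_iff mem_Collect_eq zero_le_one)
  fix f :: "real ^ 'n \<Rightarrow> real" assume "f \<in> {f. f \<in> torus_H1 \<and> torus_H1_norm f \<le> 1}"
  then have f: "f \<in> torus_H1" "torus_H1_norm f \<le> 1" by auto
  have "\<bar>\<Lambda> f\<bar> \<le> C * torus_H1_norm f" by (rule bound[OF f(1)])
  also have "\<dots> \<le> C" using mult_left_mono[OF f(2) C] by simp
  finally show "\<bar>\<Lambda> f\<bar> \<le> C" .
qed

text \<open>
  A supremum of reals has its expected meaning only for sets bounded above, hence the premise.
\<close>

lemma torus_Hm1_norm_upper:
  assumes bound: "\<And>f :: real ^ 'n \<Rightarrow> real. f \<in> torus_H1 \<Longrightarrow> \<bar>\<Lambda> f\<bar> \<le> C * torus_H1_norm f"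
    and f: "f \<in> torus_H1" "torus_H1_norm f \<le> 1"
  shows "\<bar>\<Lambda> f\<bar> \<le> torus_Hm1_norm \<Lambda>"
  unfolding torus_Hm1_norm_def
proof (rule cSUP_upper)
  show "bdd_above ((\<lambda>f. \<bar>\<Lambda> f\<bar>) ` {f \<in> torus_H1. torus_H1_norm f \<le> 1})"
  proof (rule bdd_aboveI2)
    fix f :: "real ^ 'n \<Rightarrow> real" assume "f \<in> {f \<in> torus_H1. torus_H1_norm f \<le> 1}"
    then have f: "f \<in> torus_H1" "torus_H1_norm f \<le> 1" by auto
    have "\<bar>\<Lambda> f\<bar> \<le> C * torus_H1_norm f" by (rule bound[OF f(1)])
    also have "\<dots> \<le> \<bar>C\<bar> * torus_H1_norm f"
      by (intro mult_right_mono torus_H1_norm_nonneg abs_ge_self)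
    also have "\<dots> \<le> \<bar>C\<bar>" using mult_left_mono[OF f(2), of "\<bar>C\<bar>"] by simp
    finally show "\<bar>\<Lambda> f\<bar> \<le> \<bar>C\<bar>" .
  qed
qed (use f in auto)

lemma torus_Hm1_norm_nonneg:
  assumes \<rho>: "convolution_kernel (\<rho> :: real ^ 'n \<Rightarrow> real)"
    and \<Lambda>: "(\<Lambda> :: (real ^ 'n \<Rightarrow> real) \<Rightarrow> real) \<in> torus_Hm1"
  shows "0 \<le> torus_Hm1_norm \<Lambda>"
proof -
  obtain C where C: "\<And>f. f \<in> torus_H1 \<Longrightarrow> \<bar>\<Lambda> f\<bar> \<le> C * torus_H1_norm f" using torus_Hm1_bounded[OF \<Lambda>] by blast
  have "\<bar>\<Lambda> (\<lambda>_. 0)\<bar> \<le> torus_Hm1_norm \<Lambda>"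
    by (rule torus_Hm1_norm_upper[OF C torus_H1_zero(1)[OF \<rho>]]) (simp_all add: torus_H1_zero(2)[OF \<rho>])
  then show ?thesis by linarith
qed

lemma torus_Hm1_norm_triangle:
  assumes \<rho>: "convolution_kernel (\<rho> :: real ^ 'n \<Rightarrow> real)"
    and A: "(A :: (real ^ 'n \<Rightarrow> real) \<Rightarrow> real) \<in> torus_Hm1" and B: "B \<in> torus_Hm1"
  shows "\<bar>torus_Hm1_norm A - torus_Hm1_norm B\<bar> \<le> torus_Hm1_norm (A - B)"
proof -
  obtain a where a: "\<And>f. f \<in> torus_H1 \<Longrightarrow> \<bar>A f\<bar> \<le> a * torus_H1_norm f" using torus_Hm1_bounded[OF A] by blast
  obtain b where b: "\<And>f. f \<in> torus_H1 \<Longrightarrow> \<bar>B f\<bar> \<le> b * torus_H1_norm f" using torus_Hm1_bounded[OF B] by blast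
  have d: "\<bar>(A - B) f\<bar> \<le> (a + b) * torus_H1_norm f" if "f \<in> torus_H1" for f
    using a[OF that] b[OF that] by (simp add: distrib_right)
  have ne: "{f :: real ^ 'n \<Rightarrow> real. f \<in> torus_H1 \<and> torus_H1_norm f \<le> 1} \<noteq> {}"
    using torus_H1_zero[OF \<rho>] by (metis (mono_tags, lifting) empty_iff mem_Collect_eq zero_le_one)
  have "\<bar>A f\<bar> \<le> torus_Hm1_norm B + torus_Hm1_norm (A - B)" "\<bar>B f\<bar> \<le> torus_Hm1_norm A + torus_Hm1_norm (A - B)"
    if f: "f \<in> torus_H1" "torus_H1_norm f \<le> 1" for f
    using torus_Hm1_norm_upper[OF a f] torus_Hm1_norm_upper[OF b f] torus_Hm1_norm_upper[OF d f]
      minus_apply[of A B f] by linarith+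
  then have "(SUP f\<in>{f \<in> torus_H1. torus_H1_norm f \<le> 1}. \<bar>A f\<bar>) \<le> torus_Hm1_norm B + torus_Hm1_norm (A - B)"
    "(SUP f\<in>{f \<in> torus_H1. torus_H1_norm f \<le> 1}. \<bar>B f\<bar>) \<le> torus_Hm1_norm A + torus_Hm1_norm (A - B)"
    by (intro cSUP_least[OF ne]; simp)+
  then have "torus_Hm1_norm A \<le> torus_Hm1_norm B + torus_Hm1_norm (A - B)"
    "torus_Hm1_norm B \<le> torus_Hm1_norm A + torus_Hm1_norm (A - B)"
    by (simp_all only: torus_Hm1_norm_def[of A, symmetric] torus_Hm1_norm_def[of B, symmetric])
  then show ?thesis by linarith
qed

lemma flux_functional_norm_le:
  assumes \<rho>: "convolution_kernel (\<rho> :: real ^ 'n \<Rightarrow> real)" and G: "(G :: real ^ 'n \<Rightarrow> real ^ 'n) \<in> torus_Lp 2"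
  shows "torus_Hm1_norm (flux_functional G) \<le> torus_Lp_norm 2 G"
  by (rule torus_Hm1_norm_le[OF \<rho>]) (simp_all add: flux_functional_bound[OF G])

section \<open>The commutator as a functional on the Sobolev space\<close>

text \<open>
  The adjoint of convolution with \<open>k\<close> averages over \<open>x + y\<close> instead of \<open>x - y\<close>.
\<close>

lemma grad_torus_conv_reflected:
  fixes k \<phi> :: "real ^ 'n \<Rightarrow> real"
  assumes k: "prob_kernel k" and \<phi>: "\<phi> \<in> torus_smooth"
  shows "grad (torus_conv \<phi> (\<lambda>y. k (- y))) x = (\<integral>y. k y *\<^sub>R grad \<phi> (x + y) \<partial>lborel)"
    "integrable lborel (\<lambda>y. k y *\<^sub>R grad \<phi> (x + y))"
proof -
  have [measurable]: "k \<in> borel_measurable borel" and k0: "\<And>y. 0 \<le> k y"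
    and k1: "(\<integral>\<^sup>+y. ennreal (k y) \<partial>lborel) = 1" using k by (auto simp: prob_kernel_def)
  note \<phi>' = torus_smoothD[OF \<phi>]
  note [measurable] = \<phi>'(6,7)
  obtain C where C: "C > 0" "\<And>x. \<bar>\<phi> x\<bar> \<le> C" "\<And>x. norm (grad \<phi> x) \<le> C"
    using torus_smooth_bounded[OF \<phi>] by blast
  have ik: "integrable lborel k" using k0 k1 by (auto intro!: integrableI_nonneg)
  show "integrable lborel (\<lambda>y. k y *\<^sub>R grad \<phi> (x + y))"
  proof (rule Bochner_Integration.integrable_bound[of _ "\<lambda>y. C * k y"])
    show "AE y in lborel. norm (k y *\<^sub>R grad \<phi> (x + y)) \<le> norm (C * k y)"
      using C k0 by (intro AE_I2) (auto simp: abs_mult mult.commute[of C] intro!: mult_left_mono)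
  qed (use ik in auto)
  have ik': "integrable lborel (\<lambda>y. k (- y))"
  proof -
    have "integrable (distr lborel borel (\<lambda>y. 0 - y)) k" using ik by (simp only: lborel_distr_reflect)
    then show ?thesis by (subst (asm) integrable_distr_eq) auto
  qed
  have "torus_conv \<phi> (\<lambda>y. k (- y)) = (\<lambda>x. \<integral>y. k (- y) * \<phi> (x - y) \<partial>lborel)"
  proof
    fix x
    have "torus_conv \<phi> (\<lambda>y. k (- y)) x = (\<integral>y. \<phi> (x - y) * k (- y) \<partial>lborel)"
      unfolding torus_conv_def by (rule integral_completion) measurable
    then show "torus_conv \<phi> (\<lambda>y. k (- y)) x = (\<integral>y. k (- y) * \<phi> (x - y) \<partial>lborel)" by (simp add: mult.commute)
  qed
  then have "grad (torus_conv \<phi> (\<lambda>y. k (- y))) x = (\<integral>y. k (- y) *\<^sub>R grad \<phi> (x - y) \<partial>lborel)"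
    using grad_eqI[OF convolution_has_derivative[OF ik' \<phi>'(1) \<phi>'(7) C(3) C(2)]] by simp
  also have "\<dots> = (\<integral>y. k y *\<^sub>R grad \<phi> (x + y) \<partial>lborel)"
    using integral_lborel_reflect[of "\<lambda>y. k y *\<^sub>R grad \<phi> (x + y)" 0] by simp
  finally show "grad (torus_conv \<phi> (\<lambda>y. k (- y))) x = (\<integral>y. k y *\<^sub>R grad \<phi> (x + y) \<partial>lborel)" .
qed

lemma torus_conv_AE_cong:
  fixes k w w' :: "real ^ 'n \<Rightarrow> real"
  assumes [measurable]: "k \<in> borel_measurable borel" "w' \<in> borel_measurable borel"
    and w: "AE x in lborel. w x = w' x"
  shows "torus_conv w k x = (\<integral>y. k y * w' (x - y) \<partial>lborel)"
proof -
  have "AE y in lborel. w (x - y) * k y = k y * w' (x - y)"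
    using AE_lborel_reflect[OF w, of x] by eventually_elim simp
  then show ?thesis unfolding torus_conv_def by (intro integral_lebesgue_AE) measurable
qed

text \<open>
  Both terms of the commutator are double integrals over the cube and the kernel variable. In the
  mollified distribution the kernel falls on \<open>grad \<phi>\<close>; a translation of the torus by \<open>- y\<close> moves it
  to \<open>w b\<close>. The difference is then an integral of \<open>k y * w (x - y) * (b (x - y) - b x) \<bullet> grad \<phi> x\<close>.
\<close>

lemma commutator_eq_integral_field:
  fixes b :: "real ^ 'n \<Rightarrow> real ^ 'n" and w :: "real ^ 'n \<Rightarrow> real"
  assumes pq: "p > 0" "q > 0" "1 / p + 1 / q \<le> 1 / 2" and k: "prob_kernel k"
    and b: "b \<in> torus_Lp p" and w: "w \<in> torus_Lp q" and \<phi>: "\<phi> \<in> torus_smooth"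
  shows "commutator k b w \<phi> = (\<integral>x. commutator_field k b w x \<bullet> grad \<phi> x \<partial>torus_measure)"
proof -
  have km [measurable]: "k \<in> borel_measurable borel" using k by (simp add: prob_kernel_def)
  note \<phi>' = torus_smoothD[OF \<phi>]
  note [measurable] = \<phi>'(6,7)
  obtain C where C: "C > 0" "\<And>x. norm (grad \<phi> x) \<le> C" using torus_smooth_bounded[OF \<phi>] by blast
  obtain b' where b' [measurable]: "b' \<in> borel_measurable borel" and b'': "torus_periodic b'" "AE x in lborel. b x = b' x"
    "power_integral p b' = ennreal (torus_Lp_norm p b powr p)"
    by (rule torus_Lp_borel_representative[OF b pq(1)])
  obtain w' where w' [measurable]: "w' \<in> borel_measurable borel" and w'': "torus_periodic w'" "AE x in lborel. w x = w' x"
    "power_integral q w' = ennreal (torus_Lp_norm q w powr q)"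
    by (rule torus_Lp_borel_representative[OF w pq(2)])
  define A B where "A = torus_Lp_norm q w" and "B = torus_Lp_norm p b"
  have AB: "A \<ge> 0" "B \<ge> 0" by (simp_all add: A_def B_def)
  have bn: "power_integral p b' \<le> ennreal (B powr p)"
    and wn: "power_integral q w' \<le> ennreal (A powr q)"
    using b''(3) w''(3) by (simp_all add: A_def B_def)
  have sq: "(\<integral>\<^sup>+x. ennreal ((norm (F x))\<^sup>2) \<partial>unit_cube) \<le> ennreal (C\<^sup>2 * (A * B)\<^sup>2)"
    if F: "\<And>x. \<bar>F x\<bar> \<le> C * (\<bar>w' (x - a)\<bar> * norm (b' (x - c)))" for F :: "real ^ 'n \<Rightarrow> real" and a c
  proof -
    have "(\<integral>\<^sup>+x. ennreal ((norm (F x))\<^sup>2) \<partial>unit_cube) \<le>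
        (\<integral>\<^sup>+x. ennreal (C\<^sup>2) * ennreal ((\<bar>w' (x - a)\<bar> * norm (b' (x - c)))\<^sup>2) \<partial>unit_cube)"
    proof (rule nn_integral_mono)
      fix x
      have "(norm (F x))\<^sup>2 \<le> (C * (\<bar>w' (x - a)\<bar> * norm (b' (x - c))))\<^sup>2"
        using F[of x] by (intro power_mono) auto
      then have "ennreal ((norm (F x))\<^sup>2) \<le> ennreal (C\<^sup>2 * (\<bar>w' (x - a)\<bar> * norm (b' (x - c)))\<^sup>2)"
        by (intro ennreal_leI) (simp add: power_mult_distrib)
      then show "ennreal ((norm (F x))\<^sup>2) \<le> ennreal (C\<^sup>2) * ennreal ((\<bar>w' (x - a)\<bar> * norm (b' (x - c)))\<^sup>2)"
        by (simp add: ennreal_mult)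
    qed
    also have "\<dots> = ennreal (C\<^sup>2) * (\<integral>\<^sup>+x. ennreal ((\<bar>w' (x - a)\<bar> * norm (b' (x - c)))\<^sup>2) \<partial>unit_cube)"
      by (rule nn_integral_cmult) measurable
    also have "\<dots> \<le> ennreal (C\<^sup>2) * ennreal ((A * B)\<^sup>2)"
      by (intro mult_left_mono product_shift_sq_le[OF pq AB b' w' b''(1) w''(1) bn wn]) simp
    finally show ?thesis by (simp add: ennreal_mult)
  qed
  have cs: "\<bar>u * (v \<bullet> grad \<phi> z)\<bar> \<le> C * (\<bar>u\<bar> * norm v)" for u v z
  proof -
    have "\<bar>v \<bullet> grad \<phi> z\<bar> \<le> norm v * norm (grad \<phi> z)" by (rule Cauchy_Schwarz_ineq2)
    also have "\<dots> \<le> norm v * C" by (intro mult_left_mono C) simp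
    finally have "\<bar>u\<bar> * \<bar>v \<bullet> grad \<phi> z\<bar> \<le> \<bar>u\<bar> * (norm v * C)" by (intro mult_left_mono) auto
    then show ?thesis by (simp add: abs_mult mult_ac)
  qed
  \<comment> \<open>The integrands of the mollified transport term before (\<open>F0\<close>) and after (\<open>F1\<close>) the translation,
    and of the transport of the mollified density (\<open>F2\<close>).\<close>
  define F0 F1 F2 where "F0 x y = w' x * (b' x \<bullet> grad \<phi> (x + y))"
    and "F1 x y = w' (x - y) * (b' (x - y) \<bullet> grad \<phi> x)"
    and "F2 x y = w' (x - y) * (b' x \<bullet> grad \<phi> x)" for x y :: "real ^ 'n"
  define F3 where "F3 x y = w' (x - y) *\<^sub>R (b' (x - y) - b' x)" for x y :: "real ^ 'n"
  note [measurable] = b' w' km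
  have Fm: "(\<lambda>z. F0 (fst z) (snd z)) \<in> borel_measurable (borel \<Otimes>\<^sub>M borel)"
    "(\<lambda>z. F1 (fst z) (snd z)) \<in> borel_measurable (borel \<Otimes>\<^sub>M borel)"
    "(\<lambda>z. F2 (fst z) (snd z)) \<in> borel_measurable (borel \<Otimes>\<^sub>M borel)"
    unfolding F0_def F1_def F2_def by measurable
  have I0: "integrable (unit_cube \<Otimes>\<^sub>M lborel) (\<lambda>z. k (snd z) *\<^sub>R F0 (fst z) (snd z))"
    by (rule kernel_average_integrable[OF k Fm(1)], rule sq[of _ 0 0]) (use cs in \<open>simp add: F0_def\<close>)
  have I1: "integrable (unit_cube \<Otimes>\<^sub>M lborel) (\<lambda>z. k (snd z) *\<^sub>R F1 (fst z) (snd z))"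
    by (rule kernel_average_integrable[OF k Fm(2)], rule sq) (unfold F1_def, rule cs)
  have I2: "integrable (unit_cube \<Otimes>\<^sub>M lborel) (\<lambda>z. k (snd z) *\<^sub>R F2 (fst z) (snd z))"
    by (rule kernel_average_integrable[OF k Fm(3)], rule sq[of _ _ 0]) (use cs in \<open>simp add: F2_def\<close>)
  have I3: "integrable (unit_cube \<Otimes>\<^sub>M lborel) (\<lambda>z. k (snd z) *\<^sub>R F3 (fst z) (snd z))"
  proof (rule kernel_average_integrable[OF k])
    show "(\<integral>\<^sup>+x. ennreal ((norm (F3 x y))\<^sup>2) \<partial>unit_cube) \<le> ennreal ((2 * A * B)\<^sup>2)" for y
      using oscillation_product_sq_le[OF pq AB b' w' b''(1) w''(1) bn wn, of y] by (simp add: F3_def)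
  qed (unfold F3_def, measurable)
  define J1 J2 where "J1 x = (\<integral>y. k y * F1 x y \<partial>lborel)" and "J2 x = (\<integral>y. k y * F2 x y \<partial>lborel)" for x

  have t1: "transport b (torus_conv w k) \<phi> = - (\<integral>x. J2 x \<partial>unit_cube)"
  proof -
    have "(\<integral>x. (torus_conv w k x *\<^sub>R b x) \<bullet> grad \<phi> x \<partial>torus_measure) = (\<integral>x. J2 x \<partial>unit_cube)"
    proof (rule integral_torus_measure_AE)
      show "J2 \<in> borel_measurable borel" unfolding J2_def F2_def by measurable
      show "AE x in lborel. (torus_conv w k x *\<^sub>R b x) \<bullet> grad \<phi> x = J2 x"
        using b''(2)
      proof eventually_elim
        case (elim x)
        have "(torus_conv w k x *\<^sub>R b x) \<bullet> grad \<phi> x = (\<integral>y. k y * w' (x - y) \<partial>lborel) * (b' x \<bullet> grad \<phi> x)"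
          by (simp add: elim torus_conv_AE_cong[OF km w' w''(2)])
        also have "\<dots> = J2 x" unfolding J2_def F2_def
          by (subst integral_mult_left_zero[symmetric]) (simp add: mult.assoc)
        finally show ?case .
      qed
    qed
    then show ?thesis by (simp add: transport_def distr_div_def)
  qed

  have t2: "distr_conv (transport b w) k \<phi> = - (\<integral>x. J1 x \<partial>unit_cube)"
  proof -
    have "(\<integral>x. (w x *\<^sub>R b x) \<bullet> grad (torus_conv \<phi> (\<lambda>y. k (- y))) x \<partial>torus_measure) =
        (\<integral>x. (\<integral>y. k y * F0 x y \<partial>lborel) \<partial>unit_cube)"
    proof (rule integral_torus_measure_AE)
      show "(\<lambda>x. \<integral>y. k y * F0 x y \<partial>lborel) \<in> borel_measurable borel" unfolding F0_def by measurable
      show "AE x in lborel. (w x *\<^sub>R b x) \<bullet> grad (torus_conv \<phi> (\<lambda>y. k (- y))) x = (\<integral>y. k y * F0 x y \<partial>lborel)"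
        using b''(2) w''(2)
      proof eventually_elim
        case (elim x)
        have "(w x *\<^sub>R b x) \<bullet> grad (torus_conv \<phi> (\<lambda>y. k (- y))) x =
            (w' x *\<^sub>R b' x) \<bullet> (\<integral>y. k y *\<^sub>R grad \<phi> (x + y) \<partial>lborel)"
          by (simp add: elim grad_torus_conv_reflected(1)[OF k \<phi>])
        also have "\<dots> = (\<integral>y. (w' x *\<^sub>R b' x) \<bullet> (k y *\<^sub>R grad \<phi> (x + y)) \<partial>lborel)"
          by (rule integral_inner_right[symmetric]) (rule grad_torus_conv_reflected(2)[OF k \<phi>])
        also have "\<dots> = (\<integral>y. k y * F0 x y \<partial>lborel)" by (simp add: F0_def mult_ac)
        finally show ?case .
      qed
    qed
    also have "\<dots> = (\<integral>y. (\<integral>x. k y * F0 x y \<partial>unit_cube) \<partial>lborel)"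
      by (rule cube_space.Fubini_integral[symmetric]) (use I0 in \<open>simp add: case_prod_unfold\<close>)
    also have "\<dots> = (\<integral>y. (\<integral>x. k y * F1 x y \<partial>unit_cube) \<partial>lborel)"
    proof (rule Bochner_Integration.integral_cong)
      fix y
      have "(\<integral>x. F0 (x + - y) y \<partial>unit_cube) = (\<integral>x. F0 x y \<partial>unit_cube)"
      proof (rule integral_torus_shift)
        show "(\<lambda>x. F0 x y) \<in> borel_measurable borel" unfolding F0_def by measurable
        have "torus_periodic (\<lambda>x. b' x \<bullet> grad \<phi> (x + y))"
          by (rule torus_periodic_comp2[OF b''(1) torus_periodic_shift[OF \<phi>'(5)]])
        then show "torus_periodic (\<lambda>x. F0 x y)"
          unfolding F0_def by (rule torus_periodic_comp2[OF w''(1)])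
      qed
      then show "(\<integral>x. k y * F0 x y \<partial>unit_cube) = (\<integral>x. k y * F1 x y \<partial>unit_cube)"
        by (simp add: F0_def F1_def)
    qed simp
    also have "\<dots> = (\<integral>x. J1 x \<partial>unit_cube)"
      unfolding J1_def by (rule cube_space.Fubini_integral) (use I1 in \<open>simp add: case_prod_unfold\<close>)
    finally show ?thesis by (simp add: distr_conv_def transport_def distr_div_def)
  qed

  have i1: "integrable unit_cube J1" using cube_space.integrable_fst'[OF I1] by (simp add: J1_def[abs_def])
  have i2: "integrable unit_cube J2" using cube_space.integrable_fst'[OF I2] by (simp add: J2_def[abs_def])
  have "commutator k b w \<phi> = (\<integral>x. J1 x - J2 x \<partial>unit_cube)"
    using i1 i2 by (simp add: commutator_def t1 t2)
  also have "\<dots> = (\<integral>x. commutator_field k b' w' x \<bullet> grad \<phi> x \<partial>unit_cube)"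
  proof (rule integral_cong_AE)
    show "(\<lambda>x. J1 x - J2 x) \<in> borel_measurable unit_cube" using i1 i2 by auto
    show "(\<lambda>x. commutator_field k b' w' x \<bullet> grad \<phi> x) \<in> borel_measurable unit_cube" by measurable
    have "AE x in unit_cube. integrable lborel (\<lambda>y. k y * F1 x y)" using cube_space.AE_integrable_fst'[OF I1] by simp
    moreover have "AE x in unit_cube. integrable lborel (\<lambda>y. k y * F2 x y)" using cube_space.AE_integrable_fst'[OF I2] by simp
    moreover have "AE x in unit_cube. integrable lborel (\<lambda>y. k y *\<^sub>R F3 x y)" using cube_space.AE_integrable_fst'[OF I3] by simp
    ultimately show "AE x in unit_cube. J1 x - J2 x = commutator_field k b' w' x \<bullet> grad \<phi> x"
    proof eventually_elim
      case (elim x)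
      have "commutator_field k b' w' x = (\<integral>y. k y *\<^sub>R F3 x y \<partial>lborel)"
        unfolding commutator_field_def F3_def by (rule integral_completion) measurable
      then have "commutator_field k b' w' x \<bullet> grad \<phi> x = (\<integral>y. (k y *\<^sub>R F3 x y) \<bullet> grad \<phi> x \<partial>lborel)"
        using integral_inner_left[of "grad \<phi> x" lborel "\<lambda>y. k y *\<^sub>R F3 x y"] elim(3) by (simp del: inner_scaleR_left)
      also have "\<dots> = (\<integral>y. k y * F1 x y - k y * F2 x y \<partial>lborel)"
        by (simp add: F1_def F2_def F3_def inner_diff_left right_diff_distrib mult.assoc)
      also have "\<dots> = J1 x - J2 x" using elim by (simp add: J1_def J2_def)
      finally show ?case by simp
    qed
  qed
  also have "\<dots> = (\<integral>x. commutator_field k b w x \<bullet> grad \<phi> x \<partial>torus_measure)"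
  proof (rule integral_torus_measure_AE[symmetric])
    show "(\<lambda>x. commutator_field k b' w' x \<bullet> grad \<phi> x) \<in> borel_measurable borel" by measurable
    show "AE x in lborel. commutator_field k b w x \<bullet> grad \<phi> x = commutator_field k b' w' x \<bullet> grad \<phi> x"
      using commutator_field_AE_cong[OF km b' w' b''(2) w''(2)] by eventually_elim simp
  qed
  finally show ?thesis .
qed

lemma flux_functional_smooth:
  fixes G :: "real ^ 'n \<Rightarrow> real ^ 'n"
  assumes \<rho>: "convolution_kernel (\<rho> :: real ^ 'n \<Rightarrow> real)" and G: "G \<in> torus_Lp 2" and \<phi>: "\<phi> \<in> torus_smooth"
  shows "flux_functional G \<phi> = (\<integral>x. G x \<bullet> grad \<phi> x \<partial>torus_measure)"
  unfolding flux_functional_def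
proof (rule integral_torus_cong_AE)
  note W = torus_smooth_weak_grad[OF \<rho> \<phi>]
  show "integrable torus_measure (\<lambda>x. G x \<bullet> weak_grad \<phi> x)"
    by (rule torus_L2_inner(1)[OF G torus_H1_weak_grad(2)[OF W(1)]])
  show "integrable torus_measure (\<lambda>x. G x \<bullet> grad \<phi> x)"
    by (rule torus_L2_inner(1)[OF G torus_smooth_Lp(2)[OF \<phi>]]) simp
  show "AE x in torus_measure. G x \<bullet> weak_grad \<phi> x = G x \<bullet> grad \<phi> x"
    using W(2) by eventually_elim simp
qed

text \<open>
  Continuous dependence of the functional on \<open>(b, w)\<close>, which carries simple approximants of \<open>b\<close> and \<open>w\<close>
  to simple approximants of the commutator.
\<close>

lemma flux_commutator_field_diff:
  fixes b s :: "real ^ 'n \<Rightarrow> real ^ 'n" and w v :: "real ^ 'n \<Rightarrow> real"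
  assumes \<rho>: "convolution_kernel (\<rho> :: real ^ 'n \<Rightarrow> real)"
    and pq: "p > 0" "q > 0" "1 / p + 1 / q \<le> 1 / 2" and k: "prob_kernel k"
    and bs: "b \<in> torus_Lp p" "s \<in> torus_Lp p" and wv: "w \<in> torus_Lp q" "v \<in> torus_Lp q"
  shows "torus_Hm1_norm (flux_functional (commutator_field k b w) - flux_functional (commutator_field k s v)) \<le>
    2 * torus_Lp_norm q w * torus_Lp_norm p (b - s) + 2 * torus_Lp_norm q (w - v) * torus_Lp_norm p b
      + 2 * torus_Lp_norm q (w - v) * torus_Lp_norm p (b - s)"
    (is "_ \<le> ?C")
proof (rule torus_Hm1_norm_le[OF \<rho>])
  show "0 \<le> ?C" by simp
  let ?D = "flux_functional (commutator_field k b w) - flux_functional (commutator_field k s v)"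
  have d: "b - s \<in> torus_Lp p" "w - v \<in> torus_Lp q"
    using torus_Lp_diff[OF bs pq(1)] torus_Lp_diff[OF wv pq(2)] by (simp_all add: fun_diff_def)
  note L = commutator_field_L2[OF pq k]
  define G1 G2 G3 where "G1 = commutator_field k (b - s) w" and "G2 = commutator_field k b (w - v)"
    and "G3 = commutator_field k (b - s) (w - v)"
  have G: "G1 \<in> torus_Lp 2" "G2 \<in> torus_Lp 2" "G3 \<in> torus_Lp 2"
    unfolding G1_def G2_def G3_def by (intro L(1) bs wv d)+
  fix f :: "real ^ 'n \<Rightarrow> real" assume f: "f \<in> torus_H1"
  note D = torus_H1_weak_grad(2)[OF f]
  note I = torus_L2_inner(1)[OF _ D]
  have "flux_functional (commutator_field k b w) f - flux_functional (commutator_field k s v) f =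
      (\<integral>x. commutator_field k b w x \<bullet> weak_grad f x - commutator_field k s v x \<bullet> weak_grad f x \<partial>torus_measure)"
    unfolding flux_functional_def
    using I[OF L(1)[OF bs(1) wv(1)]] I[OF L(1)[OF bs(2) wv(2)]] by simp
  also have "\<dots> = (\<integral>x. G1 x \<bullet> weak_grad f x + G2 x \<bullet> weak_grad f x - G3 x \<bullet> weak_grad f x \<partial>torus_measure)"
  proof (rule integral_torus_cong_AE)
    show "AE x in torus_measure. commutator_field k b w x \<bullet> weak_grad f x - commutator_field k s v x \<bullet> weak_grad f x =
        G1 x \<bullet> weak_grad f x + G2 x \<bullet> weak_grad f x - G3 x \<bullet> weak_grad f x"
      using commutator_field_diff[OF pq k bs wv]
    proof eventually_elim
      case (elim x)
      have "commutator_field k b w x - commutator_field k s v x = G1 x + G2 x - G3 x"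
        using elim by (simp add: G1_def G2_def G3_def fun_diff_def)
      then show ?case by (simp add: inner_diff_left[symmetric] inner_add_left[symmetric])
    qed
  qed (use I[OF L(1)[OF bs(1) wv(1)]] I[OF L(1)[OF bs(2) wv(2)]] I[OF G(1)] I[OF G(2)] I[OF G(3)] in auto)
  also have "\<dots> = flux_functional G1 f + flux_functional G2 f - flux_functional G3 f"
    using I[OF G(1)] I[OF G(2)] I[OF G(3)] by (simp add: flux_functional_def)
  finally have "\<bar>?D f\<bar> \<le>
      \<bar>flux_functional G1 f\<bar> + \<bar>flux_functional G2 f\<bar> + \<bar>flux_functional G3 f\<bar>"
    unfolding minus_apply by linarith
  also have "\<dots> \<le> torus_Lp_norm 2 G1 * torus_H1_norm f + torus_Lp_norm 2 G2 * torus_H1_norm f + torus_Lp_norm 2 G3 * torus_H1_norm f"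
    by (intro add_mono flux_functional_bound G f)
  also have "\<dots> = (torus_Lp_norm 2 G1 + torus_Lp_norm 2 G2 + torus_Lp_norm 2 G3) * torus_H1_norm f"
    by (simp add: distrib_right)
  also have "\<dots> \<le> ?C * torus_H1_norm f"
    unfolding G1_def G2_def G3_def
    by (intro mult_right_mono add_mono L(2) bs wv d torus_H1_norm_nonneg)
  finally show "\<bar>?D f\<bar> \<le> ?C * torus_H1_norm f" .
qed

lemma torus_Hm1_norm_diff_nonneg:
  assumes "convolution_kernel (\<rho> :: real ^ 'n \<Rightarrow> real)"
    and "(A :: (real ^ 'n \<Rightarrow> real) \<Rightarrow> real) \<in> torus_Hm1" "B \<in> torus_Hm1"
  shows "0 \<le> torus_Hm1_norm (A - B)"
  using torus_Hm1_norm_triangle[OF assms] by linarith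

section \<open>Measurability in time and convergence\<close>

theorem lemma3p1:
  fixes b :: "real \<Rightarrow> real ^ 'n \<Rightarrow> real ^ 'n"
    and w :: "real \<Rightarrow> real ^ 'n \<Rightarrow> real"
    and \<rho> :: "real ^ 'n \<Rightarrow> real"
    and T p q :: real
  assumes "T > 0" and "p > 0" and "q > 0" and "1 / p + 1 / q \<le> 1 / 2"
    and "b \<in> bochner_L2 T (torus_Lp p) (torus_Lp_norm p)"
    and "divergence_free T b"
    and "w \<in> bochner_Linf T (torus_Lp q) (torus_Lp_norm q)"
    and "convolution_kernel \<rho>"
  shows "\<exists>R. (\<forall>\<delta>>0. represents_L2_Hm1 T (R \<delta>) (\<lambda>t. commutator (rescaled \<rho> \<delta>) (b t) (w t))) \<and>
    ((\<lambda>\<delta>. bochner_L2_norm T torus_Hm1_norm (R \<delta>)) \<longlongrightarrow> 0) (at_right 0)"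
proof -
  note pq = assms(2,3,4) and \<rho> = assms(8)
  let ?M = "lebesgue_on {0..T}"
  interpret M: complete_measure ?M by (rule complete_measure_lebesgue_on) simp
  obtain sb where sb: "\<And>n::nat. simple_function ?M (sb n)" "\<And>n. sb n ` {0..T} \<subseteq> torus_Lp p"
    and sb_lim: "AE t in ?M. b t \<in> torus_Lp p \<and> (\<lambda>n. torus_Lp_norm p (b t - sb n t)) \<longlonglongrightarrow> 0"
    using assms(5) unfolding bochner_L2_def strongly_measurable_def by blast
  have b2: "integrable ?M (\<lambda>t. (torus_Lp_norm p (b t))\<^sup>2)" using assms(5) by (simp add: bochner_L2_def)
  obtain sw where sw: "\<And>n::nat. simple_function ?M (sw n)" "\<And>n. sw n ` {0..T} \<subseteq> torus_Lp q"
    and sw_lim: "AE t in ?M. w t \<in> torus_Lp q \<and> (\<lambda>n. torus_Lp_norm q (w t - sw n t)) \<longlonglongrightarrow> 0"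
    using assms(7) unfolding bochner_Linf_def strongly_measurable_def by blast
  obtain K where K: "AE t in ?M. torus_Lp_norm q (w t) \<le> K" using assms(7) unfolding bochner_Linf_def by blast
  have AE_T: "AE t in ?M. t \<in> {0..T}" by (rule AE_I2) simp
  have ker: "prob_kernel (rescaled \<rho> \<delta>)" if "\<delta> > 0" for \<delta>
    by (intro prob_kernel_rescaled convolution_kernelD \<rho> that)
  define R where "R \<delta> t = flux_functional (commutator_field (rescaled \<rho> \<delta>) (b t) (w t))" for \<delta> t
  \<comment> \<open>Substituting simple functions of time for \<open>b\<close> and \<open>w\<close> gives a simple function of time.\<close>
  define S where "S \<delta> n t = flux_functional (commutator_field (rescaled \<rho> \<delta>) (sb n t) (sw n t))" for \<delta> n t
  note Hm1 = flux_functional_in_Hm1[OF \<rho> commutator_field_L2(1)[OF pq ker]]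
  have R_in: "AE t in ?M. R \<delta> t \<in> torus_Hm1" if "\<delta> > 0" for \<delta>
    using sb_lim sw_lim by eventually_elim (auto simp: R_def intro: Hm1 that)
  have S_in: "S \<delta> n t \<in> torus_Hm1" if "\<delta> > 0" "t \<in> {0..T}" for \<delta> n t
  proof -
    have "sb n t \<in> torus_Lp p" "sw n t \<in> torus_Lp q" using sb(2)[of n] sw(2)[of n] that(2) by blast+
    then show ?thesis unfolding S_def by (rule Hm1[OF that(1)])
  qed
  have S_simple: "simple_function ?M (S \<delta> n)" for \<delta> n
    unfolding S_def
    by (rule simple_function_compose2[OF sb(1) sw(1),
          where h = "\<lambda>c v. flux_functional (commutator_field (rescaled \<rho> \<delta>) c v)"])
  have S_lim: "AE t in ?M. (\<lambda>n. torus_Hm1_norm (R \<delta> t - S \<delta> n t)) \<longlonglongrightarrow> 0" if \<delta>: "\<delta> > 0" for \<delta>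
    using sb_lim sw_lim AE_T R_in[OF \<delta>]
  proof eventually_elim
    case (elim t)
    then have t: "b t \<in> torus_Lp p" "w t \<in> torus_Lp q" "sb n t \<in> torus_Lp p" "sw n t \<in> torus_Lp q" for n
      using sb(2)[of n] sw(2)[of n] by blast+
    let ?E = "\<lambda>n. 2 * torus_Lp_norm q (w t) * torus_Lp_norm p (b t - sb n t) + 2 * torus_Lp_norm q (w t - sw n t) * torus_Lp_norm p (b t)
        + 2 * torus_Lp_norm q (w t - sw n t) * torus_Lp_norm p (b t - sb n t)"
    have "?E \<longlonglongrightarrow>
        2 * torus_Lp_norm q (w t) * 0 + 2 * 0 * torus_Lp_norm p (b t) + 2 * 0 * 0"
      using elim by (intro tendsto_intros) auto
    then have lim: "?E \<longlonglongrightarrow> 0" by simp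
    show ?case
    proof (rule tendsto_sandwich[OF _ _ tendsto_const lim])
      show "\<forall>\<^sub>F n in sequentially. 0 \<le> torus_Hm1_norm (R \<delta> t - S \<delta> n t)"
        using elim S_in[OF \<delta>] by (intro always_eventually allI torus_Hm1_norm_diff_nonneg[OF \<rho>]) auto
      show "\<forall>\<^sub>F n in sequentially. torus_Hm1_norm (R \<delta> t - S \<delta> n t) \<le>
          ?E n"
        unfolding R_def S_def
        by (intro always_eventually allI flux_commutator_field_diff[OF \<rho> pq ker[OF \<delta>]] t)
    qed
  qed
  \<comment> \<open>The norm is an almost everywhere limit of simple functions; completeness of the Lebesgue measure
    makes it measurable.\<close>
  have N_meas: "(\<lambda>t. torus_Hm1_norm (R \<delta> t)) \<in> borel_measurable ?M" if \<delta>: "\<delta> > 0" for \<delta>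
  proof (rule M.borel_measurable_AE_cong)
    have "(\<lambda>t. torus_Hm1_norm (S \<delta> n t)) \<in> borel_measurable ?M" for n
      by (rule borel_measurable_simple_function[OF simple_function_compose1[OF S_simple, where g = torus_Hm1_norm]])
    then show "(\<lambda>t. lim (\<lambda>n. torus_Hm1_norm (S \<delta> n t))) \<in> borel_measurable ?M"
      by (rule borel_measurable_lim_metric)
    show "AE t in ?M. torus_Hm1_norm (R \<delta> t) = lim (\<lambda>n. torus_Hm1_norm (S \<delta> n t))"
      using S_lim[OF \<delta>] AE_T R_in[OF \<delta>]
    proof eventually_elim
      case (elim t)
      have "(\<lambda>n. torus_Hm1_norm (R \<delta> t) - torus_Hm1_norm (S \<delta> n t)) \<longlonglongrightarrow> 0"
      proof (rule Lim_null_comparison[OF _ elim(1)])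
        show "\<forall>\<^sub>F n in sequentially. norm (torus_Hm1_norm (R \<delta> t) - torus_Hm1_norm (S \<delta> n t)) \<le> torus_Hm1_norm (R \<delta> t - S \<delta> n t)"
          using elim S_in[OF \<delta>] torus_Hm1_norm_triangle[OF \<rho>] by (intro always_eventually allI) auto
      qed
      then have "(\<lambda>n. torus_Hm1_norm (R \<delta> t) - (torus_Hm1_norm (R \<delta> t) - torus_Hm1_norm (S \<delta> n t))) \<longlonglongrightarrow> torus_Hm1_norm (R \<delta> t) - 0"
        by (intro tendsto_intros)
      then show ?case by (simp add: limI)
    qed
  qed
  \<comment> \<open>The dominating function: it does not depend on \<open>\<delta>\<close> and is integrable because \<open>b\<close> is square
    integrable in time.\<close>
  have N_bound: "AE t in ?M. (torus_Hm1_norm (R \<delta> t))\<^sup>2 \<le> (2 * K)\<^sup>2 * (torus_Lp_norm p (b t))\<^sup>2" if \<delta>: "\<delta> > 0" for \<delta>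
    using sb_lim sw_lim K R_in[OF \<delta>]
  proof eventually_elim
    case (elim t)
    have "torus_Hm1_norm (R \<delta> t) \<le> torus_Lp_norm 2 (commutator_field (rescaled \<rho> \<delta>) (b t) (w t))"
      unfolding R_def using elim by (intro flux_functional_norm_le[OF \<rho>] commutator_field_L2(1)[OF pq ker[OF \<delta>]]) auto
    also have "\<dots> \<le> 2 * torus_Lp_norm q (w t) * torus_Lp_norm p (b t)"
      using elim by (intro commutator_field_L2(2)[OF pq ker[OF \<delta>]]) auto
    also have "\<dots> \<le> 2 * K * torus_Lp_norm p (b t)"
      using elim by (intro mult_right_mono mult_left_mono) auto
    finally have "(torus_Hm1_norm (R \<delta> t))\<^sup>2 \<le> (2 * K * torus_Lp_norm p (b t))\<^sup>2"
      using torus_Hm1_norm_nonneg[OF \<rho>] elim by (intro power_mono) auto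
    then show ?case by (simp add: power_mult_distrib)
  qed
  have dom: "integrable ?M (\<lambda>t. (2 * K)\<^sup>2 * (torus_Lp_norm p (b t))\<^sup>2)" using b2 by simp
  have rep: "represents_L2_Hm1 T (R \<delta>) (\<lambda>t. commutator (rescaled \<rho> \<delta>) (b t) (w t))" if \<delta>: "\<delta> > 0" for \<delta>
    unfolding represents_L2_Hm1_def bochner_L2_def mem_Collect_eq
  proof (intro conjI)
    show "strongly_measurable T torus_Hm1 torus_Hm1_norm (R \<delta>)"
      unfolding strongly_measurable_def
    proof (intro exI[of _ "S \<delta>"] conjI allI)
      show "simple_function ?M (S \<delta> n)" for n by (rule S_simple)
      show "S \<delta> n ` {0..T} \<subseteq> torus_Hm1" for n using S_in[OF \<delta>] by auto
      show "AE t in ?M. R \<delta> t \<in> torus_Hm1 \<and> (\<lambda>n. torus_Hm1_norm (R \<delta> t - S \<delta> n t)) \<longlonglongrightarrow> 0"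
        using R_in[OF \<delta>] S_lim[OF \<delta>] by eventually_elim simp
    qed
    show "integrable ?M (\<lambda>t. (torus_Hm1_norm (R \<delta> t))\<^sup>2)"
    proof (rule Bochner_Integration.integrable_bound[OF dom])
      show "(\<lambda>t. (torus_Hm1_norm (R \<delta> t))\<^sup>2) \<in> borel_measurable ?M" using N_meas[OF \<delta>] by simp
      show "AE t in ?M. norm ((torus_Hm1_norm (R \<delta> t))\<^sup>2) \<le> norm ((2 * K)\<^sup>2 * (torus_Lp_norm p (b t))\<^sup>2)"
        using N_bound[OF \<delta>] by eventually_elim simp
    qed
    show "AE t in ?M. \<forall>\<phi>\<in>torus_smooth. R \<delta> t \<phi> = commutator (rescaled \<rho> \<delta>) (b t) (w t) \<phi>"
      using sb_lim sw_lim
    proof eventually_elim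
      case (elim t)
      show ?case
      proof
        fix \<phi> :: "real ^ 'n \<Rightarrow> real" assume \<phi>: "\<phi> \<in> torus_smooth"
        show "R \<delta> t \<phi> = commutator (rescaled \<rho> \<delta>) (b t) (w t) \<phi>"
          unfolding R_def using elim
          by (subst flux_functional_smooth[OF \<rho> commutator_field_L2(1)[OF pq ker[OF \<delta>]] \<phi>],
              simp, simp, subst commutator_eq_integral_field[OF pq ker[OF \<delta>] _ _ \<phi>]) auto
      qed
    qed
  qed
  have "((\<lambda>\<delta>. bochner_L2_norm T torus_Hm1_norm (R \<delta>)) \<longlongrightarrow> 0) (at_right 0)"
  proof (rule tendsto_at_right_sequentially[of 0 1])
    fix d :: "nat \<Rightarrow> real" assume d: "\<And>n. 0 < d n" "d \<longlonglongrightarrow> 0"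
    obtain r where r: "r > 0" "\<And>y. \<rho> y \<noteq> 0 \<Longrightarrow> norm y \<le> r" using convolution_kernelD(3)[OF \<rho>] by blast
    have "(\<lambda>n. \<integral>t. (torus_Hm1_norm (R (d n) t))\<^sup>2 \<partial>?M) \<longlonglongrightarrow> (\<integral>t. 0 \<partial>?M)"
    proof (rule integral_dominated_convergence[OF _ _ dom])
      show "(\<lambda>t. (torus_Hm1_norm (R (d n) t))\<^sup>2) \<in> borel_measurable ?M" for n using N_meas[OF d(1)] by simp
      show "AE t in ?M. norm ((torus_Hm1_norm (R (d n) t))\<^sup>2) \<le> (2 * K)\<^sup>2 * (torus_Lp_norm p (b t))\<^sup>2" for n
        using N_bound[OF d(1)] by eventually_elim simp
      have "AE t in ?M. \<forall>n. R (d n) t \<in> torus_Hm1" using R_in[OF d(1)] by (simp add: AE_all_countable)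
      then show "AE t in ?M. (\<lambda>n. (torus_Hm1_norm (R (d n) t))\<^sup>2) \<longlonglongrightarrow> 0"
        using sb_lim sw_lim
      proof eventually_elim
        case (elim t)
        have "(\<lambda>n. torus_Hm1_norm (R (d n) t)) \<longlonglongrightarrow> 0"
        proof (rule LIMSEQ_I)
          fix e :: real assume e: "e > 0"
          define W where "W = torus_Lp_norm q (w t)"
          have W: "W \<ge> 0" by (simp add: W_def)
          \<comment> \<open>The summand one keeps the quotient meaningful when \<open>w t\<close> is null.\<close>
          define e' where "e' = e / (W + 1)"
          have e': "e' > 0" "W * e' < e" using e W by (simp_all add: e'_def field_simps)
          obtain \<eta> where \<eta>: "\<eta> > 0" "\<And>k w. prob_kernel k \<Longrightarrow> (\<And>y. k y \<noteq> 0 \<Longrightarrow> norm y < \<eta>) \<Longrightarrow> w \<in> torus_Lp q \<Longrightarrow>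
              torus_Lp_norm 2 (commutator_field k (b t) w) \<le> torus_Lp_norm q w * e'"
            using commutator_field_small[OF pq _ e'(1), of "b t"] elim by auto
          obtain n0 where n0: "\<And>n. n \<ge> n0 \<Longrightarrow> norm (d n - 0) < \<eta> / r"
            using LIMSEQ_D[OF d(2), of "\<eta> / r"] \<eta>(1) r(1) by auto
          show "\<exists>n0. \<forall>n\<ge>n0. norm (torus_Hm1_norm (R (d n) t) - 0) < e"
          proof (intro exI[of _ n0] allI impI)
            fix n assume "n \<ge> n0"
            then have "d n * r < \<eta>" using n0[of n] d(1)[of n] r(1) by (simp add: pos_less_divide_eq)
            then have supp: "norm y < \<eta>" if "rescaled \<rho> (d n) y \<noteq> 0" for y
              using rescaled_support[of \<rho> r "d n" y] r(2) d(1) that by force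
            have "torus_Hm1_norm (R (d n) t) \<le> torus_Lp_norm 2 (commutator_field (rescaled \<rho> (d n)) (b t) (w t))"
              unfolding R_def using elim by (intro flux_functional_norm_le[OF \<rho>] commutator_field_L2(1)[OF pq ker[OF d(1)]]) auto
            also have "\<dots> \<le> W * e'"
              unfolding W_def using elim supp by (intro \<eta>(2) ker[OF d(1)]) auto
            finally have "torus_Hm1_norm (R (d n) t) < e" using e'(2) by linarith
            then show "norm (torus_Hm1_norm (R (d n) t) - 0) < e"
              using torus_Hm1_norm_nonneg[OF \<rho>] elim by simp
          qed
        qed
        then show ?case using tendsto_power[of _ 0 sequentially 2] by fastforce
      qed
    qed simp
    then have "(\<lambda>n. sqrt (\<integral>t. (torus_Hm1_norm (R (d n) t))\<^sup>2 \<partial>?M)) \<longlonglongrightarrow> sqrt 0"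
      by (intro tendsto_real_sqrt) simp
    then show "(\<lambda>n. bochner_L2_norm T torus_Hm1_norm (R (d n))) \<longlonglongrightarrow> 0"
      by (simp add: bochner_L2_norm_def)
  qed simp
  with rep show ?thesis by blast
qed

end
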